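(* Let $n$ be a positive even integer, $p=\frac{n-2}2$, and let $Y_n$ be the one-vertex H-triangulation of $(S^3,K_n)$ described in the context, with distinguished edge $\overrightarrow{K_n}$. Then for every $\hbar>0$ (of the form $\hbar=(\mathsf b+\mathsf b^{-1})^{-2}$, $\mathsf b>0$) and for every $\tau\in\mathcal S_{Y_n\setminus Z}\times\overline{\mathcal S_Z}$ such that $\omega_{Y_n,\tau}$ vanishes on $\overrightarrow{K_n}$ and is equal to $2\pi$ on every other edge of $Y_n$, the limit $$\lim_{\alpha\to\tau,\ \alpha\in\mathcal S_{Y_n}}\Phi_{\mathsf b}\left(\frac{\pi-\omega_{Y_n,\alpha}(\overrightarrow{K_n})}{2\pi i\sqrt\hbar}\right)\mathcal Z_\hbar(Y_n,\alpha)$$ exists and its modulus is equal to $|J_{X_n}(\hbar,0)|$.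
   Context: Triangulations: a tetrahedron $T$ has totally ordered vertices $0,1,2,3$ and a sign $\varepsilon(T)=\pm1$ (recording whether the vertex order agrees with the orientation); $x_k(T)$ is its face opposite to vertex $k$. A triangulation $X$ consists of finitely many tetrahedra whose faces are all glued in pairs by the unique affine isomorphisms preserving vertex order; faces with the same name are glued. $X^k$ is the set of $k$-cells after gluing. $K_n$ is the twist knot with $n$ half-twists. For $n\geq2$ even, $p=\frac{n-2}2$, $f_0:=e_1$; write $T:(x_0,x_1,x_2,x_3)$. - $Y_n$ has tetrahedra $T_1,\dots,T_p,U,V,W,Z$ and faces $e_1,\dots,e_{p+1},f_1,\dots,f_p,v,r,s,s',g,u,m$: $T_k:(e_k,e_{k+1},f_k,f_{k-1})$ ($1\le k\le p$), $Z:(m,m,s,s')$ and $U:(r,v,s',g)$ of sign $+1$; $V:(s,g,f_p,u)$, $W:(u,v,r,e_{p+1})$ of sign $-1$. The edge $\overrightarrow{K_n}\in Y_n^1$ is the class of the edge $23$ of $Z$ and represents $K_n$ in $S^3$. - $X_n$ (an ideal triangulation of $S^3\setminus K_n$) has tetrahedra $T_1,\dots,T_p,U,V,W$: $T_k:(e_k,e_{k+1},f_k,f_{k-1})$ and $U:(r,v,s,g)$ of sign $+1$; $V:(s,g,f_p,u)$, $W:(u,v,r,e_{p+1})$ of sign $-1$. Angles: the set $\mathcal S_X$ of shape structures is the set of $\alpha=(a_T,b_T,c_T)_{T\in X^3}$ with $a_T,b_T,c_T\in(0,\pi)$, $a_T+b_T+c_T=\pi$ ($a_T$ at edges $01,23$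 of $T$, $b_T$ at $02,13$, $c_T$ at $03,12$). For $e\in X^1$, $\omega_{X,\alpha}(e)$ is the sum of the angles at all tetrahedral edges identified to $e$; $\mathcal A_X=\{\alpha\in\mathcal S_X:\omega_{X,\alpha}(e)=2\pi\ \forall e\in X^1\}$. $\mathcal S_{Y_n\setminus Z}$ denotes shape structures on all tetrahedra of $Y_n$ except $Z$; $\overline{\mathcal S_Z}$ the triples $(a_Z,b_Z,c_Z)\in[0,\pi]^3$ with sum $\pi$. Indices $k,U,V,W,Z$ refer to $T_k,U,V,W,Z$. Quantum dilogarithm: $\mathsf b>0$, $\hbar=(\mathsf b+\mathsf b^{-1})^{-2}$, $$\Phi_{\mathsf b}(z)=\exp\Big(\tfrac14\int_{\mathbb R+i0^+}\frac{e^{-2izw}\,dw}{\sinh(\mathsf bw)\sinh(\mathsf b^{-1}w)w}\Big)\quad\text{for }|\mathrm{Im}\,z|<\tfrac1{2\sqrt\hbar}$$ (contour: real line avoiding $0$ from above), extended meromorphically to $\mathbb C$. Partition function (for a shape structure $\alpha$): attach real variables $t_T$ to tetrahedra and variables to faces. The kinematical kernel is the tempered distribution on $\mathbb R^{X^3}$ $$\mathcal K_X(\mathbf t)=\int_{\mathbb R^{X^2}}d\mathbf x\prod_{T\in X^3}e^{2i\pi\varepsilon(T)x_0(T)t_T}\,\delta\big(x_0(T)-x_1(T)+x_2(T)\big)\,\delta\big(x_2(T)-x_3(T)+t_T\big),$$ where $x_i(T)$ denotes the component of $\mathbf x\in\mathbb R^{X^2}$ indexed by that face, and the expression is understood as the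 tempered distribution obtained by writing each delta as $\delta(x)=\int_{\mathbb R}e^{-2\pi ixw}dw$ and using Fourier inversion. The dynamical content is the Schwartz function of $\mathbf t$ $$\mathcal D_{\hbar,X}(\mathbf t,\alpha)=\prod_{T\in X^3}\frac{\exp(\hbar^{-1/2}c_Tt_T)}{\Phi_{\mathsf b}\big(t_T-\frac{i}{2\pi\sqrt\hbar}\varepsilon(T)(\pi-a_T)\big)^{\varepsilon(T)}},$$ and $\mathcal Z_\hbar(X,\alpha)=\int_{\mathbb R^{X^3}}\mathcal K_X(\mathbf t)\mathcal D_{\hbar,X}(\mathbf t,\alpha)d\mathbf t$ (pairing of a distribution with a Schwartz function). The value $J_{X_n}(\hbar,0)$: $$J_{X_n}(\hbar,0)=\int_{\mathcal Y'_{\hbar,\beta}}d\mathbf y'\,e^{2i\pi\mathbf y'^\top Q_n\mathbf y'+\frac1{\sqrt\hbar}\mathbf y'^\top\mathcal W_n}\frac{\Phi_{\mathsf b}(-y'_U)\Phi_{\mathsf b}(y'_W)}{\Phi_{\mathsf b}(y'_1)\cdots\Phi_{\mathsf b}(y'_p)\Phi_{\mathsf b}(y'_U)},$$ $\mathbf y'=(y'_1,\dots,y'_p,y'_U,y'_W)^\top$; $Q_n$ is symmetric with $(Q_n)_{jk}=\min(j,k)$, $(Q_n)_{jU}=j$ ($1\le j,k\le p$), $(Q_n)_{UU}=p+1$, $(Q_n)_{UW}=-\frac12$, other entries $0$; $\mathcal W_n$ has entries $-2\pi(kp-\frac{k(k-1)}2)$ ($1\le k\le p$), $-(p^2+p+3)\pi$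 (index $U$), $\pi$ (index $W$); and $$\mathcal Y'_{\hbar,\beta}=\prod_{k=1,\dots,p,U}\Big(\mathbb R-\tfrac{i(\pi-a_k)}{2\pi\sqrt\hbar}\Big)\times\Big(\mathbb R+\tfrac{i(\pi-a_W)}{2\pi\sqrt\hbar}\Big),$$ where the $a$'s are those of any angle structure $\beta\in\mathcal A_{X_n}$ with $a_U=a_V$; the value does not depend on the choice, by contour deformation. *)

theory Defs
  imports "HOL-Complex_Analysis.Complex_Analysis"
begin

section \<open>Ordered triangulations\<close>

text \<open>
  A tetrahedron has vertices \<open>0,1,2,3\<close>; \<open>face X T k\<close> is the name of the face of \<open>T\<close> opposite to
  vertex \<open>k\<close>, meaningful for \<open>k < 4\<close> only. Two faces carrying the same name are glued.
\<close>

record ('t, 'f) triangulation =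
  tets :: "'t set"
  tsign :: "'t \<Rightarrow> int"
  face :: "'t \<Rightarrow> nat \<Rightarrow> 'f"

definition faces :: "('t, 'f) triangulation \<Rightarrow> 'f set" where
  "faces X = {face X T k | T k. T \<in> tets X \<and> k < 4}"

text \<open>The increasing list of the three vertices of the face opposite to vertex \<open>k\<close>.\<close>

definition face_vertices :: "nat \<Rightarrow> nat list" where
  "face_vertices k = filter (\<lambda>i. i \<noteq> k) [0..<4]"

definition tet_edges :: "('t, 'f) triangulation \<Rightarrow> ('t \<times> nat \<times> nat) set" where
  "tet_edges X = {(T, i, j) | T i j. T \<in> tets X \<and> i < j \<and> j < 4}"

text \<open>
  The gluing of two equally named faces preserves the vertex order, so it sends the \<open>i\<close>-th vertex of
  one face to the \<open>i\<close>-th vertex of the other. The relation is symmetric; its reflexive transitive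
  closure is the identification of edges in the quotient space.
\<close>

definition edge_glue ::
    "('t, 'f) triangulation \<Rightarrow> (('t \<times> nat \<times> nat) \<times> ('t \<times> nat \<times> nat)) set" where
  "edge_glue X =
     {((T, face_vertices k ! i, face_vertices k ! j), (T', face_vertices l ! i, face_vertices l ! j))
        | T T' k l i j. T \<in> tets X \<and> T' \<in> tets X \<and> k < 4 \<and> l < 4 \<and> face X T k = face X T' l \<and>
                        i < j \<and> j < 3}"

definition edges :: "('t, 'f) triangulation \<Rightarrow> ('t \<times> nat \<times> nat) set set" where
  "edges X = tet_edges X // (edge_glue X)\<^sup>*"

section \<open>Shape structures\<close>

text \<open>
  A shape structure is a function from tetrahedra to triples \<open>(a, b, c)\<close>, extensional outside
  \<open>tets X\<close> (\<open>\<Pi>\<^sub>E\<close>), so that the product topology on functions induces on it the usual topology of a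
  subset of a Euclidean space indexed by \<open>tets X\<close>.
\<close>

type_synonym shape = "real \<times> real \<times> real"

definition shape_a :: "shape \<Rightarrow> real" where "shape_a s = fst s"
definition shape_b :: "shape \<Rightarrow> real" where "shape_b s = fst (snd s)"
definition shape_c :: "shape \<Rightarrow> real" where "shape_c s = snd (snd s)"

definition open_shapes :: "shape set" where
  "open_shapes = {(a, b, c). a \<in> {0<..<pi} \<and> b \<in> {0<..<pi} \<and> c \<in> {0<..<pi} \<and> a + b + c = pi}"

definition closed_shapes :: "shape set" where
  "closed_shapes = {(a, b, c). a \<in> {0..pi} \<and> b \<in> {0..pi} \<and> c \<in> {0..pi} \<and> a + b + c = pi}"

definition shape_structures :: "('t, 'f) triangulation \<Rightarrow> ('t \<Rightarrow> shape) set" where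
  "shape_structures X = (\<Pi>\<^sub>E T \<in> tets X. open_shapes)"

text \<open>Shape structures that may degenerate at the tetrahedron \<open>Z\<close>.\<close>

definition shape_structures_closed_at :: "('t, 'f) triangulation \<Rightarrow> 't \<Rightarrow> ('t \<Rightarrow> shape) set" where
  "shape_structures_closed_at X Z =
     (\<Pi>\<^sub>E T \<in> tets X. if T = Z then closed_shapes else open_shapes)"

definition edge_angle :: "shape \<Rightarrow> nat \<Rightarrow> nat \<Rightarrow> real" where
  "edge_angle s i j =
     (if (i, j) \<in> {(0, 1), (2, 3)} then shape_a s
      else if (i, j) \<in> {(0, 2), (1, 3)} then shape_b s
      else shape_c s)"

definition weight :: "('t \<Rightarrow> shape) \<Rightarrow> ('t \<times> nat \<times> nat) set \<Rightarrow> real" where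
  "weight \<alpha> e = (\<Sum>(T, i, j) \<in> e. edge_angle (\<alpha> T) i j)"

definition angle_structures :: "('t, 'f) triangulation \<Rightarrow> ('t \<Rightarrow> shape) set" where
  "angle_structures X = {\<alpha> \<in> shape_structures X. \<forall>e \<in> edges X. weight \<alpha> e = 2 * pi}"

section \<open>Faddeev's quantum dilogarithm\<close>

definition hbar :: "real \<Rightarrow> real" where
  "hbar b = 1 / (b + 1 / b)\<^sup>2"

definition qdilog_integrand :: "real \<Rightarrow> complex \<Rightarrow> complex \<Rightarrow> complex" where
  "qdilog_integrand b z w =
     exp (- 2 * \<i> * z * w) / (sinh (of_real b * w) * sinh (w / of_real b) * w)"

text \<open>
  The contour \<open>\<real> + i0\<^sup>+\<close> is read as the limit of the horizontal lines \<open>\<real> + i\<eta>\<close> as \<open>\<eta>\<close> decreases to \<open>0\<close>;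
  the integral does not depend on \<open>\<eta>\<close> as long as the line stays below the first pole of the
  integrand in the upper half plane.
\<close>

definition qdilog_strip :: "real \<Rightarrow> complex \<Rightarrow> complex" where
  "qdilog_strip b z =
     exp (1 / 4 * Lim (at_right 0)
            (\<lambda>\<eta>::real. LINT x|lborel. qdilog_integrand b z (of_real x + \<i> * of_real \<eta>)))"

text \<open>
  Outside the strip the value is that of the meromorphic extension (with value \<open>0\<close> at the poles,
  which is what \<^const>\<open>nicely_meromorphic_on\<close> prescribes).
\<close>

definition qdilog :: "real \<Rightarrow> complex \<Rightarrow> complex" where
  "qdilog b z =
     (if \<bar>Im z\<bar> < 1 / (2 * sqrt (hbar b)) then qdilog_strip b z
      else (THE f. f nicely_meromorphic_on UNIV \<and>
                   (\<forall>w. \<bar>Im w\<bar> < 1 / (2 * sqrt (hbar b)) \<longrightarrow> f w = qdilog_strip b w)) z)"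

section \<open>The partition function\<close>

text \<open>
  The kinematical kernel is a tempered distribution on \<open>\<real>\<^bsup>tets X\<^esup>\<close>, represented by its action on
  test functions. It is given by the formal integral
    \<open>\<integral> dx \<Prod>\<^sub>T exp (2\<pi>i \<epsilon>(T) x\<^sub>0(T) t\<^sub>T) \<delta>(x\<^sub>0(T) - x\<^sub>1(T) + x\<^sub>2(T)) \<delta>(x\<^sub>2(T) - x\<^sub>3(T) + t\<^sub>T)\<close>
  in which each delta is written as \<open>\<delta>(y) = \<integral> exp (-2\<pi>i y w) dw\<close>. This is an oscillatory integral in
  the face variables \<open>x\<close> and the auxiliary variables \<open>w\<close>; as usual it is the limit, in the weak sense of
  distributions, of the absolutely convergent integrals obtained by inserting a convergence factor
  \<open>exp (-\<pi>\<epsilon>y\<^sup>2)\<close> for each of the integration variables and letting \<open>\<epsilon>\<close> decrease to \<open>0\<close>. In particular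
  \<^term>\<open>delta_reg \<epsilon>\<close> tends to Dirac's delta by Fourier inversion, and so does the factor coming from a
  face variable that drops out of all the deltas.
  (Functions on \<open>\<real>\<^sup>I\<close> are functions on extensional maps, integrated against \<open>\<Pi>\<^sub>M i\<in>I. lborel\<close>.)
\<close>

definition delta_reg :: "real \<Rightarrow> real \<Rightarrow> complex" where
  "delta_reg \<epsilon> y =
     (LINT w|lborel. exp (- 2 * \<i> * of_real pi * of_real y * of_real w) *
                     exp (- of_real pi * of_real \<epsilon> * (of_real w)\<^sup>2))"

definition kinematical_kernel_reg ::
    "('t, 'f) triangulation \<Rightarrow> real \<Rightarrow> ('t \<Rightarrow> real) \<Rightarrow> complex" where
  "kinematical_kernel_reg X \<epsilon> t =
     (LINT x|(\<Pi>\<^sub>M f\<in>faces X. lborel).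
        (\<Prod>f\<in>faces X. exp (- of_real pi * of_real \<epsilon> * (of_real (x f))\<^sup>2)) *
        (\<Prod>T\<in>tets X.
           exp (2 * \<i> * of_real pi * of_int (tsign X T) * of_real (x (face X T 0)) * of_real (t T)) *
           delta_reg \<epsilon> (x (face X T 0) - x (face X T 1) + x (face X T 2)) *
           delta_reg \<epsilon> (x (face X T 2) - x (face X T 3) + t T)))"

definition kinematical_kernel ::
    "('t, 'f) triangulation \<Rightarrow> (('t \<Rightarrow> real) \<Rightarrow> complex) \<Rightarrow> complex" where
  "kinematical_kernel X \<phi> =
     Lim (at_right 0) (\<lambda>\<epsilon>. LINT t|(\<Pi>\<^sub>M T\<in>tets X. lborel). kinematical_kernel_reg X \<epsilon> t * \<phi> t)"

definition dynamical_content ::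
    "real \<Rightarrow> ('t, 'f) triangulation \<Rightarrow> ('t \<Rightarrow> shape) \<Rightarrow> ('t \<Rightarrow> real) \<Rightarrow> complex" where
  "dynamical_content b X \<alpha> t =
     (\<Prod>T\<in>tets X.
        of_real (exp (shape_c (\<alpha> T) * t T / sqrt (hbar b))) /
        (qdilog b (of_real (t T) -
                   \<i> / of_real (2 * pi * sqrt (hbar b)) * of_int (tsign X T) *
                   of_real (pi - shape_a (\<alpha> T)))) powi (tsign X T))"

definition partition_function ::
    "real \<Rightarrow> ('t, 'f) triangulation \<Rightarrow> ('t \<Rightarrow> shape) \<Rightarrow> complex" where
  "partition_function b X \<alpha> = kinematical_kernel X (dynamical_content b X \<alpha>)"

section \<open>The triangulations for the twist knot \<open>K\<^sub>n\<close>, \<open>n\<close> even\<close>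

datatype twist_tet = T nat | U | V | W | Z

text \<open>The primed face of the mathematical notation is \<open>Fs'\<close>.\<close>

datatype twist_face = Fe nat | Ff nat | Fv | Fr | Fs | Fs' | Fg | Fu | Fm

definition twist_p :: "nat \<Rightarrow> nat" where
  "twist_p n = (n - 2) div 2"

text \<open>The faces \<open>f\<^sub>k\<close>, with the convention \<open>f\<^sub>0 = e\<^sub>1\<close>.\<close>

definition face_f :: "nat \<Rightarrow> twist_face" where
  "face_f k = (if k = 0 then Fe 1 else Ff k)"

fun twist_sign :: "twist_tet \<Rightarrow> int" where
  "twist_sign V = - 1"
| "twist_sign W = - 1"
| "twist_sign _ = 1"

fun Y_faces :: "nat \<Rightarrow> twist_tet \<Rightarrow> twist_face list" where
  "Y_faces n (T k) = [Fe k, Fe (k + 1), face_f k, face_f (k - 1)]"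
| "Y_faces n U = [Fr, Fv, Fs', Fg]"
| "Y_faces n V = [Fs, Fg, face_f (twist_p n), Fu]"
| "Y_faces n W = [Fu, Fv, Fr, Fe (twist_p n + 1)]"
| "Y_faces n Z = [Fm, Fm, Fs, Fs']"

text \<open>\<open>X_tri n\<close> has no tetrahedron \<open>Z\<close>, so the value of its face map there is irrelevant.\<close>

definition X_faces :: "nat \<Rightarrow> twist_tet \<Rightarrow> twist_face list" where
  "X_faces n t = (if t = U then [Fr, Fv, Fs, Fg] else Y_faces n t)"

definition Y_tri :: "nat \<Rightarrow> (twist_tet, twist_face) triangulation" where
  "Y_tri n = \<lparr>tets = T ` {1..twist_p n} \<union> {U, V, W, Z}, tsign = twist_sign,
              face = (\<lambda>t k. Y_faces n t ! k)\<rparr>"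

definition X_tri :: "nat \<Rightarrow> (twist_tet, twist_face) triangulation" where
  "X_tri n = \<lparr>tets = T ` {1..twist_p n} \<union> {U, V, W}, tsign = twist_sign,
              face = (\<lambda>t k. X_faces n t ! k)\<rparr>"

text \<open>The distinguished edge of \<open>Y_tri n\<close>, carrying the knot: the class of the edge \<open>23\<close> of \<open>Z\<close>.\<close>

definition knot_edge :: "nat \<Rightarrow> (twist_tet \<times> nat \<times> nat) set" where
  "knot_edge n = (edge_glue (Y_tri n))\<^sup>* `` {(Z, 2, 3)}"

section \<open>The value \<open>J\<^bsub>X\<^sub>n\<^esub>(\<hbar>, 0)\<close>\<close>

definition J_index :: "nat \<Rightarrow> twist_tet set" where
  "J_index n = T ` {1..twist_p n} \<union> {U, W}"

fun Q_matrix :: "nat \<Rightarrow> twist_tet \<Rightarrow> twist_tet \<Rightarrow> real" where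
  "Q_matrix n (T j) (T k) = real (min j k)"
| "Q_matrix n (T j) U = real j"
| "Q_matrix n U (T j) = real j"
| "Q_matrix n U U = real (twist_p n) + 1"
| "Q_matrix n U W = - 1 / 2"
| "Q_matrix n W U = - 1 / 2"
| "Q_matrix n _ _ = 0"

fun W_vector :: "nat \<Rightarrow> twist_tet \<Rightarrow> real" where
  "W_vector n (T k) = - 2 * pi * (real k * real (twist_p n) - real k * (real k - 1) / 2)"
| "W_vector n U = - ((real (twist_p n))\<^sup>2 + real (twist_p n) + 3) * pi"
| "W_vector n W = pi"
| "W_vector n _ = 0"

definition J_integrand :: "real \<Rightarrow> nat \<Rightarrow> (twist_tet \<Rightarrow> complex) \<Rightarrow> complex" where
  "J_integrand b n y =
     exp (2 * \<i> * of_real pi *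
            (\<Sum>j\<in>J_index n. \<Sum>k\<in>J_index n. y j * of_real (Q_matrix n j k) * y k) +
          (\<Sum>j\<in>J_index n. y j * of_real (W_vector n j)) / of_real (sqrt (hbar b))) *
     (qdilog b (- y U) * qdilog b (y W)) /
     ((\<Prod>k\<in>{1..twist_p n}. qdilog b (y (T k))) * qdilog b (y U))"

text \<open>
  The imaginary parts of the coordinates on the contour: each coordinate runs over a horizontal line,
  shifted down for \<open>T\<^sub>k\<close> and \<open>U\<close> and up for \<open>W\<close>.
\<close>

definition J_shift :: "real \<Rightarrow> (twist_tet \<Rightarrow> shape) \<Rightarrow> twist_tet \<Rightarrow> real" where
  "J_shift b \<beta> t =
     (if t = W then 1 else - 1) * (pi - shape_a (\<beta> t)) / (2 * pi * sqrt (hbar b))"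

text \<open>
  The integral over the contour determined by \<open>\<beta>\<close>, an angle structure on \<open>X_tri n\<close> with equal first
  angles at \<open>U\<close> and \<open>V\<close>. Its value does not depend on \<open>\<beta>\<close>.
\<close>

definition J_value :: "real \<Rightarrow> nat \<Rightarrow> (twist_tet \<Rightarrow> shape) \<Rightarrow> complex" where
  "J_value b n \<beta> =
     (LINT x|(\<Pi>\<^sub>M t\<in>J_index n. lborel).
        J_integrand b n (\<lambda>t. of_real (x t) + \<i> * of_real (J_shift b \<beta> t)))"

end

theory Submission
  imports Defs "HOL-Probability.Characteristic_Functions"
begin

text \<open>
  The two faces of \<open>Z\<close> opposite to the vertices \<open>0\<close> and \<open>1\<close> are glued together, so their common
  variable \<open>m\<close> cancels in \<open>x\<^sub>0(Z) - x\<^sub>1(Z) + x\<^sub>2(Z)\<close> and survives only in the factor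
  \<open>exp (2\<pi>i m t\<^sub>Z)\<close>. Integrating over \<open>m\<close> gives \<open>\<delta>(t\<^sub>Z)\<close>. The dynamical content of \<open>Z\<close> is therefore
  evaluated at \<open>t\<^sub>Z = 0\<close>, where it is the inverse of the quantum dilogarithm in front of the partition
  function: the product in the theorem no longer involves \<open>Z\<close>, for every shape structure and not only in
  the limit (\<open>partition_function_eq\<close>, \<open>prefactor_cancels\<close>). The limit at \<open>\<tau>\<close> is then a matter of
  continuity.

  The other deltas form a triangular system. They express all face variables, \<open>t\<^sub>V\<close> and \<open>t\<^sub>Z\<close> by the free
  variables \<open>t\<^sub>1, \<dots>, t\<^sub>p, t\<^sub>U, t\<^sub>W\<close>; in particular \<open>t\<^sub>V = - t\<^sub>U\<close>, and the phase becomes the quadratic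
  form of \<open>Q\<^sub>n\<close>. With the convergence factors in place the same system is solved up to multiples of
  \<open>\<sigma> = \<surd>\<epsilon>\<close> (\<open>face_sol\<close>, \<open>tet_subst\<close>): the substitution turns the regularised deltas into a Gaussian
  that does not depend on \<open>\<sigma>\<close>, and dominated convergence gives the value of the kernel on every
  exponentially decaying product (\<open>kinematical_kernel_content\<close>).

  The decay comes from the comparison of \<open>\<bar>\<Phi>\<^sub>b(x + iy)\<bar>\<close> with \<open>exp (- 2\<pi> max(x, 0) y)\<close> in closed
  substrips (\<open>qdilog_bounds\<close>). It makes the factor of a tetrahedron with angles \<open>(a, b, c)\<close> decay with
  rate proportional to \<open>c\<close> on the left and to \<open>b\<close> on the right, locally uniformly in the angles
  (\<open>tet_factor_bound\<close>); the same bounds give the continuity in the shape structure.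

  It remains to recognise \<open>J\<close>. On the contour of an angle structure the exponent of the integrand of
  \<open>J\<close> has a real linear part, determined by the first angles, by \<open>Q\<^sub>n\<close> and by \<open>\<W>\<^sub>n\<close>. The
  edge equations say exactly that this linear part is the one given by the third angles in the dynamical
  content (\<open>angle_relations\<close>), so both integrands agree up to a constant of modulus one
  (\<open>J_integrand_on_contour\<close>). The equations hold for \<open>\<tau>\<close> as well as for angle structures with
  \<open>a\<^sub>U = a\<^sub>V\<close>, and the segment between two solutions consists of solutions; moving the contour
  along it does not change the integral (\<open>J_value_independent\<close>).
\<close>

section \<open>Integrals depending holomorphically on a parameter\<close>

text \<open>
  The space of parameters is first countable, so the convergence may be tested on sequences.
\<close>

lemma tendsto_integral_dominated:
  fixes F :: "'z::first_countable_topology \<Rightarrow> 'a \<Rightarrow> complex"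
  assumes meas: "\<And>z. z \<in> S \<Longrightarrow> F z \<in> borel_measurable M"
    and h: "integrable M h"
    and bound: "\<forall>\<^sub>F z in at z0 within S. \<forall>x\<in>space M. cmod (F z x) \<le> h x"
    and lim: "\<And>x. x \<in> space M \<Longrightarrow> ((\<lambda>z. F z x) \<longlongrightarrow> f x) (at z0 within S)"
    and fm: "f \<in> borel_measurable M"
  shows "((\<lambda>z. LINT x|M. F z x) \<longlongrightarrow> (LINT x|M. f x)) (at z0 within S)"
  unfolding tendsto_at_iff_sequentially comp_def
proof (intro allI impI)
  fix X :: "nat \<Rightarrow> 'z" assume X: "\<forall>i. X i \<in> S - {z0}" "X \<longlonglongrightarrow> z0"
  have fl: "filterlim X (at z0 within S) sequentially"
    using X by (auto simp: filterlim_at)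
  then obtain N where N: "\<And>i. i \<ge> N \<Longrightarrow> \<forall>x\<in>space M. cmod (F (X i) x) \<le> h x"
    using bound by (auto simp: filterlim_iff eventually_sequentially)
  have "(\<lambda>i. LINT x|M. F (X (i + N)) x) \<longlonglongrightarrow> (LINT x|M. f x)"
  proof (rule integral_dominated_convergence[where w = h])
    show "AE x in M. (\<lambda>i. F (X (i + N)) x) \<longlonglongrightarrow> f x"
    proof (intro AE_I2)
      fix x assume "x \<in> space M"
      then have "(\<lambda>i. F (X i) x) \<longlonglongrightarrow> f x"
        using filterlim_compose[OF lim fl] by simp
      then show "(\<lambda>i. F (X (i + N)) x) \<longlonglongrightarrow> f x" by (rule LIMSEQ_ignore_initial_segment)
    qed
    show "AE x in M. cmod (F (X (i + N)) x) \<le> h x" for i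
      using N[of "i + N"] by auto
  qed (use meas h fm X in auto)
  then show "(\<lambda>i. LINT x|M. F (X i) x) \<longlonglongrightarrow> (LINT x|M. f x)"
    by (rule LIMSEQ_offset)
qed

lemma add_small_real_in_ball:
  fixes z :: complex
  assumes "r > 0"
  shows "z + of_real (r / real (i + 2)) \<in> ball z r"
    and "z + of_real (r / real (i + 2)) \<in> cball z r"
proof -
  have "dist z (z + of_real (r / real (i + 2))) = \<bar>r / real (i + 2)\<bar>"
    unfolding dist_norm by (metis add_diff_cancel_left' norm_minus_commute norm_of_real)
  also have "\<bar>r / real (i + 2)\<bar> < r"
    using assms by (simp add: divide_less_eq)
  finally show "z + of_real (r / real (i + 2)) \<in> ball z r" by simp
  then show "z + of_real (r / real (i + 2)) \<in> cball z r" by (simp add: less_imp_le)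
qed

text \<open>
  A local integrable majorant of the integrand also bounds its difference quotients, by Cauchy's estimate,
  so the integral may be differentiated under the integral sign.
\<close>

lemma holomorphic_integral:
  fixes F :: "complex \<Rightarrow> 'a \<Rightarrow> complex"
  assumes S: "open S"
    and meas: "\<And>z. z \<in> S \<Longrightarrow> F z \<in> borel_measurable M"
    and hol: "\<And>x. x \<in> space M \<Longrightarrow> (\<lambda>z. F z x) holomorphic_on S"
    and dom: "\<And>z0. z0 \<in> S \<Longrightarrow> \<exists>r>0. \<exists>h. integrable M h \<and> cball z0 r \<subseteq> S \<and>
                (\<forall>z\<in>cball z0 r. \<forall>x\<in>space M. cmod (F z x) \<le> h x)"
  shows "(\<lambda>z. LINT x|M. F z x) holomorphic_on S"
proof -
  have "\<exists>D. ((\<lambda>z. LINT x|M. F z x) has_field_derivative D) (at z0)" if z0: "z0 \<in> S" for z0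
  proof -
    obtain r h where r: "r > 0" and h: "integrable M h" and sub: "cball z0 r \<subseteq> S"
      and hb: "\<And>z x. z \<in> cball z0 r \<Longrightarrow> x \<in> space M \<Longrightarrow> cmod (F z x) \<le> h x"
      using dom[OF z0] by blast
    define F' where "F' x = deriv (\<lambda>z. F z x) z0" for x
    let ?q = "\<lambda>z x. (F z x - F z0 x) / (z - z0)"
    have int: "integrable M (F z)" if "z \<in> cball z0 r" for z
      by (rule Bochner_Integration.integrable_bound[OF h])
         (use that sub meas hb in \<open>auto intro!: AE_I2 order_trans[OF hb abs_ge_self]\<close>)
    \<comment> \<open>Cauchy's estimate on discs of radius \<open>r / 2\<close> bounds the difference quotients.\<close>
    have der: "cmod (deriv (\<lambda>z. F z x) z) \<le> 2 / r * h x"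
      if "z \<in> cball z0 (r/2)" "x \<in> space M" for z x
    proof -
      have "cball z (r/2) \<subseteq> cball z0 r"
        using that(1) by (simp add: cball_subset_cball_iff dist_commute)
      then have c: "cball z (r/2) \<subseteq> S" "\<And>w. w \<in> cball z (r/2) \<Longrightarrow> cmod (F w x) \<le> h x"
        using sub hb that(2) by auto
      have "cmod ((deriv ^^ 1) (\<lambda>z. F z x) z) \<le> fact 1 * h x / (r/2) ^ 1"
      proof (rule Cauchy_inequality)
        show "(\<lambda>z. F z x) holomorphic_on ball z (r/2)"
          using hol[OF that(2)] c(1) by (meson ball_subset_cball holomorphic_on_subset order_trans)
        show "continuous_on (cball z (r/2)) (\<lambda>z. F z x)"
          using hol[OF that(2)] c(1) by (meson holomorphic_on_imp_continuous_on continuous_on_subset)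
        show "cmod (F w x) \<le> h x" if "cmod (z - w) = r/2" for w
          using that by (intro c(2)) (simp add: dist_norm)
      qed (use r in auto)
      also have "fact 1 * h x / (r/2) ^ 1 = 2 / r * h x" by simp
      finally show ?thesis by simp
    qed
    have quot: "cmod (?q z x) \<le> 2 / r * h x"
      if "z \<in> cball z0 (r/2)" "x \<in> space M" for z x
    proof (cases "z = z0")
      case True
      have "0 \<le> h x" using order_trans[OF norm_ge_zero hb[of z0 x]] r that(2) by simp
      then show ?thesis using True r by simp
    next
      case False
      have "cmod (F z x - F z0 x) \<le> 2 / r * h x * cmod (z - z0)"
      proof (rule field_differentiable_bound[where S = "cball z0 (r/2)" and f' = "deriv (\<lambda>z. F z x)"])
        fix w assume w: "w \<in> cball z0 (r/2)"
        then have "w \<in> S" using sub r by (auto simp: subset_iff)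
        then show "((\<lambda>z. F z x) has_field_derivative deriv (\<lambda>z. F z x) w) (at w within cball z0 (r/2))"
          using hol[OF that(2)] S by (meson holomorphic_derivI has_field_derivative_at_within)
      qed (use der that r in auto)
      then show ?thesis using False by (simp add: norm_divide pos_divide_le_eq)
    qed
    have qlim: "((\<lambda>z. ?q z x) \<longlongrightarrow> F' x) (at z0 within S)" if "x \<in> space M" for x
    proof -
      have "((\<lambda>z. F z x) has_field_derivative F' x) (at z0)"
        unfolding F'_def using hol[OF that] S z0 by (meson holomorphic_derivI)
      then have "((\<lambda>z. ?q z x) \<longlongrightarrow> F' x) (at z0)" by (simp add: has_field_derivative_iff)
      then show ?thesis by (rule tendsto_within_subset) simp
    qed
    have nb: "\<forall>\<^sub>F z in at z0 within S. z \<in> cball z0 (r/2)"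
      using r by (auto simp: eventually_at dist_commute intro!: exI[of _ "r/2"])
    have F'm: "F' \<in> borel_measurable M"
    proof (rule borel_measurable_LIMSEQ_metric[where f = "\<lambda>i. ?q (z0 + of_real (r / real (i + 2)))"])
      fix x assume x: "x \<in> space M"
      have "(\<lambda>i. z0 + of_real (r / real (i + 2))) \<longlonglongrightarrow> z0 + of_real 0"
        by (intro tendsto_intros) real_asymp
      moreover have *: "z0 + of_real (r / real (i + 2)) \<in> S - {z0}" for i
      proof -
        have "z0 + of_real (r / real (i + 2)) \<in> S"
          using add_small_real_in_ball(2)[OF r(1), of z0 i] sub by blast
        moreover have "complex_of_real (r / real (i + 2)) \<noteq> 0"
          using r unfolding of_real_eq_0_iff by simp
        ultimately show ?thesis by (simp only: Diff_iff singleton_iff add_cancel_left_right) simp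
      qed
      ultimately have "filterlim (\<lambda>i. z0 + of_real (r / real (i + 2))) (at z0 within S) sequentially"
        by (auto simp: filterlim_at)
      from filterlim_compose[OF qlim[OF x] this]
      show "(\<lambda>i. ?q (z0 + of_real (r / real (i + 2))) x) \<longlonglongrightarrow> F' x" .
    next
      fix i
      have "z0 + of_real (r / real (i + 2)) \<in> S"
        using add_small_real_in_ball(2)[OF r(1), of z0 i] sub by blast
      then show "?q (z0 + of_real (r / real (i + 2))) \<in> borel_measurable M"
        using meas[of "z0 + of_real (r / real (i + 2))"] meas[OF z0] by measurable
    qed
    have "((\<lambda>z. LINT x|M. ?q z x) \<longlongrightarrow> (LINT x|M. F' x)) (at z0 within S)"
    proof (rule tendsto_integral_dominated[where h = "\<lambda>x. 2 / r * h x"])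
      show "\<forall>\<^sub>F z in at z0 within S. \<forall>x\<in>space M. cmod (?q z x) \<le> 2 / r * h x"
        using nb by eventually_elim (use quot in auto)
    qed (use meas z0 h qlim F'm in \<open>auto intro!: borel_measurable_diff\<close>)
    moreover have "\<forall>\<^sub>F z in at z0 within S.
        (LINT x|M. ?q z x) = ((LINT x|M. F z x) - (LINT x|M. F z0 x)) / (z - z0)"
      using nb
    proof eventually_elim
      case (elim z)
      then have "z \<in> cball z0 r" using r by auto
      then show ?case using int[of z] int[of z0] r by simp
    qed
    ultimately have "((\<lambda>z. ((LINT x|M. F z x) - (LINT x|M. F z0 x)) / (z - z0)) \<longlongrightarrow> (LINT x|M. F' x)) (at z0 within S)"
      by (rule Lim_transform_eventually)
    then have "((\<lambda>z. ((LINT x|M. F z x) - (LINT x|M. F z0 x)) / (z - z0)) \<longlongrightarrow> (LINT x|M. F' x)) (at z0)"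
      by (simp add: at_within_open[OF z0 S])
    then show ?thesis by (auto simp: has_field_derivative_iff)
  qed
  then show ?thesis
    using S by (auto simp: holomorphic_on_def field_differentiable_def intro: has_field_derivative_at_within)
qed

text \<open>
  The derivative of a holomorphic function can be computed along the real direction, where the function
  does not change. This is how contours are shifted below, as long as no pole is crossed: translating
  the variable of integration by a real number never changes an integral over a line or over a real vector
  space, so integrals over parallel contours agree as soon as they depend holomorphically on the complex
  translation. The argument needs no limit of truncated contours and works in every dimension.
\<close>

lemma constant_if_invariant_under_real_translations:
  assumes hol: "G holomorphic_on S" and S: "open S" "connected S"
    and inv: "\<And>z r. z \<in> S \<Longrightarrow> z + of_real r \<in> S \<Longrightarrow> G (z + of_real r) = G z"
    and z: "z \<in> S" "w \<in> S"
  shows "G z = G w"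
proof -
  have "(G has_field_derivative 0) (at z)" if z: "z \<in> S" for z
  proof -
    have d: "(G has_field_derivative deriv G z) (at z)"
      using hol S z by (meson holomorphic_derivI)
    obtain r where r: "r > 0" "ball z r \<subseteq> S" using S z by (meson openE)
    have "filterlim (\<lambda>i. complex_of_real (r / real (i + 2))) (at 0) sequentially"
      unfolding filterlim_at
    proof
      have "(\<lambda>i. complex_of_real (r / real (i + 2))) \<longlonglongrightarrow> of_real 0"
        by (intro tendsto_intros) real_asymp
      then show "filterlim (\<lambda>i. complex_of_real (r / real (i + 2))) (nhds 0) sequentially" by simp
      show "\<forall>\<^sub>F x in sequentially. complex_of_real (r / real (x + 2)) \<in> UNIV \<and>
              complex_of_real (r / real (x + 2)) \<noteq> 0"
        using r by (intro always_eventually allI) (simp only: of_real_eq_0_iff, simp)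
    qed
    from filterlim_compose[OF d[unfolded DERIV_def] this]
    have "(\<lambda>i. (G (z + of_real (r / real (i + 2))) - G z) / of_real (r / real (i + 2))) \<longlonglongrightarrow> deriv G z" .
    moreover have "G (z + of_real (r / real (i + 2))) - G z = 0" for i
    proof -
      have "z + of_real (r / real (i + 2)) \<in> S"
        using add_small_real_in_ball(1)[OF r(1), of z i] r(2) by blast
      then show ?thesis using inv[OF z, of "r / real (i + 2)"] by simp
    qed
    ultimately have "(\<lambda>i::nat. 0) \<longlonglongrightarrow> deriv G z" by simp
    then have "deriv G z = 0" by (rule LIMSEQ_unique[OF _ tendsto_const])
    then show ?thesis using d by simp
  qed
  then have "\<exists>c. \<forall>x\<in>S. G x = c"
    using DERIV_zero_connected_constant[OF S(2,1), of "{}" G] holomorphic_on_imp_continuous_on[OF hol]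
    by simp metis
  then show ?thesis using z by metis
qed

section \<open>Affine substitutions in product integrals\<close>

lemma measurable_affine_coordinate:
  fixes I :: "'i set" and \<phi> :: "('i \<Rightarrow> real) \<Rightarrow> real"
  assumes I: "i \<in> I" and \<phi>: "\<phi> \<in> borel_measurable (\<Pi>\<^sub>M j\<in>I. lborel)"
  shows "(\<lambda>x. x(i := c * x i + \<phi> x)) \<in> measurable (\<Pi>\<^sub>M j\<in>I. lborel) (\<Pi>\<^sub>M j\<in>I. lborel)"
proof (rule measurable_fun_upd[where J = I])
  have "(\<lambda>x. x i) \<in> borel_measurable (\<Pi>\<^sub>M j\<in>I. (lborel :: real measure))"
    using measurable_component_singleton[OF I, of "\<lambda>_. lborel :: real measure"] by simp
  then have "(\<lambda>x. c * x i + \<phi> x) \<in> borel_measurable (\<Pi>\<^sub>M j\<in>I. lborel)"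
    by (intro borel_measurable_add borel_measurable_times \<phi> borel_measurable_const)
  then show "(\<lambda>x. c * x i + \<phi> x) \<in> measurable (\<Pi>\<^sub>M j\<in>I. lborel) lborel"
    by simp
qed (use I in auto)

lemma distr_affine_coordinate:
  fixes I :: "'i set" and \<phi> :: "('i \<Rightarrow> real) \<Rightarrow> real"
  assumes I: "finite I" "i \<in> I" and c: "c \<noteq> 0"
    and \<phi>[measurable]: "\<phi> \<in> borel_measurable (\<Pi>\<^sub>M j\<in>I. lborel)"
    and indep: "\<And>x y. \<phi> (x(i := y)) = \<phi> x"
  shows "distr (\<Pi>\<^sub>M j\<in>I. lborel) (\<Pi>\<^sub>M j\<in>I. lborel) (\<lambda>x. x(i := c * x i + \<phi> x)) =
         density (\<Pi>\<^sub>M j\<in>I. lborel) (\<lambda>_. ennreal (1 / \<bar>c\<bar>))"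
proof (rule measure_eqI)
  interpret product_sigma_finite "\<lambda>_::'i. lborel :: real measure" ..
  let ?P = "\<Pi>\<^sub>M j\<in>I. (lborel :: real measure)"
  define J where "J = I - {i}"
  have J: "finite J" "i \<notin> J" "insert i J = I" using I by (auto simp: J_def)
  note S[measurable] = measurable_affine_coordinate[OF I(2) \<phi>, of c]
  fix A assume "A \<in> sets (distr ?P ?P (\<lambda>x. x(i := c * x i + \<phi> x)))"
  then have A[measurable]: "A \<in> sets ?P" by simp
  have "emeasure (distr ?P ?P (\<lambda>x. x(i := c * x i + \<phi> x))) A =
        (\<integral>\<^sup>+x. indicator A x \<partial>distr ?P ?P (\<lambda>x. x(i := c * x i + \<phi> x)))"
    by simp
  also have "\<dots> = (\<integral>\<^sup>+x. indicator A (x(i := c * x i + \<phi> x)) \<partial>?P)"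
    by (rule nn_integral_distr) auto
  also have "\<dots> = (\<integral>\<^sup>+x. (\<integral>\<^sup>+y. indicator A (x(i := c * y + \<phi> x)) \<partial>lborel) \<partial>(\<Pi>\<^sub>M j\<in>J. lborel))"
    unfolding J(3)[symmetric]
    by (subst product_nn_integral_insert[OF J(1,2)]) (auto simp: indep J(3))
  also have "\<dots> = (\<integral>\<^sup>+x. ennreal (1 / \<bar>c\<bar>) * (\<integral>\<^sup>+y. indicator A (x(i := y)) \<partial>lborel) \<partial>(\<Pi>\<^sub>M j\<in>J. lborel))"
  proof (rule nn_integral_cong)
    fix x assume x: "x \<in> space (\<Pi>\<^sub>M j\<in>J. (lborel :: real measure))"
    have "(\<lambda>y. x(i := y)) \<in> measurable lborel (\<Pi>\<^sub>M j\<in>insert i J. (lborel :: real measure))"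
      using x J by (intro measurable_component_update) auto
    then have [measurable]: "(\<lambda>y. x(i := y)) \<in> measurable borel ?P" unfolding J(3) by simp
    have "(\<integral>\<^sup>+y. indicator A (x(i := y)) \<partial>lborel) =
          ennreal \<bar>c\<bar> * (\<integral>\<^sup>+y. indicator A (x(i := \<phi> x + c * y)) \<partial>lborel)"
      by (rule nn_integral_real_affine[OF _ c]) measurable
    then have "ennreal (1 / \<bar>c\<bar>) * (\<integral>\<^sup>+y. indicator A (x(i := y)) \<partial>lborel) =
          (ennreal (1 / \<bar>c\<bar>) * ennreal \<bar>c\<bar>) * (\<integral>\<^sup>+y. indicator A (x(i := \<phi> x + c * y)) \<partial>lborel)"
      by (simp add: mult.assoc)
    also have "ennreal (1 / \<bar>c\<bar>) * ennreal \<bar>c\<bar> = 1"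
      using c by (simp add: ennreal_mult[symmetric])
    finally show "(\<integral>\<^sup>+y. indicator A (x(i := c * y + \<phi> x)) \<partial>lborel) =
        ennreal (1 / \<bar>c\<bar>) * (\<integral>\<^sup>+y. indicator A (x(i := y)) \<partial>lborel)"
      by (simp only: mult_1_left add.commute[of "c * _" "\<phi> x"])
  qed
  also have "\<dots> = ennreal (1 / \<bar>c\<bar>) * (\<integral>\<^sup>+x. (\<integral>\<^sup>+y. indicator A (x(i := y)) \<partial>lborel) \<partial>(\<Pi>\<^sub>M j\<in>J. lborel))"
  proof (rule nn_integral_cmult)
    interpret J: finite_product_sigma_finite "\<lambda>_::'i. lborel :: real measure" J by standard (rule J)
    have [measurable]: "(\<lambda>p. (fst p)(i := snd p)) \<in> measurable ((\<Pi>\<^sub>M j\<in>J. lborel) \<Otimes>\<^sub>M lborel) ?P"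
      unfolding J(3)[symmetric] by (intro measurable_fun_upd[where J = J]) auto
    have "(\<lambda>(x, y). indicator A (x(i := y)) :: ennreal) \<in> borel_measurable ((\<Pi>\<^sub>M j\<in>J. lborel) \<Otimes>\<^sub>M lborel)"
      unfolding split_def by measurable
    then show "(\<lambda>x. \<integral>\<^sup>+y. indicator A (x(i := y)) \<partial>lborel) \<in> borel_measurable (\<Pi>\<^sub>M j\<in>J. lborel)"
      by (rule lborel.borel_measurable_nn_integral)
  qed
  also have "(\<integral>\<^sup>+x. (\<integral>\<^sup>+y. indicator A (x(i := y)) \<partial>lborel) \<partial>(\<Pi>\<^sub>M j\<in>J. lborel)) = (\<integral>\<^sup>+x. indicator A x \<partial>?P)"
    using product_nn_integral_insert[OF J(1,2), of "indicator A"] J(3) by simp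
  also have "ennreal (1 / \<bar>c\<bar>) * (\<integral>\<^sup>+x. indicator A x \<partial>?P) = emeasure (density ?P (\<lambda>_. ennreal (1 / \<bar>c\<bar>))) A"
    by (simp add: emeasure_density nn_integral_cmult)
  finally show "emeasure (distr ?P ?P (\<lambda>x. x(i := c * x i + \<phi> x))) A =
      emeasure (density ?P (\<lambda>_. ennreal (1 / \<bar>c\<bar>))) A" .
qed simp

text \<open>
  The image measure is a multiple of the product measure, so the formula holds for all measurable
  integrands, integrable or not.
\<close>

lemma integral_affine_coordinate:
  fixes I :: "'i set" and \<phi> :: "('i \<Rightarrow> real) \<Rightarrow> real" and f :: "('i \<Rightarrow> real) \<Rightarrow> complex"
  assumes I: "finite I" "i \<in> I" and c: "c \<noteq> 0"
    and \<phi>[measurable]: "\<phi> \<in> borel_measurable (\<Pi>\<^sub>M j\<in>I. lborel)"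
    and indep: "\<And>x y. \<phi> (x(i := y)) = \<phi> x"
    and f[measurable]: "f \<in> borel_measurable (\<Pi>\<^sub>M j\<in>I. lborel)"
  shows "(LINT x|(\<Pi>\<^sub>M j\<in>I. lborel). f x) =
         of_real \<bar>c\<bar> * (LINT x|(\<Pi>\<^sub>M j\<in>I. lborel). f (x(i := c * x i + \<phi> x)))"
proof -
  let ?P = "\<Pi>\<^sub>M j\<in>I. (lborel :: real measure)"
  note S = measurable_affine_coordinate[OF I(2) \<phi>, of c]
  have "(LINT x|?P. f (x(i := c * x i + \<phi> x))) = (LINT x|density ?P (\<lambda>_. ennreal (1 / \<bar>c\<bar>)). f x)"
    unfolding distr_affine_coordinate[OF I c \<phi> indep, symmetric] by (rule integral_distr[OF S f, symmetric])
  also have "\<dots> = (LINT x|?P. (1 / \<bar>c\<bar>) *\<^sub>R f x)"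
    by (rule integral_density) auto
  also have "\<dots> = (1 / \<bar>c\<bar>) *\<^sub>R (LINT x|?P. f x)"
    by simp
  finally show ?thesis using c by (simp add: scaleR_conv_of_real)
qed

text \<open>
  The substitution changes one coordinate at a time, in the order of increasing rank. When a coordinate is
  changed, the coordinates of smaller rank have already got their new values, which by triangularity do
  not involve it.
\<close>

lemma integral_triangular_affine:
  fixes I :: "'i set" and S :: "('i \<Rightarrow> real) \<Rightarrow> 'i \<Rightarrow> real" and rank :: "'i \<Rightarrow> nat"
    and f :: "('i \<Rightarrow> real) \<Rightarrow> complex"
  assumes I: "finite I" and c: "\<And>j. j \<in> I \<Longrightarrow> c j \<noteq> 0"
    and S: "\<And>j. j \<in> I \<Longrightarrow> (\<lambda>x. S x j) \<in> borel_measurable (\<Pi>\<^sub>M j\<in>I. lborel)"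
    and tri: "\<And>i j x y. i \<in> I \<Longrightarrow> j \<in> I \<Longrightarrow> rank j \<le> rank i \<Longrightarrow>
                S (x(i := y)) j - c j * (x(i := y)) j = S x j - c j * x j"
    and f: "f \<in> borel_measurable (\<Pi>\<^sub>M j\<in>I. lborel)"
  shows "(LINT x|(\<Pi>\<^sub>M j\<in>I. lborel). f x) =
         of_real (\<Prod>j\<in>I. \<bar>c j\<bar>) * (LINT x|(\<Pi>\<^sub>M j\<in>I. lborel). f (\<lambda>j\<in>I. S x j))"
proof -
  let ?P = "\<Pi>\<^sub>M j\<in>I. (lborel :: real measure)"
  let ?S = "\<lambda>K x j. if j \<in> K then S x j else x j"
  have comp: "(\<lambda>x. x j) \<in> borel_measurable ?P" if "j \<in> I" for j
    using measurable_component_singleton[OF that, of "\<lambda>_. lborel :: real measure"] by simp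
  have meas: "?S K \<in> measurable ?P ?P" if "K \<subseteq> I" for K
  proof (rule measurable_PiM_single')
    show "(\<lambda>x. ?S K x j) \<in> measurable ?P lborel" if "j \<in> I" for j
      using S[OF that] comp[OF that] by (cases "j \<in> K") auto
  qed (use that in \<open>auto simp: space_PiM PiE_def extensional_def\<close>)
  have "(LINT x|?P. f x) = of_real (\<Prod>j\<in>K. \<bar>c j\<bar>) * (LINT x|?P. f (?S K x))" if "K \<subseteq> I" for K
    using finite_subset[OF that I] that
  proof (induction K rule: finite_ranking_induct[where f = rank])
    case (insert i K)
    show ?case
    proof (cases "i \<in> K")
      case False
      let ?\<phi> = "\<lambda>x. S x i - c i * x i"
      have upd: "?S K (x(i := c i * x i + ?\<phi> x)) = ?S (insert i K) x" for x
      proof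
        fix j
        show "?S K (x(i := c i * x i + ?\<phi> x)) j = ?S (insert i K) x j"
        proof (cases "j \<in> K")
          case True
          then have "j \<noteq> i" "j \<in> I" "i \<in> I" "rank j \<le> rank i" using False insert by auto
          then show ?thesis using tri[of i j x "S x i"] True by simp
        qed auto
      qed
      have "(LINT x|?P. f x) = of_real (\<Prod>j\<in>K. \<bar>c j\<bar>) * (LINT x|?P. f (?S K x))"
        using insert by auto
      also have "(LINT x|?P. f (?S K x)) =
          of_real \<bar>c i\<bar> * (LINT x|?P. f (?S K (x(i := c i * x i + ?\<phi> x))))"
      proof (rule integral_affine_coordinate[OF I])
        show "(\<lambda>x. f (?S K x)) \<in> borel_measurable ?P"
          using measurable_compose[OF meas f] insert by auto
        show "?\<phi> \<in> borel_measurable ?P"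
          using insert.prems by (intro borel_measurable_diff borel_measurable_times S comp) auto
        show "?\<phi> (x(i := y)) = ?\<phi> x" for x y using tri[of i i x y] insert.prems by auto
      qed (use insert c in auto)
      finally show ?thesis unfolding upd using insert.hyps(1) False by (simp add: mult_ac)
    next
      case True
      then have "insert i K = K" by auto
      then show ?thesis using insert by auto
    qed
  qed simp
  from this[OF order_refl]
  have "(LINT x|?P. f x) = of_real (\<Prod>j\<in>I. \<bar>c j\<bar>) * (LINT x|?P. f (?S I x))" .
  also have "(LINT x|?P. f (?S I x)) = (LINT x|?P. f (\<lambda>j\<in>I. S x j))"
    by (intro Bochner_Integration.integral_cong refl arg_cong[where f = f])
       (auto simp: space_PiM PiE_def extensional_def)
  finally show ?thesis .
qed

section \<open>The quantum dilogarithm in its strip\<close>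

lemma integrable_exp_abs:
  fixes \<kappa> :: real
  assumes "\<kappa> > 0"
  shows "integrable lborel (\<lambda>x::real. exp (- \<kappa> * \<bar>x\<bar>))"
proof -
  let ?f = "\<lambda>x::real. indicator {0..} x *\<^sub>R exp (- \<kappa> * x)"
  have "(\<lambda>x::real. exp (- \<kappa> * x)) absolutely_integrable_on {0..}"
    using integrable_on_exp_minus_to_infinity[OF assms, of 0]
    by (intro nonnegative_absolutely_integrable_1) auto
  then have f: "integrable lborel ?f"
    unfolding set_integrable_def by (subst (asm) integrable_completion) auto
  then have "integrable lborel (\<lambda>x. ?f (0 + (-1) * x))"
    by (rule lborel_integrable_real_affine) simp
  then have "integrable lborel (\<lambda>x. ?f x + ?f (0 + (-1) * x))"
    using f by (rule Bochner_Integration.integrable_add[rotated])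
  then show ?thesis
    by (rule Bochner_Integration.integrable_bound) (auto simp: indicator_def)
qed

text \<open>
  The two estimates come from \<open>\<bar>sinh (x + iy)\<bar>\<^sup>2 = sinh\<^sup>2 x + sin\<^sup>2 y\<close>. The first one controls the
  integrand of the quantum dilogarithm on horizontal lines, the second one on vertical segments far from
  the origin, which cross the real axis.
\<close>

lemma cmod_sinh_ge:
  fixes w :: complex
  shows "\<bar>sin (Im w)\<bar> * cosh (Re w) \<le> cmod (sinh w)"
    and "\<bar>sinh (Re w)\<bar> \<le> cmod (sinh w)"
proof -
  have s: "sinh w = Complex (sinh (Re w) * cos (Im w)) (cosh (Re w) * sin (Im w))"
    by (simp add: complex_eq_iff sinh_field_def cosh_field_def Re_exp Im_exp field_simps)
  have "\<bar>Im (sinh w)\<bar> = \<bar>sin (Im w)\<bar> * cosh (Re w)"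
    by (simp add: s abs_mult cosh_real_nonneg)
  then show "\<bar>sin (Im w)\<bar> * cosh (Re w) \<le> cmod (sinh w)"
    using abs_Im_le_cmod[of "sinh w"] by simp
  have "(sinh (Re w))\<^sup>2 \<le> (sinh (Re w) * cos (Im w))\<^sup>2 + (cosh (Re w) * sin (Im w))\<^sup>2"
  proof -
    have "(sinh (Re w) * cos (Im w))\<^sup>2 + (cosh (Re w) * sin (Im w))\<^sup>2 =
        (sinh (Re w))\<^sup>2 * ((cos (Im w))\<^sup>2 + (sin (Im w))\<^sup>2) + (sin (Im w))\<^sup>2"
      by (simp add: power_mult_distrib cosh_square_eq cos_squared_eq algebra_simps)
    then show ?thesis by simp
  qed
  then show "\<bar>sinh (Re w)\<bar> \<le> cmod (sinh w)"
    unfolding s cmod_def by (simp add: real_le_rsqrt)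
qed

lemma exp_abs_le_cosh: "exp \<bar>x\<bar> / 2 \<le> cosh (x::real)"
  by (auto simp: cosh_field_def abs_if)

text \<open>The distance from the origin to the nearest other pole of the integrand.\<close>
definition pole_dist :: "real \<Rightarrow> real" where
  "pole_dist b = pi * min b (1 / b)"

text \<open>
  The width \<open>b + b\<^sup>-\<^sup>1 = \<hbar>\<^sup>-\<^sup>1\<^sup>/\<^sup>2\<close> of the strip in which the defining integral of the quantum dilogarithm
  converges.
\<close>

definition strip_width :: "real \<Rightarrow> real" where
  "strip_width b = b + 1 / b"

context
  fixes b :: real
  assumes b: "b > 0"
begin

lemma pole_dist_pos: "pole_dist b > 0"
  using b by (simp add: pole_dist_def)

lemma hbar_pos: "hbar b > 0"
proof -
  have "b + 1 / b > 0" using b by (simp add: add_pos_pos)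
  then show ?thesis by (simp add: hbar_def)
qed

lemma inverse_sqrt_hbar: "1 / sqrt (hbar b) = strip_width b"
proof -
  have "b + 1 / b > 0" using b by (simp add: add_pos_pos)
  then show ?thesis by (simp add: hbar_def real_sqrt_divide strip_width_def)
qed

lemma strip_half_width: "1 / (2 * sqrt (hbar b)) = strip_width b / 2"
  using inverse_sqrt_hbar by (simp add: field_simps)

lemma sin_nonzero_in_strip:
  assumes "y \<noteq> 0" "\<bar>y\<bar> < pole_dist b"
  shows "sin (b * y) \<noteq> 0" "sin (y / b) \<noteq> 0"
proof -
  have *: "sin t \<noteq> 0" if "t \<noteq> 0" "\<bar>t\<bar> < pi" for t :: real
    using that sin_gt_zero[of t] sin_gt_zero[of "-t"] by (cases "t > 0") auto
  have "\<bar>y\<bar> < pi * b" "\<bar>y\<bar> < pi * (1 / b)"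
    using assms(2) by (auto simp: pole_dist_def min_mult_distrib_left)
  then have "b * \<bar>y\<bar> < pi" "\<bar>y\<bar> / b < pi"
    using b by (auto simp: field_simps)
  then have "\<bar>b * y\<bar> < pi" "\<bar>y / b\<bar> < pi" "b * y \<noteq> 0" "y / b \<noteq> 0"
    using b assms(1) by (auto simp: abs_mult)
  then show "sin (b * y) \<noteq> 0" "sin (y / b) \<noteq> 0"
    using * by blast+
qed

text \<open>
  The bound of \<open>1 / \<bar>sinh (b w) sinh (w / b) w\<bar>\<close> on the line of height \<open>y\<close>, up to the factor
  \<open>exp (- (b + b\<^sup>-\<^sup>1) \<bar>Re w\<bar>)\<close>.
\<close>

definition pole_bound :: "real \<Rightarrow> real" where
  "pole_bound y = 4 / (\<bar>sin (b * y)\<bar> * \<bar>sin (y / b)\<bar> * \<bar>y\<bar>)"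

lemma cmod_exp_linear:
  "cmod (exp (- 2 * \<i> * z * w)) = exp (2 * Re z * Im w + 2 * Im z * Re w)"
  by (simp add: algebra_simps)

lemma cmod_integrand_le:
  assumes "Im w \<noteq> 0" "\<bar>Im w\<bar> < pole_dist b"
  shows "cmod (qdilog_integrand b z w) \<le>
         pole_bound (Im w) * exp (2 * Re z * Im w + 2 * Im z * Re w - strip_width b * \<bar>Re w\<bar>)"
proof -
  have sn: "0 < \<bar>sin (b * Im w)\<bar>" "0 < \<bar>sin (Im w / b)\<bar>" "0 < \<bar>Im w\<bar>"
    using sin_nonzero_in_strip[OF assms] assms by auto
  have 1: "\<bar>sin (b * Im w)\<bar> * (exp (b * \<bar>Re w\<bar>) / 2) \<le> cmod (sinh (of_real b * w))"
  proof -
    have "\<bar>sin (b * Im w)\<bar> * (exp \<bar>b * Re w\<bar> / 2) \<le> \<bar>sin (b * Im w)\<bar> * cosh (b * Re w)"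
      by (intro mult_left_mono exp_abs_le_cosh) auto
    also have "\<dots> \<le> cmod (sinh (of_real b * w))"
      using cmod_sinh_ge(1)[of "of_real b * w"] by simp
    finally show ?thesis using b by (simp add: abs_mult)
  qed
  have 2: "\<bar>sin (Im w / b)\<bar> * (exp (\<bar>Re w\<bar> / b) / 2) \<le> cmod (sinh (w / of_real b))"
  proof -
    have "\<bar>sin (Im w / b)\<bar> * (exp \<bar>Re w / b\<bar> / 2) \<le> \<bar>sin (Im w / b)\<bar> * cosh (Re w / b)"
      by (intro mult_left_mono exp_abs_le_cosh) auto
    also have "\<dots> \<le> cmod (sinh (w / of_real b))"
      using cmod_sinh_ge(1)[of "w / of_real b"] by simp
    finally show ?thesis using b by (simp add: abs_mult)
  qed
  have "\<bar>sin (b * Im w)\<bar> * (exp (b * \<bar>Re w\<bar>) / 2) * (\<bar>sin (Im w / b)\<bar> * (exp (\<bar>Re w\<bar> / b) / 2)) * \<bar>Im w\<bar>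
        \<le> cmod (sinh (of_real b * w)) * cmod (sinh (w / of_real b)) * cmod w"
    by (intro mult_mono 1 2 abs_Im_le_cmod) auto
  also have "\<bar>sin (b * Im w)\<bar> * (exp (b * \<bar>Re w\<bar>) / 2) * (\<bar>sin (Im w / b)\<bar> * (exp (\<bar>Re w\<bar> / b) / 2)) * \<bar>Im w\<bar>
        = exp (strip_width b * \<bar>Re w\<bar>) / pole_bound (Im w)"
    by (simp add: pole_bound_def strip_width_def distrib_right exp_add)
  finally have den: "exp (strip_width b * \<bar>Re w\<bar>) / pole_bound (Im w) \<le>
      cmod (sinh (of_real b * w)) * cmod (sinh (w / of_real b)) * cmod w" .
  have pb: "pole_bound (Im w) > 0" using sn by (simp add: pole_bound_def)
  have "cmod (qdilog_integrand b z w) =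
      exp (2 * Re z * Im w + 2 * Im z * Re w) /
      (cmod (sinh (of_real b * w)) * cmod (sinh (w / of_real b)) * cmod w)"
    by (simp only: qdilog_integrand_def norm_divide norm_mult[of _ w] norm_mult[of "sinh _"] cmod_exp_linear)
  also have "\<dots> \<le> exp (2 * Re z * Im w + 2 * Im z * Re w) / (exp (strip_width b * \<bar>Re w\<bar>) / pole_bound (Im w))"
    using den pb by (intro divide_left_mono mult_pos_pos less_le_trans[OF _ den]) auto
  also have "\<dots> = pole_bound (Im w) * exp (2 * Re z * Im w + 2 * Im z * Re w - strip_width b * \<bar>Re w\<bar>)"
    by (simp add: exp_diff)
  finally show ?thesis .
qed

text \<open>
  One majorant serves for all \<open>z\<close> and all lines in a compact range, which is what differentiating
  under the integral sign in \<open>z\<close> and in the height of the line requires.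
\<close>

lemma integrand_uniform_bound:
  assumes K: "compact K" "K \<subseteq> {y. y \<noteq> 0 \<and> \<bar>y\<bar> < pole_dist b}" and Y: "Y < strip_width b / 2"
  obtains C where "C > 0"
    "\<And>z w s. \<bar>Re z\<bar> \<le> R \<Longrightarrow> \<bar>Im z\<bar> \<le> Y \<Longrightarrow> Im w \<in> K \<Longrightarrow> \<bar>Re w\<bar> \<le> R \<Longrightarrow>
       cmod (qdilog_integrand b z (of_real s + w)) \<le> C * exp (- (strip_width b - 2 * Y) * \<bar>s\<bar>)"
proof -
  have "continuous_on K pole_bound"
    unfolding pole_bound_def
    using K(2) sin_nonzero_in_strip b by (intro continuous_intros) auto
  then have "bounded (pole_bound ` K)"
    using K(1) compact_continuous_image compact_imp_bounded by blast
  then obtain P where P: "P > 0" "\<And>y. y \<in> K \<Longrightarrow> \<bar>pole_bound y\<bar> \<le> P"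
    by (auto simp: bounded_pos)
  \<comment> \<open>The last term of the exponent pays for replacing \<open>\<bar>s + Re w\<bar>\<close> by \<open>\<bar>s\<bar>\<close>.\<close>
  define C where "C = P * exp (2 * \<bar>R\<bar> * pole_dist b + (strip_width b + 2 * \<bar>Y\<bar>) * \<bar>R\<bar>)"
  show ?thesis
  proof
    show "C > 0" using P by (simp add: C_def)
    fix z w :: complex and s :: real
    assume *: "\<bar>Re z\<bar> \<le> R" "\<bar>Im z\<bar> \<le> Y" "Im w \<in> K" "\<bar>Re w\<bar> \<le> R"
    have w: "Im w \<noteq> 0" "\<bar>Im w\<bar> < pole_dist b" using K(2) *(3) by auto
    let ?u = "of_real s + w"
    have "cmod (qdilog_integrand b z ?u) \<le> pole_bound (Im w) *
        exp (2 * Re z * Im w + 2 * Im z * (s + Re w) - strip_width b * \<bar>s + Re w\<bar>)"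
      using cmod_integrand_le[of ?u z] w by simp
    also have "\<dots> \<le> P * exp ((2 * \<bar>R\<bar> * pole_dist b + (strip_width b + 2 * \<bar>Y\<bar>) * \<bar>R\<bar>) + - (strip_width b - 2 * Y) * \<bar>s\<bar>)"
    proof (intro mult_mono)
      show "pole_bound (Im w) \<le> P" using P(2)[OF *(3)] by linarith
      define q where "q = strip_width b"
      have "Re z * Im w \<le> \<bar>Re z\<bar> * \<bar>Im w\<bar>" by (metis abs_ge_self abs_mult)
      also have "\<dots> \<le> \<bar>R\<bar> * pole_dist b"
        using *(1) w(2) by (intro mult_mono) auto
      finally have 1: "Re z * Im w \<le> \<bar>R\<bar> * pole_dist b" .
      have "Im z * (s + Re w) \<le> \<bar>Im z\<bar> * \<bar>s + Re w\<bar>" by (metis abs_ge_self abs_mult)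
      also have "\<dots> \<le> Y * \<bar>s + Re w\<bar>" using *(2) by (intro mult_right_mono) auto
      finally have 2: "Im z * (s + Re w) \<le> Y * \<bar>s + Re w\<bar>" .
      have 3: "(q - 2 * Y) * \<bar>s + Re w\<bar> \<ge> (q - 2 * Y) * (\<bar>s\<bar> - \<bar>R\<bar>)"
        using *(4) Y by (intro mult_left_mono) (auto simp: q_def)
      have 4: "- 2 * Y * \<bar>R\<bar> \<le> 2 * \<bar>Y\<bar> * \<bar>R\<bar>"
        by (intro mult_right_mono) auto
      have "2 * Re z * Im w + 2 * Im z * (s + Re w) - q * \<bar>s + Re w\<bar>
          \<le> (2 * \<bar>R\<bar> * pole_dist b + (q + 2 * \<bar>Y\<bar>) * \<bar>R\<bar>) + - (q - 2 * Y) * \<bar>s\<bar>"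
        using 1 2 3 4 by (simp add: algebra_simps)
      then show "exp (2 * Re z * Im w + 2 * Im z * (s + Re w) - strip_width b * \<bar>s + Re w\<bar>) \<le>
          exp ((2 * \<bar>R\<bar> * pole_dist b + (strip_width b + 2 * \<bar>Y\<bar>) * \<bar>R\<bar>) + - (strip_width b - 2 * Y) * \<bar>s\<bar>)"
        unfolding exp_le_cancel_iff q_def .
    qed (use P in auto)
    also have "\<dots> = C * exp (- (strip_width b - 2 * Y) * \<bar>s\<bar>)"
      by (simp only: C_def exp_add mult.assoc)
    finally show "cmod (qdilog_integrand b z ?u) \<le> C * exp (- (strip_width b - 2 * Y) * \<bar>s\<bar>)" .
  qed
qed

lemma integrand_measurable [measurable]:
  "(\<lambda>s::real. qdilog_integrand b z (of_real s + w)) \<in> borel_measurable borel"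
  unfolding qdilog_integrand_def
  by (intro borel_measurable_divide borel_measurable_times borel_measurable_continuous_onI continuous_intros)
     (use b in auto)

definition line_integral :: "real \<Rightarrow> complex \<Rightarrow> complex" where
  "line_integral \<eta> z = (LINT s|lborel. qdilog_integrand b z (of_real s + \<i> * of_real \<eta>))"

lemma integrand_integrable:
  assumes "\<bar>Im z\<bar> < strip_width b / 2" "Im w \<noteq> 0" "\<bar>Im w\<bar> < pole_dist b"
  shows "integrable lborel (\<lambda>s::real. qdilog_integrand b z (of_real s + w))"
proof -
  have K: "compact {Im w}" "{Im w} \<subseteq> {y. y \<noteq> 0 \<and> \<bar>y\<bar> < pole_dist b}"
    using assms by auto
  obtain C where C: "C > 0"
    "\<And>s. cmod (qdilog_integrand b z (of_real s + w)) \<le> C * exp (- (strip_width b - 2 * \<bar>Im z\<bar>) * \<bar>s\<bar>)"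
    by (rule integrand_uniform_bound[OF K assms(1), where R = "\<bar>Re z\<bar> + \<bar>Re w\<bar>"]) auto
  have "integrable lborel (\<lambda>s. C * exp (- (strip_width b - 2 * \<bar>Im z\<bar>) * \<bar>s\<bar>))"
    using assms by (intro integrable_mult_right integrable_exp_abs) auto
  then show ?thesis
    by (rule Bochner_Integration.integrable_bound) (use C assms in \<open>auto intro!: AE_I2 order_trans[OF C(2) abs_ge_self]\<close>)
qed

lemma denominator_nonzero:
  assumes "Im w \<noteq> 0" "\<bar>Im w\<bar> < pole_dist b"
  shows "sinh (of_real b * w) \<noteq> 0" "sinh (w / of_real b) \<noteq> 0" "w \<noteq> 0"
proof -
  have "0 < \<bar>sin (b * Im w)\<bar> * cosh (b * Re w)" "0 < \<bar>sin (Im w / b)\<bar> * cosh (Re w / b)"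
    using sin_nonzero_in_strip[OF assms] by auto
  then have "0 < cmod (sinh (of_real b * w))" "0 < cmod (sinh (w / of_real b))"
    using cmod_sinh_ge(1)[of "of_real b * w"] cmod_sinh_ge(1)[of "w / of_real b"]
    by (simp_all del: zero_less_norm_iff)
  then show "sinh (of_real b * w) \<noteq> 0" "sinh (w / of_real b) \<noteq> 0" by auto
  show "w \<noteq> 0" using assms(1) by auto
qed

lemma integrand_holomorphic_z: "(\<lambda>z. qdilog_integrand b z w) holomorphic_on A"
proof -
  have "(\<lambda>z. exp (- 2 * \<i> * z * w) * inverse (sinh (of_real b * w) * sinh (w / of_real b) * w)) holomorphic_on A"
    by (intro holomorphic_on_mult holomorphic_on_const holomorphic_intros)
  then show ?thesis by (simp add: qdilog_integrand_def divide_inverse)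
qed

lemma holomorphic_on_sinh:
  "f holomorphic_on A \<Longrightarrow> (\<lambda>z. sinh (f z)) holomorphic_on A"
  unfolding sinh_field_def by (intro holomorphic_intros) auto

lemma integrand_holomorphic_w:
  "(\<lambda>w. qdilog_integrand b z w) holomorphic_on {w. Im w \<noteq> 0 \<and> \<bar>Im w\<bar> < pole_dist b}"
  unfolding qdilog_integrand_def
  using denominator_nonzero b by (intro holomorphic_intros holomorphic_on_sinh) auto

lemma open_strip: "open {z. \<bar>Im z\<bar> < c}"
  by (intro open_Collect_less continuous_intros)

lemma line_integral_holomorphic:
  assumes "\<eta> \<noteq> 0" "\<bar>\<eta>\<bar> < pole_dist b"
  shows "line_integral \<eta> holomorphic_on {z. \<bar>Im z\<bar> < strip_width b / 2}"
proof -
  have "(\<lambda>z. LINT s|lborel. qdilog_integrand b z (of_real s + \<i> * of_real \<eta>))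
          holomorphic_on {z. \<bar>Im z\<bar> < strip_width b / 2}"
  proof (rule holomorphic_integral[OF open_strip])
    fix z0 assume "z0 \<in> {z. \<bar>Im z\<bar> < strip_width b / 2}"
    then have z0: "\<bar>Im z0\<bar> < strip_width b / 2" by simp
    define r where "r = (strip_width b / 2 - \<bar>Im z0\<bar>) / 2"
    have r: "r > 0" using z0 unfolding r_def by simp
    have r2: "\<bar>Im z0\<bar> + r < strip_width b / 2" using z0 unfolding r_def by argo
    have ball: "\<bar>Im z\<bar> \<le> \<bar>Im z0\<bar> + r \<and> \<bar>Re z\<bar> \<le> \<bar>Re z0\<bar> + r" if "z \<in> cball z0 r" for z
      using that abs_Im_le_cmod[of "z0 - z"] abs_Re_le_cmod[of "z0 - z"] by (auto simp: dist_norm)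
    have K: "compact {\<eta>}" "{\<eta>} \<subseteq> {y. y \<noteq> 0 \<and> \<bar>y\<bar> < pole_dist b}" using assms by auto
    obtain C where C: "C > 0"
      "\<And>z s. z \<in> cball z0 r \<Longrightarrow> cmod (qdilog_integrand b z (of_real s + \<i> * of_real \<eta>))
         \<le> C * exp (- (strip_width b - 2 * (\<bar>Im z0\<bar> + r)) * \<bar>s\<bar>)"
      by (rule integrand_uniform_bound[OF K r2, where R = "\<bar>Re z0\<bar> + r"]) (use ball r in auto)
    have "integrable lborel (\<lambda>s. C * exp (- (strip_width b - 2 * (\<bar>Im z0\<bar> + r)) * \<bar>s\<bar>))"
      using r2 by (intro integrable_mult_right integrable_exp_abs) simp
    moreover have "cball z0 r \<subseteq> {z. \<bar>Im z\<bar> < strip_width b / 2}"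
      using ball r2 by force
    ultimately show "\<exists>r>0. \<exists>h. integrable lborel h \<and> cball z0 r \<subseteq> {z. \<bar>Im z\<bar> < strip_width b / 2} \<and>
        (\<forall>z\<in>cball z0 r. \<forall>s\<in>space lborel. cmod (qdilog_integrand b z (of_real s + \<i> * of_real \<eta>)) \<le> h s)"
      using r C(2) by blast
  qed (auto intro: integrand_holomorphic_z)
  then show ?thesis by (simp add: line_integral_def[abs_def])
qed

lemma line_integral_shift:
  assumes z: "\<bar>Im z\<bar> < strip_width b / 2"
    and \<eta>: "0 < \<eta>" "\<eta> < pole_dist b" and \<eta>': "0 < \<eta>'" "\<eta>' < pole_dist b"
  shows "line_integral \<eta> z = line_integral \<eta>' z"
proof -
  let ?S = "{w. 0 < Im w} \<inter> {w. Im w < pole_dist b}"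
  let ?G = "\<lambda>w. LINT s|lborel. qdilog_integrand b z (of_real s + w)"
  have "?G (\<i> * of_real \<eta>) = ?G (\<i> * of_real \<eta>')"
  proof (rule constant_if_invariant_under_real_translations[where S = ?S and G = ?G])
    show S: "open ?S"
      by (intro open_Int open_halfspace_Im_gt open_halfspace_Im_lt)
    show "connected ?S"
      by (intro convex_connected convex_Int convex_halfspace_Im_gt convex_halfspace_Im_lt)
    show "?G holomorphic_on ?S"
    proof (rule holomorphic_integral[OF S])
      fix w0 assume w0: "w0 \<in> ?S"
      then obtain r where r: "r > 0" "cball w0 r \<subseteq> ?S"
        using S by (meson open_contains_cball)
      have sub: "0 < Im w \<and> Im w < pole_dist b" if "w \<in> cball w0 r" for w
        using r that by blast
      define K where "K = Im ` cball w0 r"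
      have K: "compact K" "K \<subseteq> {y. y \<noteq> 0 \<and> \<bar>y\<bar> < pole_dist b}"
        unfolding K_def using sub by (fastforce intro!: compact_continuous_image continuous_intros)+
      have ball: "\<bar>Re w\<bar> \<le> \<bar>Re w0\<bar> + r" if "w \<in> cball w0 r" for w
        using that abs_Re_le_cmod[of "w0 - w"] by (auto simp: dist_norm)
      have pre: "\<bar>Re z\<bar> \<le> \<bar>Re z\<bar> + (\<bar>Re w0\<bar> + r)"
          "\<And>w. w \<in> cball w0 r \<Longrightarrow> Im w \<in> K \<and> \<bar>Re w\<bar> \<le> \<bar>Re z\<bar> + (\<bar>Re w0\<bar> + r)"
        using r(1) ball by (simp_all add: K_def add_increasing)
      obtain C where C: "C > 0"
        "\<And>w s. w \<in> cball w0 r \<Longrightarrow> cmod (qdilog_integrand b z (of_real s + w))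
           \<le> C * exp (- (strip_width b - 2 * \<bar>Im z\<bar>) * \<bar>s\<bar>)"
        by (rule integrand_uniform_bound[OF K z, where R = "\<bar>Re z\<bar> + (\<bar>Re w0\<bar> + r)"])
           (rule that, assumption, use pre order_refl in blast)
      have "integrable lborel (\<lambda>s. C * exp (- (strip_width b - 2 * \<bar>Im z\<bar>) * \<bar>s\<bar>))"
        using z by (intro integrable_mult_right integrable_exp_abs) simp
      then show "\<exists>r>0. \<exists>h. integrable lborel h \<and> cball w0 r \<subseteq> ?S \<and>
          (\<forall>w\<in>cball w0 r. \<forall>s\<in>space lborel. cmod (qdilog_integrand b z (of_real s + w)) \<le> h s)"
        using r C(2) by blast
    next
      fix s :: real
      have "(qdilog_integrand b z \<circ> (\<lambda>w. of_real s + w)) holomorphic_on ?S"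
        by (rule holomorphic_on_compose_gen[OF _ integrand_holomorphic_w]) (auto intro!: holomorphic_intros)
      then show "(\<lambda>w. qdilog_integrand b z (of_real s + w)) holomorphic_on ?S"
        by (simp add: o_def)
    qed auto
    show "?G (w + of_real r) = ?G w" for w r
      using lborel_integral_real_affine[of 1 "\<lambda>s. qdilog_integrand b z (of_real s + w)" r]
      by (simp add: add_ac)
  qed (use \<eta> \<eta>' in auto)
  then show ?thesis by (simp add: line_integral_def)
qed

text \<open>
  The integrals over the lines at different heights agree, so the limit that defines the quantum
  dilogarithm is attained at every height below the first pole.
\<close>

lemma qdilog_eq:
  assumes z: "\<bar>Im z\<bar> < strip_width b / 2" and \<eta>: "0 < \<eta>" "\<eta> < pole_dist b"
  shows "qdilog b z = exp (line_integral \<eta> z / 4)"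
proof -
  have "((\<lambda>t. line_integral t z) \<longlongrightarrow> line_integral \<eta> z) (at_right 0)"
  proof (rule tendsto_eventually)
    have "\<forall>\<^sub>F t in at_right 0. t \<in> {0<..<pole_dist b}"
      by (rule eventually_at_right_real) (rule pole_dist_pos)
    then show "\<forall>\<^sub>F t in at_right 0. line_integral t z = line_integral \<eta> z"
      by eventually_elim (use line_integral_shift[OF z _ _ \<eta>] in auto)
  qed
  then have "Lim (at_right 0) (\<lambda>t. line_integral t z) = line_integral \<eta> z"
    by (intro tendsto_Lim) auto
  then have "qdilog_strip b z = exp (line_integral \<eta> z / 4)"
    by (simp add: qdilog_strip_def line_integral_def[abs_def])
  moreover have "\<bar>Im z\<bar> < 1 / (2 * sqrt (hbar b))" using z strip_half_width by simp
  ultimately show ?thesis by (simp add: qdilog_def)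
qed

lemma qdilog_nonzero: "\<bar>Im z\<bar> < strip_width b / 2 \<Longrightarrow> qdilog b z \<noteq> 0"
  using qdilog_eq[of z "pole_dist b / 2"] pole_dist_pos by simp

lemma qdilog_holomorphic: "qdilog b holomorphic_on {z. \<bar>Im z\<bar> < strip_width b / 2}"
proof -
  have "(\<lambda>z. exp (line_integral (pole_dist b / 2) z / 4)) holomorphic_on {z. \<bar>Im z\<bar> < strip_width b / 2}"
    using pole_dist_pos by (intro holomorphic_intros line_integral_holomorphic) auto
  then show ?thesis
    by (rule holomorphic_transform) (use qdilog_eq[of _ "pole_dist b / 2"] pole_dist_pos in auto)
qed

text \<open>
  At \<open>0\<close> the integrand is \<open>exp (- 2izw) g(w) / w\<^sup>3\<close> with \<open>g\<close> even and \<open>g(0) = 1\<close>. Half the second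
  derivative of the numerator is quadratic in \<open>z\<close>, and evenness of \<open>g\<close> removes its linear term; the
  constant term does not influence the growth of the quantum dilogarithm.
\<close>

lemma qdilog_residue:
  shows "\<exists>c. \<forall>z. residue (qdilog_integrand b z) 0 = - 2 * z\<^sup>2 + c"
proof -
  \<comment> \<open>\<open>k c w = sinh (c w) / w\<close>, extended over \<open>0\<close>.\<close>
  define k where "k c w = (if w = 0 then deriv (\<lambda>w. sinh (of_real c * w)) 0
      else (sinh (of_real c * w) - sinh (of_real c * 0)) / (w - 0))" for c :: real and w :: complex
  have k0: "k c 0 = of_real c" for c
  proof -
    have "((\<lambda>w. sinh (of_real c * w)) has_field_derivative cosh (of_real c * 0) * (of_real c * 1)) (at (0::complex))"
      by (rule derivative_eq_intros refl | simp)+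
    then show ?thesis unfolding k_def by (simp add: DERIV_imp_deriv)
  qed
  have kn: "k c w = sinh (of_real c * w) / w" if "w \<noteq> 0" for c w using that by (simp add: k_def)
  have khol: "k c holomorphic_on UNIV" for c
    unfolding k_def by (rule pole_lemma_open) (auto intro!: holomorphic_intros holomorphic_on_sinh)
  have keven: "k c (- w) = k c w" for c w
    by (cases "w = 0") (simp_all add: kn)
  obtain r where r: "r > 0" "\<And>w. w \<in> ball 0 r \<Longrightarrow> k b w * k (1 / b) w \<noteq> 0"
  proof -
    have "continuous_on UNIV (\<lambda>w. k b w * k (1 / b) w)"
      by (intro continuous_intros holomorphic_on_imp_continuous_on khol)
    then have "open ((\<lambda>w. k b w * k (1 / b) w) -` (- {0}))"
      by (intro open_vimage) auto
    moreover have "0 \<in> (\<lambda>w. k b w * k (1 / b) w) -` (- {0})" using b by (simp add: k0)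
    ultimately show ?thesis using that unfolding open_contains_ball by blast
  qed
  define g where "g w = inverse (k b w * k (1 / b) w)" for w
  have ghol: "g holomorphic_on ball 0 r"
    unfolding g_def using r(2)
    by (intro holomorphic_intros holomorphic_on_subset[OF khol]) auto
  have g0: "g 0 = 1" using b by (simp add: g_def k0)
  have dg: "deriv g 0 = 0"
  proof -
    have d: "(g has_field_derivative deriv g 0) (at 0)"
      using ghol r(1) by (intro holomorphic_derivI[of _ "ball 0 r"]) auto
    have "((\<lambda>w. g (- w)) has_field_derivative deriv g 0 * (- 1)) (at 0)"
      by (rule DERIV_chain2[where g = uminus]) (use d in \<open>auto intro!: derivative_eq_intros\<close>)
    moreover have "(\<lambda>w. g (- w)) = g" by (rule ext) (simp add: g_def keven)
    ultimately have "(g has_field_derivative deriv g 0 * (- 1)) (at 0)" by simp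
    from DERIV_unique[OF d this] have "2 * deriv g 0 = 0" by algebra
    then show ?thesis by simp
  qed
  have "residue (qdilog_integrand b z) 0 = - 2 * z\<^sup>2 + (deriv ^^ 2) g 0 / 2" for z
  proof -
    define E where "E w = exp ((- 2 * \<i> * z) * w)" for w
    have dE: "deriv (\<lambda>w. c * exp (a * w)) = (\<lambda>w. (c * a) * exp (a * w))" for a c :: complex
      by (rule ext, rule DERIV_imp_deriv) (rule derivative_eq_intros refl | simp)+
    have E1: "deriv E = (\<lambda>w. (- 2 * \<i> * z) * exp ((- 2 * \<i> * z) * w))"
      using dE[of 1 "- 2 * \<i> * z"] by (simp add: E_def[abs_def])
    have E2: "deriv (deriv E) = (\<lambda>w. ((- 2 * \<i> * z) * (- 2 * \<i> * z)) * exp ((- 2 * \<i> * z) * w))"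
      unfolding E1 by (rule dE)
    have E: "E 0 = 1" "deriv E 0 = - 2 * \<i> * z"
      unfolding E1 by (simp_all add: E_def)
    have E': "deriv (deriv E) 0 = - 4 * z\<^sup>2"
      by (simp only: E2) (simp add: power2_eq_square)
    have Ehol: "E holomorphic_on A" for A
      unfolding E_def by (intro holomorphic_intros)
    have "residue (qdilog_integrand b z) 0 = residue (\<lambda>w. (E w * g w) / w ^ Suc 2) 0"
    proof (rule residue_cong)
      show "\<forall>\<^sub>F w in at 0. qdilog_integrand b z w = E w * g w / w ^ Suc 2"
        unfolding eventually_at_filter
        by (intro always_eventually allI impI)
           (simp add: qdilog_integrand_def E_def g_def kn field_simps power3_eq_cube)
    qed simp
    also have "\<dots> = (deriv ^^ 2) (\<lambda>w. E w * g w) 0 / fact 2"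
      by (rule residue_holomorphic_over_power'[of "ball 0 r"])
         (use r ghol Ehol in \<open>auto intro!: holomorphic_intros\<close>)
    also have "(deriv ^^ 2) (\<lambda>w. E w * g w) 0 =
        (\<Sum>i = 0..2. of_nat (2 choose i) * (deriv ^^ i) E 0 * (deriv ^^ (2 - i)) g 0)"
      by (rule higher_deriv_mult[of _ "ball 0 r"]) (use r ghol Ehol in auto)
    also have "\<dots> = (deriv ^^ 2) g 0 - 4 * z\<^sup>2"
      by (simp add: numeral_2_eq_2 g0 dg E E')
    finally show ?thesis by (simp add: fact_numeral field_simps)
  qed
  then show ?thesis by blast
qed

lemma contour_integral_horizontal:
  fixes f :: "complex \<Rightarrow> complex"
  assumes int: "integrable lborel (\<lambda>s::real. f (of_real s + \<i> * of_real \<eta>))"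
    and f: "f contour_integrable_on linepath (Complex x \<eta>) (Complex y \<eta>)" and xy: "x < y"
  shows "contour_integral (linepath (Complex x \<eta>) (Complex y \<eta>)) f =
         (LINT s|lborel. indicator {x..y} s *\<^sub>R f (of_real s + \<i> * of_real \<eta>))"
proof -
  have lp: "linepath (Complex x \<eta>) (Complex y \<eta>) t = linepath (of_real x) (of_real y) t + \<i> * of_real \<eta>" for t
    by (simp add: linepath_def complex_eq_iff algebra_simps)
  have diff: "Complex y \<eta> - Complex x \<eta> = of_real y - of_real x"
    by (simp add: complex_eq_iff)
  from f obtain J where J: "(f has_contour_integral J) (linepath (Complex x \<eta>) (Complex y \<eta>))"
    by (auto simp: contour_integrable_on_def)
  then have "((\<lambda>w. f (w + \<i> * of_real \<eta>)) has_contour_integral J) (linepath (of_real x) (of_real y))"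
    by (simp only: has_contour_integral_linepath lp diff)
  then have "((\<lambda>s. f (of_real s + \<i> * of_real \<eta>)) has_integral J) {x..y}"
    using xy by (subst (asm) has_contour_integral_linepath_Reals_iff) auto
  moreover have "set_integrable lborel {x..y} (\<lambda>s. f (of_real s + \<i> * of_real \<eta>))"
    unfolding set_integrable_def by (rule integrable_mult_indicator[OF _ int]) simp
  then have "(LINT s:{x..y}|lborel. f (of_real s + \<i> * of_real \<eta>)) =
      integral {x..y} (\<lambda>s. f (of_real s + \<i> * of_real \<eta>))"
    by (rule set_borel_integral_eq_integral)
  ultimately have "J = (LINT s:{x..y}|lborel. f (of_real s + \<i> * of_real \<eta>))"
    by (simp add: integral_unique)
  then show ?thesis
    using contour_integral_unique[OF J] by (simp add: set_lebesgue_integral_def)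
qed

lemma tendsto_integral_symmetric_interval:
  fixes g :: "real \<Rightarrow> complex"
  assumes g: "integrable lborel g"
  shows "(\<lambda>n. LINT s|lborel. indicator {- real (Suc n)..real (Suc n)} s *\<^sub>R g s) \<longlonglongrightarrow> (LINT s|lborel. g s)"
proof (rule integral_dominated_convergence[where w = "\<lambda>s. cmod (g s)"])
  show "AE s in lborel. (\<lambda>n. indicator {- real (Suc n)..real (Suc n)} s *\<^sub>R g s) \<longlonglongrightarrow> g s"
  proof (intro AE_I2 tendsto_eventually)
    fix s :: real
    obtain N where N: "\<bar>s\<bar> \<le> real N" using real_arch_simple by blast
    show "\<forall>\<^sub>F n in sequentially. indicator {- real (Suc n)..real (Suc n)} s *\<^sub>R g s = g s"
      using eventually_ge_at_top[of N] by eventually_elim (use N in \<open>auto simp: indicator_def\<close>)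
  qed
qed (use g in \<open>auto simp: indicator_def\<close>)

text \<open>
  The residue theorem on the rectangles with vertices \<open>\<plusminus> R \<plusminus> i\<eta>\<close>. The vertical sides are bounded by
  \<open>B R\<close>, which tends to \<open>0\<close> because of the factor \<open>1 / R\<close>; the exponential growth of the numerator is
  cancelled by that of the hyperbolic sines.
\<close>

lemma line_integral_jump:
  assumes z: "\<bar>Im z\<bar> < strip_width b / 2" and \<eta>: "0 < \<eta>" "\<eta> < pole_dist b"
  shows "line_integral (- \<eta>) z - line_integral \<eta> z = 2 * of_real pi * \<i> * residue (qdilog_integrand b z) 0"
proof -
  let ?f = "qdilog_integrand b z"
  let ?res = "2 * of_real pi * \<i> * residue ?f 0"
  let ?S = "{w. \<bar>Im w\<bar> < pole_dist b}"
  define R where "R n = real (Suc n)" for n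
  have hol: "?f holomorphic_on ?S - {0}"
  proof -
    have nz: "sinh (of_real b * w) \<noteq> 0 \<and> sinh (w / of_real b) \<noteq> 0" if "w \<in> ?S - {0}" for w
    proof (cases "Im w = 0")
      case True
      then have "Re w \<noteq> 0" using that by (auto simp: complex_eq_iff)
      then have "0 < \<bar>sinh (b * Re w)\<bar>" "0 < \<bar>sinh (Re w / b)\<bar>" using b by auto
      then show ?thesis
        using cmod_sinh_ge(2)[of "of_real b * w"] cmod_sinh_ge(2)[of "w / of_real b"]
        by (auto simp del: zero_less_abs_iff)
    qed (use that denominator_nonzero in auto)
    show ?thesis
      unfolding qdilog_integrand_def using nz b by (intro holomorphic_intros holomorphic_on_sinh) auto
  qed
  have int: "integrable lborel (\<lambda>s::real. ?f (of_real s + \<i> * of_real t))" if "t = \<eta> \<or> t = - \<eta>" for t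
    using that \<eta> by (intro integrand_integrable z) auto
  have cint: "?f contour_integrable_on linepath u v"
    if "closed_segment u v \<subseteq> ?S - {0}" for u v
    using that by (intro contour_integrable_continuous_linepath continuous_on_subset[OF holomorphic_on_imp_continuous_on[OF hol]])
  define side where "side x = contour_integral (linepath (Complex x (- \<eta>)) (Complex x \<eta>)) ?f" for x
  have seg: "closed_segment (Complex x \<eta>') (Complex y \<eta>') \<subseteq> ?S - {0}" if "\<eta>' = \<eta> \<or> \<eta>' = - \<eta>" for x y \<eta>'
    using that \<eta> by (auto simp: closed_segment_same_Im)
  have segv: "closed_segment (Complex x (- \<eta>)) (Complex x \<eta>) \<subseteq> ?S - {0}" if "x \<noteq> 0" for x
    using that \<eta> by (auto simp: closed_segment_same_Re closed_segment_eq_real_ivl)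
  have rect: "(LINT s|lborel. indicator {- R n..R n} s *\<^sub>R ?f (of_real s + \<i> * of_real (- \<eta>))) + side (R n)
      - (LINT s|lborel. indicator {- R n..R n} s *\<^sub>R ?f (of_real s + \<i> * of_real \<eta>)) - side (- R n) = ?res" for n
  proof -
    have R: "R n > 0" by (simp add: R_def)
    let ?a = "Complex (- R n) (- \<eta>)" and ?c = "Complex (R n) \<eta>"
    let ?bb = "Complex (R n) (- \<eta>)" and ?d = "Complex (- R n) \<eta>"
    have res: "contour_integral (rectpath ?a ?c) ?f =
        2 * pi * \<i> * (\<Sum>p\<in>{0}. winding_number (rectpath ?a ?c) p * residue ?f p)"
    proof (rule Residue_theorem[where S = ?S])
      show "connected ?S"
      proof -
        have "?S = {w. - pole_dist b < Im w} \<inter> {w. Im w < pole_dist b}" by auto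
        then show ?thesis
          by (simp only:) (intro convex_connected convex_Int convex_halfspace_Im_gt convex_halfspace_Im_lt)
      qed
      show "path_image (rectpath ?a ?c) \<subseteq> ?S - {0}"
        using R \<eta> by (subst path_image_rectpath) auto
      show "\<forall>z. z \<notin> ?S \<longrightarrow> winding_number (rectpath ?a ?c) z = 0"
        using R \<eta> by (intro allI impI winding_number_rectpath_outside) (auto simp: in_cbox_complex_iff)
    qed (use hol open_strip in auto)
    have wind: "winding_number (rectpath ?a ?c) 0 = 1"
      using R \<eta> by (intro winding_number_rectpath) (auto simp: in_box_complex_iff)
    have split: "contour_integral (rectpath ?a ?c) ?f =
        contour_integral (linepath ?a ?bb) ?f + contour_integral (linepath ?bb ?c) ?f +
        contour_integral (linepath ?c ?d) ?f + contour_integral (linepath ?d ?a) ?f"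
      using R seg[of "- \<eta>" "- R n" "R n"] seg[of \<eta> "R n" "- R n"] segv[of "R n"] segv[of "- R n"]
      by (simp add: rectpath_def Let_def contour_integral_join contour_integrable_join cint
            closed_segment_commute valid_path_join)
    have top: "contour_integral (linepath ?c ?d) ?f = - contour_integral (linepath ?d ?c) ?f"
      using contour_integral_reversepath[of "linepath ?d ?c" ?f] by simp
    have left: "contour_integral (linepath ?d ?a) ?f = - side (- R n)"
      using contour_integral_reversepath[of "linepath ?a ?d" ?f] by (simp add: side_def)
    have hor: "contour_integral (linepath (Complex (- R n) t) (Complex (R n) t)) ?f =
        (LINT s|lborel. indicator {- R n..R n} s *\<^sub>R ?f (of_real s + \<i> * of_real t))"
      if "t = \<eta> \<or> t = - \<eta>" for t
      using R by (intro contour_integral_horizontal int cint seg that) auto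
    from res[unfolded split top left hor[OF disjI1[OF refl]] hor[OF disjI2[OF refl]]] wind
    show ?thesis by (simp add: side_def)
  qed
  define B where "B r = exp (2 * \<bar>Re z\<bar> * \<eta>) * (4 / ((1 - exp (- 2 * b * r)) * (1 - exp (- 2 * r / b)) * r))" for r
  have side_le: "cmod (side x) \<le> B \<bar>x\<bar> * (2 * \<eta>)" if x: "x \<noteq> 0" for x
  proof -
    have pos: "1 - exp (- 2 * b * \<bar>x\<bar>) > 0" "1 - exp (- 2 * \<bar>x\<bar> / b) > 0" using b x by auto
    have B0: "0 \<le> B \<bar>x\<bar>" unfolding B_def using pos by (intro mult_nonneg_nonneg divide_nonneg_nonneg) auto
    have "cmod (?f w) \<le> B \<bar>x\<bar>" if "w \<in> closed_segment (Complex x (- \<eta>)) (Complex x \<eta>)" for w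
    proof -
      have w: "Re w = x" "\<bar>Im w\<bar> \<le> \<eta>"
        using that \<eta> by (auto simp: closed_segment_same_Re closed_segment_eq_real_ivl)
      have sh: "\<bar>sinh t\<bar> = exp \<bar>t\<bar> * (1 - exp (- 2 * \<bar>t\<bar>)) / 2" for t :: real
        by (auto simp: sinh_field_def abs_if field_simps simp flip: exp_add)
      have 1: "exp (b * \<bar>x\<bar>) * (1 - exp (- 2 * b * \<bar>x\<bar>)) / 2 \<le> cmod (sinh (of_real b * w))"
        using cmod_sinh_ge(2)[of "of_real b * w"] w b by (simp add: sh abs_mult mult.assoc)
      have 2: "exp (\<bar>x\<bar> / b) * (1 - exp (- 2 * \<bar>x\<bar> / b)) / 2 \<le> cmod (sinh (w / of_real b))"
        using cmod_sinh_ge(2)[of "w / of_real b"] w b by (simp add: sh abs_mult)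
      have 3: "\<bar>x\<bar> \<le> cmod w" using abs_Re_le_cmod[of w] w by simp
      define P where "P = (exp (b * \<bar>x\<bar>) * (1 - exp (- 2 * b * \<bar>x\<bar>)) / 2) *
          (exp (\<bar>x\<bar> / b) * (1 - exp (- 2 * \<bar>x\<bar> / b)) / 2) * \<bar>x\<bar>"
      have P: "P > 0" unfolding P_def using pos x by (intro mult_pos_pos divide_pos_pos) auto
      have den: "P \<le> cmod (sinh (of_real b * w)) * cmod (sinh (w / of_real b)) * cmod w"
        unfolding P_def using pos x by (intro mult_mono 1 2 3) auto
      have num: "2 * Re z * Im w + 2 * Im z * Re w \<le> 2 * \<bar>Re z\<bar> * \<eta> + strip_width b * \<bar>x\<bar>"
      proof -
        have "Re z * Im w \<le> \<bar>Re z\<bar> * \<bar>Im w\<bar>" by (metis abs_ge_self abs_mult)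
        also have "\<dots> \<le> \<bar>Re z\<bar> * \<eta>" using w by (intro mult_left_mono) auto
        finally have i: "Re z * Im w \<le> \<bar>Re z\<bar> * \<eta>" .
        have "Im z * x \<le> \<bar>Im z\<bar> * \<bar>x\<bar>" by (metis abs_ge_self abs_mult)
        also have "\<dots> \<le> strip_width b / 2 * \<bar>x\<bar>" using z by (intro mult_right_mono) auto
        finally show ?thesis using i w by simp
      qed
      have "cmod (?f w) = exp (2 * Re z * Im w + 2 * Im z * Re w) /
          (cmod (sinh (of_real b * w)) * cmod (sinh (w / of_real b)) * cmod w)"
        by (simp only: qdilog_integrand_def norm_divide norm_mult[of _ w] norm_mult[of "sinh _"] cmod_exp_linear)
      also have "\<dots> \<le> exp (2 * \<bar>Re z\<bar> * \<eta> + strip_width b * \<bar>x\<bar>) / P"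
        using den num P by (intro frac_le) auto
      also have "\<dots> = B \<bar>x\<bar>"
        unfolding B_def P_def strip_width_def distrib_right exp_add by simp
      finally show ?thesis .
    qed
    then have "cmod (side x) \<le> B \<bar>x\<bar> * cmod (Complex x \<eta> - Complex x (- \<eta>))"
      unfolding side_def using x B0
      by (intro contour_integral_bound_linepath cint segv)
    also have "Complex x \<eta> - Complex x (- \<eta>) = \<i> * of_real (2 * \<eta>)"
      by (simp add: complex_eq_iff)
    finally show ?thesis using \<eta> by (simp add: norm_mult)
  qed
  have "(B \<longlongrightarrow> 0) at_top"
    unfolding B_def using b by real_asymp
  then have "((\<lambda>n. B (R n)) \<longlongrightarrow> 0) sequentially"
    unfolding R_def by (rule filterlim_compose) real_asymp
  then have Blim: "(\<lambda>n. B (R n) * (2 * \<eta>)) \<longlonglongrightarrow> 0"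
    by (rule tendsto_mult_left_zero)
  have R0: "R n \<noteq> 0" "\<bar>R n\<bar> = R n" for n by (simp_all add: R_def)
  have s1: "(\<lambda>n. side (R n)) \<longlonglongrightarrow> 0"
    by (rule Lim_null_comparison[OF _ Blim]) (use side_le[of "R _"] R0 in auto)
  have s2: "(\<lambda>n. side (- R n)) \<longlonglongrightarrow> 0"
    by (rule Lim_null_comparison[OF _ Blim]) (use side_le[of "- R _"] R0 in auto)
  have "(\<lambda>n. (LINT s|lborel. indicator {- R n..R n} s *\<^sub>R ?f (of_real s + \<i> * of_real (- \<eta>))) + side (R n)
      - (LINT s|lborel. indicator {- R n..R n} s *\<^sub>R ?f (of_real s + \<i> * of_real \<eta>)) - side (- R n))
      \<longlonglongrightarrow> line_integral (- \<eta>) z + 0 - line_integral \<eta> z - 0"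
    unfolding line_integral_def R_def
    by (intro tendsto_intros tendsto_integral_symmetric_interval int s1[unfolded R_def] s2[unfolded R_def]) auto
  then show ?thesis unfolding rect by (simp add: LIMSEQ_const_iff)
qed

text \<open>
  On the line of height \<open>\<eta>\<close> the exponential contributes \<open>exp (2 \<eta> Re z)\<close>, so the line above the
  pole is good for \<open>Re z \<le> 0\<close> and the line below for \<open>Re z \<ge> 0\<close>.
\<close>

lemma line_integral_bounded_on_half_strip:
  assumes Y: "Y < strip_width b / 2" and \<eta>: "\<eta> \<noteq> 0" "\<bar>\<eta>\<bar> < pole_dist b"
  obtains M where "\<And>z. \<bar>Im z\<bar> \<le> Y \<Longrightarrow> Re z * \<eta> \<le> 0 \<Longrightarrow> cmod (line_integral \<eta> z) \<le> M"
proof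
  fix z assume z: "\<bar>Im z\<bar> \<le> Y" "Re z * \<eta> \<le> 0"
  let ?h = "\<lambda>s. pole_bound \<eta> * exp (- (strip_width b - 2 * Y) * \<bar>s\<bar>)"
  have "cmod (line_integral \<eta> z) \<le> (LINT s|lborel. ?h s)"
    unfolding line_integral_def
  proof (rule Bochner_Integration.integral_norm_bound_integral)
    show "integrable lborel (\<lambda>s. qdilog_integrand b z (of_real s + \<i> * of_real \<eta>))"
      using z Y \<eta> by (intro integrand_integrable) auto
    show "integrable lborel ?h"
      using Y by (intro integrable_mult_right integrable_exp_abs) simp
    fix s :: real
    have "cmod (qdilog_integrand b z (of_real s + \<i> * of_real \<eta>)) \<le>
        pole_bound \<eta> * exp (2 * Re z * \<eta> + 2 * Im z * s - strip_width b * \<bar>s\<bar>)"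
      using cmod_integrand_le[of "of_real s + \<i> * of_real \<eta>" z] \<eta> by simp
    also have "\<dots> \<le> ?h s"
    proof (intro mult_left_mono)
      have "Im z * s \<le> \<bar>Im z\<bar> * \<bar>s\<bar>" by (metis abs_ge_self abs_mult)
      also have "\<dots> \<le> Y * \<bar>s\<bar>" using z by (intro mult_right_mono) auto
      finally show "exp (2 * Re z * \<eta> + 2 * Im z * s - strip_width b * \<bar>s\<bar>)
          \<le> exp (- (strip_width b - 2 * Y) * \<bar>s\<bar>)"
        using z(2) by (simp add: algebra_simps)
    qed (simp add: pole_bound_def)
    finally show "cmod (qdilog_integrand b z (of_real s + \<i> * of_real \<eta>)) \<le> ?h s" .
  qed
  then show "cmod (line_integral \<eta> z) \<le> (LINT s|lborel. ?h s)" .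
qed

text \<open>
  To the left the logarithm of the quantum dilogarithm is a bounded integral. To the right the contour is
  moved below the pole at \<open>0\<close>; the new integral is bounded, and the residue contributes
  \<open>i\<pi>z\<^sup>2 + const\<close>, of real part \<open>- 2\<pi>xy + const\<close>.
\<close>

lemma qdilog_bounds:
  assumes Y: "Y < strip_width b / 2"
  obtains C where "C > 0"
    "\<And>x y. \<bar>y\<bar> \<le> Y \<Longrightarrow> cmod (qdilog b (Complex x y)) \<le> C * exp (- (2 * pi * max 0 x * y))"
    "\<And>x y. \<bar>y\<bar> \<le> Y \<Longrightarrow> cmod (1 / qdilog b (Complex x y)) \<le> C * exp (2 * pi * max 0 x * y)"
proof -
  define \<eta> where "\<eta> = pole_dist b / 2"
  have \<eta>: "0 < \<eta>" "\<eta> < pole_dist b" using pole_dist_pos by (auto simp: \<eta>_def)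
  obtain M where M: "\<And>z. \<bar>Im z\<bar> \<le> Y \<Longrightarrow> Re z * \<eta> \<le> 0 \<Longrightarrow> cmod (line_integral \<eta> z) \<le> M"
    using line_integral_bounded_on_half_strip[OF Y, of \<eta>] \<eta> by auto
  obtain M' where M': "\<And>z. \<bar>Im z\<bar> \<le> Y \<Longrightarrow> Re z * (- \<eta>) \<le> 0 \<Longrightarrow> cmod (line_integral (- \<eta>) z) \<le> M'"
    using line_integral_bounded_on_half_strip[OF Y, of "- \<eta>"] \<eta> by auto
  obtain c where c: "\<And>z. residue (qdilog_integrand b z) 0 = - 2 * z\<^sup>2 + c"
    using qdilog_residue by blast
  define d where "d = 2 * of_real pi * \<i> * c"
  define L where "L = (\<bar>M\<bar> + \<bar>M'\<bar> + cmod d) / 4"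
  have key: "\<bar>Re (line_integral \<eta> z / 4) + 2 * pi * max 0 (Re z) * Im z\<bar> \<le> L" if z: "\<bar>Im z\<bar> \<le> Y" for z
  proof (cases "Re z \<le> 0")
    case True
    then have "cmod (line_integral \<eta> z) \<le> M" using M[OF z] \<eta> by (simp add: mult_nonpos_nonneg)
    then have "\<bar>Re (line_integral \<eta> z)\<bar> \<le> \<bar>M\<bar>"
      using abs_Re_le_cmod[of "line_integral \<eta> z"] by linarith
    moreover have "\<bar>M\<bar> \<le> \<bar>M\<bar> + \<bar>M'\<bar> + cmod d" by simp
    ultimately have "\<bar>Re (line_integral \<eta> z)\<bar> \<le> \<bar>M\<bar> + \<bar>M'\<bar> + cmod d" by (rule order_trans)
    then show ?thesis using True unfolding L_def by simp
  next
    case False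
    then have "cmod (line_integral (- \<eta>) z) \<le> M'" using M'[OF z] \<eta> by simp
    then have 1: "\<bar>Re (line_integral (- \<eta>) z)\<bar> \<le> \<bar>M'\<bar>"
      using abs_Re_le_cmod[of "line_integral (- \<eta>) z"] by linarith
    have "line_integral \<eta> z = line_integral (- \<eta>) z - 2 * of_real pi * \<i> * (- 2 * z\<^sup>2 + c)"
      using line_integral_jump[of z \<eta>] z Y \<eta> c[of z] by (simp add: algebra_simps)
    also have "\<dots> = line_integral (- \<eta>) z + 4 * of_real pi * (\<i> * z\<^sup>2) - d"
      by (simp add: d_def algebra_simps)
    finally have re: "Re (line_integral \<eta> z) = Re (line_integral (- \<eta>) z) - 8 * pi * (Re z * Im z) - Re d"
      by (simp add: power2_eq_square)
    have half: "Re (line_integral \<eta> z / 4) + 2 * pi * max 0 (Re z) * Im z =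
        (Re (line_integral \<eta> z) + 8 * pi * (Re z * Im z)) / 4"
      using False by (simp add: max_def add_divide_distrib)
    have "Re (line_integral \<eta> z / 4) + 2 * pi * max 0 (Re z) * Im z =
        (Re (line_integral (- \<eta>) z) - Re d) / 4"
      by (simp only: half re) simp
    moreover have "\<bar>Re (line_integral (- \<eta>) z) - Re d\<bar> \<le> \<bar>M\<bar> + \<bar>M'\<bar> + cmod d"
      using 1 abs_Re_le_cmod[of d] by linarith
    ultimately show ?thesis unfolding L_def by (simp only:) simp
  qed
  have cm: "cmod (qdilog b (Complex x y)) = exp (Re (line_integral \<eta> (Complex x y) / 4))" if "\<bar>y\<bar> \<le> Y" for x y
    using qdilog_eq[of "Complex x y", OF _ \<eta>] that Y by simp
  show ?thesis
  proof (rule that[of "exp L"])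
    fix x y :: real assume y: "\<bar>y\<bar> \<le> Y"
    define A where "A = Re (line_integral \<eta> (Complex x y) / 4)"
    define B where "B = 2 * pi * max 0 x * y"
    have k: "A \<le> L + - B" "- A \<le> L + B"
      using key[of "Complex x y"] y by (simp_all add: A_def B_def)
    show "cmod (qdilog b (Complex x y)) \<le> exp L * exp (- (2 * pi * max 0 x * y))"
      using k(1) unfolding cm[OF y] exp_add[symmetric] exp_le_cancel_iff A_def B_def .
    have "cmod (1 / qdilog b (Complex x y)) = 1 / cmod (qdilog b (Complex x y))"
      by (simp only: norm_divide norm_one)
    also have "\<dots> = exp (- A)"
      by (simp only: cm[OF y] A_def exp_minus inverse_eq_divide)
    also have "\<dots> \<le> exp (L + B)" using k(2) by (simp only: exp_le_cancel_iff)
    finally show "cmod (1 / qdilog b (Complex x y)) \<le> exp L * exp (2 * pi * max 0 x * y)"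
      by (simp only: exp_add B_def)
  qed simp
qed

end

section \<open>The factors of the dynamical content\<close>

definition tet_factor :: "real \<Rightarrow> int \<Rightarrow> shape \<Rightarrow> real \<Rightarrow> complex" where
  "tet_factor b \<epsilon> s t =
     of_real (exp (shape_c s * t / sqrt (hbar b))) /
     (qdilog b (of_real t - \<i> / of_real (2 * pi * sqrt (hbar b)) * of_int \<epsilon> * of_real (pi - shape_a s))) powi \<epsilon>"

lemma open_shapesD:
  assumes "s \<in> open_shapes"
  shows "0 < shape_a s" "shape_a s < pi" "0 < shape_b s" "shape_b s < pi" "0 < shape_c s" "shape_c s < pi"
    "shape_a s + shape_b s + shape_c s = pi"
  using assms by (auto simp: open_shapes_def shape_a_def shape_b_def shape_c_def)

lemma continuous_shape_a: "continuous_on A shape_a"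
  unfolding shape_a_def by (intro continuous_intros)
lemma continuous_shape_c: "continuous_on A shape_c"
  unfolding shape_c_def by (intro continuous_intros)

context
  fixes b :: real
  assumes b: "b > 0"
begin

lemma strip_width_eq: "strip_width b = 1 / sqrt (hbar b)"
  using inverse_sqrt_hbar[OF b] by simp

lemma strip_width_pos: "strip_width b > 0"
  using strip_width_eq hbar_pos[OF b] by simp

text \<open>
  The imaginary part of the argument of the quantum dilogarithm.
\<close>

definition tet_height :: "int \<Rightarrow> shape \<Rightarrow> real" where
  "tet_height \<epsilon> s = - of_int \<epsilon> * (pi - shape_a s) * strip_width b / (2 * pi)"

lemma tet_argument:
  "of_real t - \<i> / of_real (2 * pi * sqrt (hbar b)) * of_int \<epsilon> * of_real (pi - shape_a s) =
   Complex t (tet_height \<epsilon> s)"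
  using hbar_pos[OF b] by (simp add: complex_eq_iff tet_height_def strip_width_eq Im_divide Re_divide power2_eq_square field_simps)

lemma tet_height_bound:
  assumes \<epsilon>: "\<epsilon> = 1 \<or> \<epsilon> = -1" and m: "m \<le> shape_a s" "shape_a s < pi"
  shows "\<bar>tet_height \<epsilon> s\<bar> \<le> (pi - m) * strip_width b / (2 * pi)"
proof -
  have "\<bar>tet_height \<epsilon> s\<bar> = (pi - shape_a s) * strip_width b / (2 * pi)"
    using \<epsilon> m strip_width_pos by (auto simp: tet_height_def abs_mult)
  also have "\<dots> \<le> (pi - m) * strip_width b / (2 * pi)"
    using m strip_width_pos by (intro divide_right_mono mult_right_mono) auto
  finally show ?thesis .
qed

lemma height_lt_half_strip:
  assumes "m > 0" shows "(pi - m) * strip_width b / (2 * pi) < strip_width b / 2"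
  using assms strip_width_pos by (simp add: field_simps)

text \<open>
  For both signs the quantum dilogarithm contributes \<open>exp (- max(t, 0) (\<pi> - a) / \<surd>\<hbar>)\<close>, by
  \<open>qdilog_bounds\<close>. Together with \<open>exp (c t / \<surd>\<hbar>)\<close> this leaves the rate \<open>c\<close> for \<open>t < 0\<close> and
  \<open>\<pi> - a - c = b\<close> for \<open>t > 0\<close>.
\<close>

lemma tet_factor_bound:
  assumes m: "m > 0"
  obtains C where "C > 0"
    "\<And>s \<epsilon> t. s \<in> open_shapes \<Longrightarrow> \<epsilon> = 1 \<or> \<epsilon> = -1 \<Longrightarrow> m \<le> shape_a s \<Longrightarrow> m \<le> shape_b s \<Longrightarrow> m \<le> shape_c s \<Longrightarrow>
       cmod (tet_factor b \<epsilon> s t) \<le> C * exp (- (m * strip_width b) * \<bar>t\<bar>)"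
proof -
  define q where "q = strip_width b"
  have q: "q > 0" using strip_width_pos by (simp add: q_def)
  obtain C where C: "C > 0"
    "\<And>x y. \<bar>y\<bar> \<le> (pi - m) * q / (2 * pi) \<Longrightarrow> cmod (qdilog b (Complex x y)) \<le> C * exp (- (2 * pi * max 0 x * y))"
    "\<And>x y. \<bar>y\<bar> \<le> (pi - m) * q / (2 * pi) \<Longrightarrow> cmod (1 / qdilog b (Complex x y)) \<le> C * exp (2 * pi * max 0 x * y)"
    unfolding q_def by (rule qdilog_bounds[OF b height_lt_half_strip[OF m]]) blast
  show ?thesis
  proof (rule that[OF C(1)])
    fix s \<epsilon> t
    assume s: "s \<in> open_shapes" and \<epsilon>: "\<epsilon> = 1 \<or> \<epsilon> = (-1 :: int)"
      and mm: "m \<le> shape_a s" "m \<le> shape_b s" "m \<le> shape_c s"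
    note sh = open_shapesD[OF s]
    let ?z = "Complex t (tet_height \<epsilon> s)"
    have y: "\<bar>tet_height \<epsilon> s\<bar> \<le> (pi - m) * q / (2 * pi)"
      unfolding q_def by (rule tet_height_bound[OF \<epsilon> mm(1) sh(2)])
    have e: "2 * pi * max 0 t * tet_height \<epsilon> s = - of_int \<epsilon> * (max 0 t * (pi - shape_a s) * q)"
      by (simp add: tet_height_def q_def)
    have cm: "cmod (tet_factor b \<epsilon> s t) = exp (shape_c s * t * q) * cmod (1 / (qdilog b ?z) powi \<epsilon>)"
      unfolding tet_factor_def tet_argument by (simp add: norm_divide q_def strip_width_eq)
    have "cmod (1 / (qdilog b ?z) powi \<epsilon>) \<le> C * exp (- (max 0 t * (pi - shape_a s) * q))"
      using \<epsilon>
    proof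
      assume "\<epsilon> = 1"
      then show ?thesis using C(3)[OF y, of t] e by simp
    next
      assume \<epsilon>: "\<epsilon> = -1"
      have "1 / (qdilog b ?z) powi \<epsilon> = qdilog b ?z"
        by (simp add: \<epsilon> power_int_minus inverse_eq_divide)
      moreover have "2 * pi * max 0 t * tet_height \<epsilon> s = max 0 t * (pi - shape_a s) * q"
        unfolding e by (simp add: \<epsilon>)
      ultimately show ?thesis using C(2)[OF y, of t] by (simp only:)
    qed
    then have "cmod (tet_factor b \<epsilon> s t) \<le> exp (shape_c s * t * q) * (C * exp (- (max 0 t * (pi - shape_a s) * q)))"
      unfolding cm by (intro mult_left_mono) auto
    also have "\<dots> = C * exp ((shape_c s * t - max 0 t * (pi - shape_a s)) * q)"
      by (simp add: exp_add[symmetric] algebra_simps)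
    also have "\<dots> \<le> C * exp (- (m * q) * \<bar>t\<bar>)"
    proof -
      have "shape_c s * t - max 0 t * (pi - shape_a s) \<le> - m * \<bar>t\<bar>"
      proof (cases "t \<ge> 0")
        case True
        have "shape_c s - (pi - shape_a s) = - shape_b s" using sh(7) by linarith
        then have "shape_c s * t - t * (pi - shape_a s) = - shape_b s * t"
          by (metis left_diff_distrib mult.commute)
        then show ?thesis using True mm(2) by (simp add: max_def mult_right_mono)
      next
        case False
        then show ?thesis using mm(3) by (simp add: max_def mult_right_mono_neg)
      qed
      then have "(shape_c s * t - max 0 t * (pi - shape_a s)) * q \<le> (- m * \<bar>t\<bar>) * q"
        using q by (intro mult_right_mono) auto
      then show ?thesis using C(1) by (intro mult_left_mono) (auto simp: mult_ac)
    qed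
    finally show "cmod (tet_factor b \<epsilon> s t) \<le> C * exp (- (m * strip_width b) * \<bar>t\<bar>)" by (simp add: q_def)
  qed
qed

lemma continuous_qdilog: "continuous_on {z. \<bar>Im z\<bar> < strip_width b / 2} (qdilog b)"
  by (intro holomorphic_on_imp_continuous_on qdilog_holomorphic b)

lemma tet_argument_in_strip:
  assumes "s \<in> open_shapes" and \<epsilon>: "\<epsilon> = 1 \<or> \<epsilon> = -1"
  shows "Complex t (tet_height \<epsilon> s) \<in> {z. \<bar>Im z\<bar> < strip_width b / 2}"
  using tet_height_bound[OF \<epsilon> order_refl, of s] height_lt_half_strip[of "shape_a s"] open_shapesD[OF assms(1)]
  by simp

lemma tet_factor_continuous:
  assumes \<epsilon>: "\<epsilon> = 1 \<or> \<epsilon> = -1"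
  shows "continuous_on (open_shapes \<times> UNIV) (\<lambda>(s, t). tet_factor b \<epsilon> s t)"
proof -
  have h: "continuous_on A (\<lambda>p. Complex (snd p) (tet_height \<epsilon> (fst p)))" for A :: "(shape \<times> real) set"
    unfolding Complex_eq tet_height_def
    by (intro continuous_intros continuous_on_compose2[OF continuous_shape_a[of UNIV]]) auto
  have "continuous_on (open_shapes \<times> UNIV) (\<lambda>p. qdilog b (Complex (snd p) (tet_height \<epsilon> (fst p))))"
    by (rule continuous_on_compose2[OF continuous_qdilog h]) (use tet_argument_in_strip \<epsilon> in auto)
  moreover have "qdilog b (Complex t (tet_height \<epsilon> s)) \<noteq> 0" if "s \<in> open_shapes" for s t
    using qdilog_nonzero[OF b, of "Complex t (tet_height \<epsilon> s)"] tet_argument_in_strip[OF that \<epsilon>] by auto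
  ultimately have "continuous_on (open_shapes \<times> UNIV)
      (\<lambda>p. of_real (exp (shape_c (fst p) * snd p / sqrt (hbar b))) /
           (qdilog b (Complex (snd p) (tet_height \<epsilon> (fst p)))) powi \<epsilon>)"
    using hbar_pos[OF b]
    by (intro continuous_intros continuous_on_power_int continuous_on_compose2[OF continuous_shape_c[of UNIV]]) auto
  then show ?thesis
    unfolding tet_factor_def tet_argument by (simp add: split_def)
qed

lemma tet_factor_measurable:
  assumes "s \<in> open_shapes" "\<epsilon> = 1 \<or> \<epsilon> = -1"
  shows "tet_factor b \<epsilon> s \<in> borel_measurable borel"
proof (rule borel_measurable_continuous_onI)
  show "continuous_on UNIV (tet_factor b \<epsilon> s)"
    using continuous_on_compose2[OF tet_factor_continuous[OF assms(2)] continuous_on_Pair[OF continuous_on_const continuous_on_id], of s UNIV] assms(1)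
    by auto
qed

lemma tet_factor_tendsto:
  assumes s: "(f \<longlongrightarrow> s0) F" "\<forall>\<^sub>F x in F. f x \<in> open_shapes" "s0 \<in> open_shapes" and \<epsilon>: "\<epsilon> = 1 \<or> \<epsilon> = -1"
  shows "((\<lambda>x. tet_factor b \<epsilon> (f x) t) \<longlongrightarrow> tet_factor b \<epsilon> s0 t) F"
proof -
  have "continuous_on open_shapes (\<lambda>s. tet_factor b \<epsilon> s t)"
    using continuous_on_compose2[OF tet_factor_continuous[OF \<epsilon>] continuous_on_Pair[OF continuous_on_id continuous_on_const], of t open_shapes]
    by auto
  then show ?thesis by (rule continuous_on_tendsto_compose) (use s in auto)
qed

end

lemma dynamical_content_eq:
  "dynamical_content b X \<alpha> t = (\<Prod>T\<in>tets X. tet_factor b (tsign X T) (\<alpha> T) (t T))"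
  by (simp add: dynamical_content_def tet_factor_def)

section \<open>Edge classes of the twist knot triangulations\<close>

lemma face_vertices_simps:
  "face_vertices 0 = [1, 2, 3]" "face_vertices (Suc 0) = [0, 2, 3]"
  "face_vertices 2 = [0, 1, 3]" "face_vertices 3 = [0, 1, 2]"
  by (simp_all add: face_vertices_def upt_rec numeral_eq_Suc)

lemma sym_edge_glue: "sym (edge_glue X)"
  unfolding edge_glue_def sym_def by fastforce

lemma edge_glue_in_tet_edges: "(e, e') \<in> edge_glue X \<Longrightarrow> e' \<in> tet_edges X"
proof -
  have "face_vertices l ! i < face_vertices l ! j \<and> face_vertices l ! j < 4"
    if "l < 4" "i < j" "j < 3" for l i j
  proof -
    have "l = 0 \<or> l = Suc 0 \<or> l = 2 \<or> l = 3" "(i = 0 \<and> j = 1) \<or> (i = 0 \<and> j = 2) \<or> (i = 1 \<and> j = 2)"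
      using that by auto
    then show ?thesis by (auto simp: face_vertices_simps)
  qed
  then show "(e, e') \<in> edge_glue X \<Longrightarrow> e' \<in> tet_edges X"
    unfolding edge_glue_def tet_edges_def by fastforce
qed

text \<open>
  An edge class is found by guessing it. A labelling of the edges of the glued faces
  that is compatible with all tetrahedra is constant on edge classes; conversely it suffices to connect
  every edge with the same label to one representative.
\<close>

lemma edge_class_eq_label_fibre:
  fixes label :: "'t \<times> nat \<times> nat \<Rightarrow> 'l" and face_label :: "'f \<Rightarrow> nat \<Rightarrow> nat \<Rightarrow> 'l"
  assumes compat: "\<And>T k i j. T \<in> tets X \<Longrightarrow> k < 4 \<Longrightarrow> i < j \<Longrightarrow> j < 3 \<Longrightarrow>
      label (T, face_vertices k ! i, face_vertices k ! j) = face_label (face X T k) i j"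
    and r: "r \<in> tet_edges X"
    and conn: "\<And>e. e \<in> tet_edges X \<Longrightarrow> label e = label r \<Longrightarrow> (e, r) \<in> (edge_glue X)\<^sup>*"
  shows "(edge_glue X)\<^sup>* `` {r} = {e \<in> tet_edges X. label e = label r}"
proof (intro equalityI subsetI)
  fix e assume "e \<in> (edge_glue X)\<^sup>* `` {r}"
  then have "(r, e) \<in> (edge_glue X)\<^sup>*" by auto
  then show "e \<in> {e \<in> tet_edges X. label e = label r}"
  proof (induction rule: rtrancl_induct)
    case (step x y)
    then have "label y = label x"
      using step(2) compat unfolding edge_glue_def by fastforce
    then show ?case using step edge_glue_in_tet_edges[OF step(2)] by simp
  qed (use r in auto)
next
  fix e assume "e \<in> {e \<in> tet_edges X. label e = label r}"
  then have "(e, r) \<in> (edge_glue X)\<^sup>*" using conn by auto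
  then have "(r, e) \<in> (edge_glue X)\<^sup>*"
    using sym_rtrancl[OF sym_edge_glue] by (meson symD)
  then show "e \<in> (edge_glue X)\<^sup>* `` {r}" by auto
qed

lemma weight_label_fibre:
  assumes "finite (tets X)"
  shows "weight \<alpha> {e \<in> tet_edges X. label e = l} =
    (\<Sum>t\<in>tets X. \<Sum>(i, j)\<in>{(0, 1), (0, 2), (0, 3), (1, 2), (1, 3), (2, 3)}.
        if label (t, i, j) = l then edge_angle (\<alpha> t) i j else 0)"
proof -
  let ?P = "{(0, 1), (0, 2), (0, 3), (1, 2), (1, 3), (2, 3)} :: (nat \<times> nat) set"
  have te: "tet_edges X = tets X \<times> ?P"
  proof -
    have "i < j \<and> j < 4 \<longleftrightarrow> (i, j) \<in> ?P" for i j :: nat by auto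
    then show ?thesis unfolding tet_edges_def by auto
  qed
  have "weight \<alpha> {e \<in> tet_edges X. label e = l} =
      (\<Sum>e\<in>tet_edges X. if label e = l then (case e of (t, i, j) \<Rightarrow> edge_angle (\<alpha> t) i j) else 0)"
    unfolding weight_def using assms by (intro sum.inter_filter) (simp add: te)
  also have "\<dots> = (\<Sum>t\<in>tets X. \<Sum>q\<in>?P. if label (t, q) = l then edge_angle (\<alpha> t) (fst q) (snd q) else 0)"
    unfolding te sum.cartesian_product by (intro sum.cong) (auto split: prod.split)
  finally show ?thesis by (simp add: split_def)
qed

text \<open>
  The labels of the edges \<open>01, 02, 12\<close> of each face. For \<open>k \<le> p + 1\<close> the label \<open>k\<close> belongs to the edge
  \<open>02\<close> of \<open>e\<^sub>k\<close>, and \<open>0\<close> to the edge \<open>01\<close> of \<open>e\<^sub>1\<close>; these labels also fit when \<open>p = 0\<close>, where two of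
  the classes for \<open>p > 0\<close> coincide. The labels \<open>p + 3\<close> and \<open>p + 4\<close> stand for the edge \<open>01\<close> of \<open>s\<close> and
  for the distinguished edge. The class of the edge \<open>02\<close> of \<open>v\<close> has a label \<open>C\<close> of its own, \<open>p + 2\<close>, in
  \<open>Y\<^sub>n\<close>, whereas in \<open>X\<^sub>n\<close>, where \<open>s\<close> and \<open>s'\<close> are identified, it merges with the class \<open>p\<close>.
\<close>

fun twist_face_label :: "nat \<Rightarrow> nat \<Rightarrow> twist_face \<Rightarrow> nat list" where
  "twist_face_label p C (Fe k) = [k - 1, k, 0]"
| "twist_face_label p C (Ff k) = [0, k + 1, k]"
| "twist_face_label p C Fs = [p + 3, p, p]"
| "twist_face_label p C Fs' = [p + 3, C, C]"
| "twist_face_label p C Fv = [p + 1, C, p + 3]"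
| "twist_face_label p C Fr = [p, C, p + 3]"
| "twist_face_label p C Fg = [p + 3, p + 1, p]"
| "twist_face_label p C Fu = [0, p + 3, p + 3]"
| "twist_face_label p C Fm = [C, p, p + 4]"

text \<open>
  The labels of the edges \<open>01, 02, 03, 12, 13, 23\<close> of each tetrahedron.
\<close>

fun twist_labels :: "nat \<Rightarrow> nat \<Rightarrow> twist_tet \<Rightarrow> nat list" where
  "twist_labels p C (T k) = [0, k, k + 1, k - 1, k, 0]"
| "twist_labels p C U = [p + 3, p + 1, C, p, C, p + 3]"
| "twist_labels p C V = [0, p + 3, p + 1, p + 3, p, p]"
| "twist_labels p C W = [p, p + 1, C, 0, p + 3, p + 3]"
| "twist_labels p C Z = [p + 3, C, p, C, p, p + 4]"

text \<open>
  The position of the edge \<open>ij\<close> in the list \<open>01, 02, 03, 12, 13, 23\<close>.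
\<close>

definition edge_index :: "nat \<Rightarrow> nat \<Rightarrow> nat" where
  "edge_index i j = (if i = 0 then j - 1 else i + j)"

definition twist_label :: "nat \<Rightarrow> nat \<Rightarrow> twist_tet \<times> nat \<times> nat \<Rightarrow> nat" where
  "twist_label p C e = (case e of (t, i, j) \<Rightarrow> twist_labels p C t ! edge_index i j)"

lemma tets_simps:
  "tets (Y_tri n) = T ` {1..twist_p n} \<union> {U, V, W, Z}"
  "tets (X_tri n) = T ` {1..twist_p n} \<union> {U, V, W}"
  "face (Y_tri n) t k = Y_faces n t ! k"
  "face (X_tri n) t k = X_faces n t ! k"
  "tsign (Y_tri n) = twist_sign"
  by (simp_all add: Y_tri_def X_tri_def)

lemma label_compat_Y:
  assumes "t \<in> tets (Y_tri n)" "k < 4" "i < j" "j < 3"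
  shows "twist_label (twist_p n) C (t, face_vertices k ! i, face_vertices k ! j) =
         twist_face_label (twist_p n) C (face (Y_tri n) t k) ! (i + j - 1)"
proof -
  have k: "k = 0 \<or> k = Suc 0 \<or> k = 2 \<or> k = 3" and ij: "i = 0 \<and> j = 1 \<or> i = 0 \<and> j = 2 \<or> i = 1 \<and> j = 2"
    using assms(2-4) by auto
  note simps = tets_simps twist_label_def edge_index_def face_vertices_simps face_f_def
  from assms(1) consider m where "t = T m" "m \<ge> 1" | "t = U" | "t = V" | "t = W" | "t = Z"
    by (auto simp: tets_simps)
  then show ?thesis
    by cases (use k ij in \<open>elim disjE conjE; simp add: simps\<close>)+
qed

lemma label_compat_X:
  assumes "t \<in> tets (X_tri n)" "k < 4" "i < j" "j < 3"
  shows "twist_label (twist_p n) (twist_p n) (t, face_vertices k ! i, face_vertices k ! j) =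
         twist_face_label (twist_p n) (twist_p n) (face (X_tri n) t k) ! (i + j - 1)"
proof -
  have k: "k = 0 \<or> k = Suc 0 \<or> k = 2 \<or> k = 3" and ij: "i = 0 \<and> j = 1 \<or> i = 0 \<and> j = 2 \<or> i = 1 \<and> j = 2"
    using assms(2-4) by auto
  note simps = tets_simps twist_label_def edge_index_def face_vertices_simps face_f_def X_faces_def
  from assms(1) consider m where "t = T m" "m \<ge> 1" | "t = U" | "t = V" | "t = W"
    by (auto simp: tets_simps)
  then show ?thesis
    by cases (use k ij in \<open>elim disjE conjE; simp add: simps\<close>)+
qed

lemma glueI:
  assumes "t \<in> tets X" "t' \<in> tets X" "face X t k = face X t' l" "k < 4" "l < 4" "i < j" "j < 3"
    "x = face_vertices k ! i" "y = face_vertices k ! j" "x' = face_vertices l ! i" "y' = face_vertices l ! j"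
  shows "((t, x, y), (t', x', y')) \<in> (edge_glue X)\<^sup>* \<and> ((t', x', y'), (t, x, y)) \<in> (edge_glue X)\<^sup>*"
proof -
  have "((t, x, y), (t', x', y')) \<in> edge_glue X"
    unfolding edge_glue_def using assms by blast
  then show ?thesis using sym_edge_glue[of X] by (auto dest: symD)
qed

definition same_edge :: "('t, 'f) triangulation \<Rightarrow> 't \<times> nat \<times> nat \<Rightarrow> 't \<times> nat \<times> nat \<Rightarrow> bool" where
  "same_edge X e e' \<longleftrightarrow> (e, e') \<in> (edge_glue X)\<^sup>* \<and> (e', e) \<in> (edge_glue X)\<^sup>*"

lemma same_edge_refl [simp]: "same_edge X e e"
  by (simp add: same_edge_def)

lemma same_edge_sym: "same_edge X e e' \<Longrightarrow> same_edge X e' e"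
  by (simp add: same_edge_def)

lemma same_edge_trans [trans]: "same_edge X e e' \<Longrightarrow> same_edge X e' e'' \<Longrightarrow> same_edge X e e''"
  by (auto simp: same_edge_def)

text \<open>
  In the applications of this rule the numbers are the two glued faces and the positions of the endpoints
  of the edge in them.
\<close>

lemma same_edgeI:
  assumes "face X t k = face X t' l" "t \<in> tets X" "t' \<in> tets X"  "k < 4" "l < 4" "i < j" "j < 3"
    "x = face_vertices k ! i" "y = face_vertices k ! j" "x' = face_vertices l ! i" "y' = face_vertices l ! j"
  shows "same_edge X (t, x, y) (t', x', y')"
  unfolding same_edge_def using assms by (intro glueI)

text \<open>
  One edge of each class whose label is not \<open>p + 1\<close>; the last case is the distinguished edge.
\<close>

definition edge_rep :: "nat \<Rightarrow> nat \<Rightarrow> twist_tet \<times> nat \<times> nat" where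
  "edge_rep p l = (if l = 0 then (V, 0, 1) else if l \<le> p then (T l, 0, 2)
     else if l = p + 2 then (U, 0, 3) else if l = p + 3 then (U, 0, 1) else (Z, 2, 3))"

context
  fixes n :: nat and X :: "(twist_tet, twist_face) triangulation"
  assumes X: "X = X_tri n \<or> X = Y_tri n"
begin

lemma gluings_T:
  assumes "1 \<le> k" "k < twist_p n"
  shows "same_edge X (T k, 0, 1) (T (Suc k), 0, 1)"
    and "same_edge X (T k, 2, 3) (T (Suc k), 2, 3)"
    and "same_edge X (T k, 0, 3) (T (Suc k), 0, 2)"
    and "same_edge X (T k, 0, 3) (T (Suc k), 1, 3)"
    and "same_edge X (T k, 0, 2) (T (Suc k), 1, 2)"
proof -
  note S = tets_simps X_faces_def face_vertices_simps face_f_def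
  show "same_edge X (T k, 0, 1) (T (Suc k), 0, 1)"
    by (rule same_edgeI[of X _ 2 _ 3 0 1]) (use assms X in \<open>auto simp: S\<close>)
  show "same_edge X (T k, 2, 3) (T (Suc k), 2, 3)"
    by (rule same_edgeI[of X _ 1 _ 0 1 2]) (use assms X in \<open>auto simp: S\<close>)
  show "same_edge X (T k, 0, 3) (T (Suc k), 0, 2)"
    by (rule same_edgeI[of X _ 2 _ 3 0 2]) (use assms X in \<open>auto simp: S\<close>)
  show "same_edge X (T k, 0, 3) (T (Suc k), 1, 3)"
    by (rule same_edgeI[of X _ 1 _ 0 0 2]) (use assms X in \<open>auto simp: S\<close>)
  show "same_edge X (T k, 0, 2) (T (Suc k), 1, 2)"
    by (rule same_edgeI[of X _ 1 _ 0 0 1]) (use assms X in \<open>auto simp: S\<close>)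
qed

lemma gluings_ends:
  assumes "1 \<le> twist_p n"
  shows "same_edge X (T (twist_p n), 0, 1) (V, 0, 1)"
    and "same_edge X (T (twist_p n), 2, 3) (W, 1, 2)"
    and "same_edge X (T (Suc 0), 1, 2) (T (Suc 0), 0, 1)"
    and "same_edge X (T (Suc 0), 1, 3) (T (Suc 0), 0, 2)"
    and "same_edge X (V, 1, 3) (T (twist_p n), 1, 3)"
    and "same_edge X (W, 0, 1) (T (twist_p n), 0, 2)"
proof -
  note S = tets_simps X_faces_def face_vertices_simps face_f_def
  show "same_edge X (T (twist_p n), 0, 1) (V, 0, 1)"
    by (rule same_edgeI[of X _ 2 _ 2 0 1]) (use assms X in \<open>auto simp: S\<close>)
  show "same_edge X (T (twist_p n), 2, 3) (W, 1, 2)"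
    by (rule same_edgeI[of X _ 1 _ 3 1 2]) (use assms X in \<open>auto simp: S\<close>)
  show "same_edge X (T (Suc 0), 1, 2) (T (Suc 0), 0, 1)"
    by (rule same_edgeI[of X _ 0 _ 3 0 1]) (use assms X in \<open>auto simp: S\<close>)
  show "same_edge X (T (Suc 0), 1, 3) (T (Suc 0), 0, 2)"
    by (rule same_edgeI[of X _ 0 _ 3 0 2]) (use assms X in \<open>auto simp: S\<close>)
  show "same_edge X (V, 1, 3) (T (twist_p n), 1, 3)"
    by (rule same_edgeI[of X _ 2 _ 2 1 2]) (use assms X in \<open>auto simp: S\<close>)
  show "same_edge X (W, 0, 1) (T (twist_p n), 0, 2)"
    by (rule same_edgeI[of X _ 3 _ 1 0 1]) (use assms X in \<open>auto simp: S\<close>)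
qed

lemma gluings_no_T:
  assumes "twist_p n = 0"
  shows "same_edge X (W, 0, 1) (V, 0, 1)" and "same_edge X (V, 1, 3) (W, 1, 2)"
proof -
  note S = tets_simps X_faces_def face_vertices_simps face_f_def
  show "same_edge X (W, 0, 1) (V, 0, 1)"
    by (rule same_edgeI[of X _ 3 _ 2 0 1]) (use assms X in \<open>auto simp: S\<close>)
  show "same_edge X (V, 1, 3) (W, 1, 2)"
    by (rule same_edgeI[of X _ 2 _ 3 1 2]) (use assms X in \<open>auto simp: S\<close>)
qed

lemma gluings_UVW:
  shows "same_edge X (V, 0, 1) (W, 1, 2)"
    and "same_edge X (U, 1, 2) (W, 0, 1)"
    and "same_edge X (V, 2, 3) (U, 1, 2)"
    and "same_edge X (V, 0, 2) (U, 0, 1)"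
    and "same_edge X (W, 1, 3) (V, 0, 2)"
    and "same_edge X (U, 2, 3) (W, 1, 3)"
    and "same_edge X (W, 2, 3) (U, 2, 3)"
    and "same_edge X (V, 1, 2) (W, 2, 3)"
    and "same_edge X (W, 0, 3) (U, 0, 3)"
    and "same_edge X (U, 1, 3) (W, 0, 3)"
proof -
  note S = tets_simps X_faces_def face_vertices_simps face_f_def
  show "same_edge X (V, 0, 1) (W, 1, 2)"
    by (rule same_edgeI[of X _ 3 _ 0 0 1]) (use X in \<open>auto simp: S\<close>)
  show "same_edge X (U, 1, 2) (W, 0, 1)"
    by (rule same_edgeI[of X _ 0 _ 2 0 1]) (use X in \<open>auto simp: S\<close>)
  show "same_edge X (V, 2, 3) (U, 1, 2)"
    by (rule same_edgeI[of X _ 1 _ 3 1 2]) (use X in \<open>auto simp: S\<close>)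
  show "same_edge X (V, 0, 2) (U, 0, 1)"
    by (rule same_edgeI[of X _ 1 _ 3 0 1]) (use X in \<open>auto simp: S\<close>)
  show "same_edge X (W, 1, 3) (V, 0, 2)"
    by (rule same_edgeI[of X _ 0 _ 3 0 2]) (use X in \<open>auto simp: S\<close>)
  show "same_edge X (U, 2, 3) (W, 1, 3)"
    by (rule same_edgeI[of X _ 0 _ 2 1 2]) (use X in \<open>auto simp: S\<close>)
  show "same_edge X (W, 2, 3) (U, 2, 3)"
    by (rule same_edgeI[of X _ 1 _ 1 1 2]) (use X in \<open>auto simp: S\<close>)
  show "same_edge X (V, 1, 2) (W, 2, 3)"
    by (rule same_edgeI[of X _ 3 _ 0 1 2]) (use X in \<open>auto simp: S\<close>)
  show "same_edge X (W, 0, 3) (U, 0, 3)"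
    by (rule same_edgeI[of X _ 1 _ 1 0 2]) (use X in \<open>auto simp: S\<close>)
  show "same_edge X (U, 1, 3) (W, 0, 3)"
    by (rule same_edgeI[of X _ 0 _ 2 0 2]) (use X in \<open>auto simp: S\<close>)
qed

lemma same_edge_T:
  assumes k: "1 \<le> k" "k \<le> twist_p n"
  shows "same_edge X (T k, 0, 1) (V, 0, 1)"
    and "same_edge X (T k, 2, 3) (V, 0, 1)"
    and "same_edge X (T k, 1, 2) (edge_rep (twist_p n) (k - 1))"
    and "same_edge X (T k, 1, 3) (T k, 0, 2)"
    and "k < twist_p n \<Longrightarrow> same_edge X (T k, 0, 3) (T (Suc k), 0, 2)"
proof -
  have p: "1 \<le> twist_p n" using k by simp
  have a: "same_edge X (T k, 0, 1) (V, 0, 1)" if "1 \<le> k" "k \<le> twist_p n" for k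
    using that(2,1)
  proof (induction k rule: inc_induct)
    case base then show ?case using gluings_ends(1)[OF p] by simp
  next
    case (step m)
    then have m: "1 \<le> m" "m < twist_p n" and IH: "same_edge X (T (Suc m), 0, 1) (V, 0, 1)" by auto
    show ?case by (rule same_edge_trans[OF gluings_T(1)[OF m] IH])
  qed
  have b: "same_edge X (T k, 2, 3) (V, 0, 1)" if "1 \<le> k" "k \<le> twist_p n" for k
    using that(2,1)
  proof (induction k rule: inc_induct)
    case base then show ?case
      using same_edge_trans[OF gluings_ends(2)[OF p] same_edge_sym[OF gluings_UVW(1)]] by simp
  next
    case (step m)
    then have m: "1 \<le> m" "m < twist_p n" and IH: "same_edge X (T (Suc m), 2, 3) (V, 0, 1)" by auto
    show ?case by (rule same_edge_trans[OF gluings_T(2)[OF m] IH])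
  qed
  show "same_edge X (T k, 0, 1) (V, 0, 1)" "same_edge X (T k, 2, 3) (V, 0, 1)" using a b k by auto
  show "same_edge X (T k, 1, 2) (edge_rep (twist_p n) (k - 1))"
  proof (cases "k = 1")
    case True
    then show ?thesis
      using same_edge_trans[OF gluings_ends(3)[OF p] a[of "Suc 0"]] p by (simp add: edge_rep_def)
  next
    case False
    then obtain m where m: "k = Suc m" "1 \<le> m" using k(1) by (cases k) auto
    then show ?thesis
      using same_edge_sym[OF gluings_T(5)[of m]] k by (simp add: edge_rep_def)
  qed
  show "same_edge X (T k, 1, 3) (T k, 0, 2)"
  proof (cases "k = 1")
    case True
    then show ?thesis using gluings_ends(4)[OF p] by simp
  next
    case False
    then obtain m where m: "k = Suc m" "1 \<le> m" using k(1) by (cases k) auto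
    then show ?thesis
      using same_edge_trans[OF same_edge_sym[OF gluings_T(4)[of m]] gluings_T(3)[of m]] k by simp
  qed
  show "k < twist_p n \<Longrightarrow> same_edge X (T k, 0, 3) (T (Suc k), 0, 2)"
    using gluings_T(3)[of k] k by simp
qed

lemma same_edge_last:
  defines "P \<equiv> edge_rep (twist_p n) (twist_p n)"
  shows "same_edge X (W, 1, 2) (V, 0, 1)"
    and "same_edge X (W, 0, 1) P" and "same_edge X (V, 1, 3) P"
    and "same_edge X (U, 1, 2) P" and "same_edge X (V, 2, 3) P"
proof -
  show 1: "same_edge X (W, 1, 2) (V, 0, 1)" by (rule same_edge_sym[OF gluings_UVW(1)])
  show 2: "same_edge X (W, 0, 1) P"
    using gluings_no_T(1) gluings_ends(6) by (cases "twist_p n = 0") (auto simp: P_def edge_rep_def)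
  show "same_edge X (V, 1, 3) P"
  proof (cases "twist_p n = 0")
    case True
    then show ?thesis using same_edge_trans[OF gluings_no_T(2) 1] by (simp add: P_def edge_rep_def)
  next
    case False
    then show ?thesis
      using same_edge_trans[OF gluings_ends(5) same_edge_T(4)[of "twist_p n"]]
      by (simp add: P_def edge_rep_def)
  qed
  show 3: "same_edge X (U, 1, 2) P" by (rule same_edge_trans[OF gluings_UVW(2) 2])
  show "same_edge X (V, 2, 3) P" by (rule same_edge_trans[OF gluings_UVW(3) 3])
qed

lemma same_edge_D:
  "same_edge X (V, 0, 2) (U, 0, 1)" "same_edge X (W, 1, 3) (U, 0, 1)" "same_edge X (U, 2, 3) (U, 0, 1)"
  "same_edge X (W, 2, 3) (U, 0, 1)" "same_edge X (V, 1, 2) (U, 0, 1)"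
  using gluings_UVW(4-8) same_edge_trans by metis+

lemma same_edge_C:
  "same_edge X (W, 0, 3) (U, 0, 3)" "same_edge X (U, 1, 3) (U, 0, 3)"
  using gluings_UVW(9,10) same_edge_trans by metis+

end

lemma tet_edges_cases:
  assumes "(t, i, j) \<in> tet_edges X"
  shows "(i, j) = (0, 1) \<or> (i, j) = (0, 2) \<or> (i, j) = (0, 3) \<or> (i, j) = (1, 2) \<or> (i, j) = (1, 3) \<or> (i, j) = (2, 3)"
  using assms by (auto simp: tet_edges_def)

lemma same_edge_rep_Y:
  assumes e: "e \<in> tet_edges (Y_tri n)" and l: "twist_label (twist_p n) (twist_p n + 2) e \<noteq> twist_p n + 1"
  shows "same_edge (Y_tri n) e (edge_rep (twist_p n) (twist_label (twist_p n) (twist_p n + 2) e))"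
proof -
  let ?Y = "Y_tri n" and ?P = "edge_rep (twist_p n) (twist_p n)"
  note S = tets_simps X_faces_def face_vertices_simps face_f_def
  have Y: "?Y = X_tri n \<or> ?Y = Y_tri n" by simp
  have "same_edge ?Y (Z, 0, 3) (V, 1, 3)"
    by (rule same_edgeI[of ?Y _ 2 _ 0 0 2]) (auto simp: S)
  then have z03: "same_edge ?Y (Z, 0, 3) ?P" by (rule same_edge_trans[OF _ same_edge_last(3)[OF Y]])
  have "same_edge ?Y (Z, 1, 3) (V, 2, 3)"
    by (rule same_edgeI[of ?Y _ 2 _ 0 1 2]) (auto simp: S)
  then have z13: "same_edge ?Y (Z, 1, 3) ?P" by (rule same_edge_trans[OF _ same_edge_last(5)[OF Y]])
  have z02: "same_edge ?Y (Z, 0, 2) (U, 0, 3)"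
    by (rule same_edgeI[of ?Y _ 3 _ 2 0 2]) (auto simp: S)
  have "same_edge ?Y (Z, 1, 2) (U, 1, 3)"
    by (rule same_edgeI[of ?Y _ 3 _ 2 1 2]) (auto simp: S)
  then have z12: "same_edge ?Y (Z, 1, 2) (U, 0, 3)" by (rule same_edge_trans[OF _ same_edge_C(2)[OF Y]])
  have z01: "same_edge ?Y (Z, 0, 1) (U, 0, 1)"
    by (rule same_edgeI[of ?Y _ 3 _ 2 0 1]) (auto simp: S)
  obtain t i j where [simp]: "e = (t, i, j)" by (cases e) auto
  have ij: "(i, j) = (0, 1) \<or> (i, j) = (0, 2) \<or> (i, j) = (0, 3) \<or> (i, j) = (1, 2) \<or> (i, j) = (1, 3) \<or> (i, j) = (2, 3)"
    using e tet_edges_cases by simp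
  have reps: "edge_rep (twist_p n) 0 = (V, 0, 1)" "edge_rep (twist_p n) (twist_p n + 2) = (U, 0, 3)"
    "edge_rep (twist_p n) (Suc (Suc (twist_p n))) = (U, 0, 3)"
    "edge_rep (twist_p n) (twist_p n + 3) = (U, 0, 1)" "edge_rep (twist_p n) (twist_p n + 4) = (Z, 2, 3)"
    "\<And>k. 1 \<le> k \<Longrightarrow> k \<le> twist_p n \<Longrightarrow> edge_rep (twist_p n) k = (T k, 0, 2)"
    by (auto simp: edge_rep_def)
  from e consider (T) k where "t = T k" "1 \<le> k" "k \<le> twist_p n" | (U) "t = U" | (V) "t = V" | (W) "t = W" | (Z) "t = Z"
    by (auto simp: tet_edges_def tets_simps)
  then show ?thesis
  proof cases
    case (T k)
    have k: "Suc k \<le> twist_p n" if "(i, j) = (0, 3)" using that l T by (auto simp: twist_label_def edge_index_def)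
    show ?thesis
      using ij T(2,3) k same_edge_T[OF Y T(2,3)]
      by (elim disjE) (simp_all add: T(1) twist_label_def edge_index_def reps)
  next
    case U
    then show ?thesis using ij l same_edge_last[OF Y] same_edge_C[OF Y] same_edge_D[OF Y]
      by (elim disjE) (simp_all add: twist_label_def edge_index_def reps)
  next
    case V
    then show ?thesis using ij l same_edge_last[OF Y] same_edge_C[OF Y] same_edge_D[OF Y]
      by (elim disjE) (simp_all add: twist_label_def edge_index_def reps)
  next
    case W
    then show ?thesis using ij l same_edge_last[OF Y] same_edge_C[OF Y] same_edge_D[OF Y]
      by (elim disjE) (simp_all add: twist_label_def edge_index_def reps)
  next
    case Z
    then show ?thesis using ij z01 z02 z03 z12 z13
      by (elim disjE) (simp_all add: twist_label_def edge_index_def reps)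
  qed
qed

lemma same_edge_rep_X:
  assumes e: "e \<in> tet_edges (X_tri n)" and l: "twist_label (twist_p n) (twist_p n) e \<noteq> twist_p n + 1"
  shows "same_edge (X_tri n) e (edge_rep (twist_p n) (twist_label (twist_p n) (twist_p n) e))"
proof -
  let ?X = "X_tri n" and ?P = "edge_rep (twist_p n) (twist_p n)"
  note S = tets_simps X_faces_def face_vertices_simps face_f_def
  have X: "?X = X_tri n \<or> ?X = Y_tri n" by simp
  have "same_edge ?X (U, 0, 3) (V, 1, 3)"
    by (rule same_edgeI[of ?X _ 2 _ 0 0 2]) (auto simp: S)
  then have u03: "same_edge ?X (U, 0, 3) ?P" by (rule same_edge_trans[OF _ same_edge_last(3)[OF X]])
  have u13: "same_edge ?X (U, 1, 3) ?P" and w03: "same_edge ?X (W, 0, 3) ?P"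
    using same_edge_C[OF X] u03 same_edge_trans by metis+
  obtain t i j where [simp]: "e = (t, i, j)" by (cases e) auto
  have ij: "(i, j) = (0, 1) \<or> (i, j) = (0, 2) \<or> (i, j) = (0, 3) \<or> (i, j) = (1, 2) \<or> (i, j) = (1, 3) \<or> (i, j) = (2, 3)"
    using e tet_edges_cases by simp
  have reps: "edge_rep (twist_p n) 0 = (V, 0, 1)"
    "edge_rep (twist_p n) (twist_p n + 3) = (U, 0, 1)"
    "\<And>k. 1 \<le> k \<Longrightarrow> k \<le> twist_p n \<Longrightarrow> edge_rep (twist_p n) k = (T k, 0, 2)"
    by (auto simp: edge_rep_def)
  from e consider (T) k where "t = T k" "1 \<le> k" "k \<le> twist_p n" | (U) "t = U" | (V) "t = V" | (W) "t = W"
    by (auto simp: tet_edges_def tets_simps)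
  then show ?thesis
  proof cases
    case (T k)
    have k: "Suc k \<le> twist_p n" if "(i, j) = (0, 3)" using that l T by (auto simp: twist_label_def edge_index_def)
    show ?thesis
      using ij T(2,3) k same_edge_T[OF X T(2,3)]
      by (elim disjE) (simp_all add: T(1) twist_label_def edge_index_def reps)
  next
    case U
    then show ?thesis using ij l same_edge_last[OF X] u03 u13 same_edge_D[OF X]
      by (elim disjE) (simp_all add: twist_label_def edge_index_def reps)
  next
    case V
    then show ?thesis using ij l same_edge_last[OF X] same_edge_D[OF X]
      by (elim disjE) (simp_all add: twist_label_def edge_index_def reps)
  next
    case W
    then show ?thesis using ij l same_edge_last[OF X] w03 same_edge_D[OF X]
      by (elim disjE) (simp_all add: twist_label_def edge_index_def reps)
  qed
qed

lemma edge_class_Y: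
  assumes r: "r \<in> tet_edges (Y_tri n)" and rep: "edge_rep (twist_p n) l = r"
    and l: "twist_label (twist_p n) (twist_p n + 2) r = l" "l \<noteq> twist_p n + 1"
  shows "(edge_glue (Y_tri n))\<^sup>* `` {r} = {e \<in> tet_edges (Y_tri n). twist_label (twist_p n) (twist_p n + 2) e = l}"
proof -
  have "(edge_glue (Y_tri n))\<^sup>* `` {r} = {e \<in> tet_edges (Y_tri n).
      twist_label (twist_p n) (twist_p n + 2) e = twist_label (twist_p n) (twist_p n + 2) r}"
  proof (rule edge_class_eq_label_fibre[where face_label =
        "\<lambda>f i j. twist_face_label (twist_p n) (twist_p n + 2) f ! (i + j - 1)"])
    fix e assume "e \<in> tet_edges (Y_tri n)"
      "twist_label (twist_p n) (twist_p n + 2) e = twist_label (twist_p n) (twist_p n + 2) r"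
    then show "(e, r) \<in> (edge_glue (Y_tri n))\<^sup>*"
      using same_edge_rep_Y[of e n] l rep by (simp add: same_edge_def)
  qed (use r label_compat_Y in auto)
  then show ?thesis by (simp only: l(1))
qed

lemma edge_class_X:
  assumes r: "r \<in> tet_edges (X_tri n)" and rep: "edge_rep (twist_p n) l = r"
    and l: "twist_label (twist_p n) (twist_p n) r = l" "l \<noteq> twist_p n + 1"
  shows "(edge_glue (X_tri n))\<^sup>* `` {r} = {e \<in> tet_edges (X_tri n). twist_label (twist_p n) (twist_p n) e = l}"
proof -
  have "(edge_glue (X_tri n))\<^sup>* `` {r} = {e \<in> tet_edges (X_tri n).
      twist_label (twist_p n) (twist_p n) e = twist_label (twist_p n) (twist_p n) r}"
  proof (rule edge_class_eq_label_fibre[where face_label =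
        "\<lambda>f i j. twist_face_label (twist_p n) (twist_p n) f ! (i + j - 1)"])
    fix e assume "e \<in> tet_edges (X_tri n)"
      "twist_label (twist_p n) (twist_p n) e = twist_label (twist_p n) (twist_p n) r"
    then show "(e, r) \<in> (edge_glue (X_tri n))\<^sup>*"
      using same_edge_rep_X[of e n] l rep by (simp add: same_edge_def)
  qed (use r label_compat_X in auto)
  then show ?thesis by (simp only: l(1))
qed

definition T_weight :: "nat \<Rightarrow> (twist_tet \<Rightarrow> shape) \<Rightarrow> nat \<Rightarrow> real" where
  "T_weight p s l =
     (if l = 0 then 2 * (\<Sum>k=1..p. shape_a (s (T k))) else 0) +
     (if 1 \<le> l \<and> l \<le> p then 2 * shape_b (s (T l)) else 0) +
     (if 2 \<le> l \<and> l \<le> p + 1 then shape_c (s (T (l - 1))) else 0) +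
     (if l < p then shape_c (s (T (l + 1))) else 0)"

definition tet_weight :: "nat \<Rightarrow> nat \<Rightarrow> (twist_tet \<Rightarrow> shape) \<Rightarrow> twist_tet \<Rightarrow> nat \<Rightarrow> real" where
  "tet_weight p C s t l = (case twist_labels p C t of [l1, l2, l3, l4, l5, l6] \<Rightarrow>
     (if l1 = l then shape_a (s t) else 0) + (if l2 = l then shape_b (s t) else 0) +
     (if l3 = l then shape_c (s t) else 0) + (if l4 = l then shape_c (s t) else 0) +
     (if l5 = l then shape_b (s t) else 0) + (if l6 = l then shape_a (s t) else 0))"

lemma tet_weight_eq:
  "(\<Sum>(i, j)\<in>{(0, 1), (0, 2), (0, 3), (1, 2), (1, 3), (2, 3)}.
      if twist_label p C (t, i, j) = l then edge_angle (s t) i j else 0) = tet_weight p C s t l"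
  by (cases t) (simp_all add: twist_label_def edge_index_def edge_angle_def tet_weight_def)

lemma sum_tet_weight_T:
  "(\<Sum>t\<in>T ` {1..p}. tet_weight p C s t l) = T_weight p s l"
proof -
  have "(\<Sum>t\<in>T ` {1..p}. tet_weight p C s t l) =
      (\<Sum>k=1..p. (if l = 0 then 2 * shape_a (s (T k)) else 0) + (if k = l then 2 * shape_b (s (T k)) else 0)
         + (if k = l - 1 \<and> 2 \<le> l then shape_c (s (T k)) else 0) + (if k = l + 1 then shape_c (s (T k)) else 0))"
    by (subst sum.reindex) (auto simp: inj_on_def tet_weight_def intro!: sum.cong)
  also have "\<dots> = T_weight p s l"
    unfolding sum.distrib T_weight_def
  proof (intro arg_cong2[where f = "(+)"])
    show "(\<Sum>k=1..p. if k = l - 1 \<and> 2 \<le> l then shape_c (s (T k)) else 0) =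
        (if 2 \<le> l \<and> l \<le> p + 1 then shape_c (s (T (l - 1))) else 0)"
      by (cases "2 \<le> l") (auto simp: sum.delta)
  qed (auto simp: sum.delta sum_distrib_left)
  finally show ?thesis .
qed

lemma weight_Y:
  "weight s {e \<in> tet_edges (Y_tri n). twist_label (twist_p n) C e = l} =
   T_weight (twist_p n) s l + tet_weight (twist_p n) C s U l + tet_weight (twist_p n) C s V l +
   tet_weight (twist_p n) C s W l + tet_weight (twist_p n) C s Z l"
proof -
  have "weight s {e \<in> tet_edges (Y_tri n). twist_label (twist_p n) C e = l} =
      (\<Sum>t\<in>tets (Y_tri n). tet_weight (twist_p n) C s t l)"
    by (subst weight_label_fibre) (simp_all add: tets_simps tet_weight_eq[symmetric] del: sum.insert)
  also have "\<dots> = (\<Sum>t\<in>T ` {1..twist_p n}. tet_weight (twist_p n) C s t l) +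
      (\<Sum>t\<in>{U, V, W, Z}. tet_weight (twist_p n) C s t l)"
    unfolding tets_simps by (rule sum.union_disjoint) auto
  finally show ?thesis unfolding sum_tet_weight_T by simp
qed

lemma weight_X:
  "weight s {e \<in> tet_edges (X_tri n). twist_label (twist_p n) C e = l} =
   T_weight (twist_p n) s l + tet_weight (twist_p n) C s U l + tet_weight (twist_p n) C s V l +
   tet_weight (twist_p n) C s W l"
proof -
  have "weight s {e \<in> tet_edges (X_tri n). twist_label (twist_p n) C e = l} =
      (\<Sum>t\<in>tets (X_tri n). tet_weight (twist_p n) C s t l)"
    by (subst weight_label_fibre) (simp_all add: tets_simps tet_weight_eq[symmetric] del: sum.insert)
  also have "\<dots> = (\<Sum>t\<in>T ` {1..twist_p n}. tet_weight (twist_p n) C s t l) +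
      (\<Sum>t\<in>{U, V, W}. tet_weight (twist_p n) C s t l)"
    unfolding tets_simps by (rule sum.union_disjoint) auto
  finally show ?thesis unfolding sum_tet_weight_T by simp
qed

lemma knot_edge_eq: "weight s (knot_edge n) = shape_a (s Z)"
proof -
  have "knot_edge n = {e \<in> tet_edges (Y_tri n). twist_label (twist_p n) (twist_p n + 2) e = twist_p n + 4}"
    unfolding knot_edge_def
    by (rule edge_class_Y) (auto simp: tet_edges_def tets_simps twist_label_def edge_index_def edge_rep_def)
  then show ?thesis
    by (simp add: weight_Y T_weight_def tet_weight_def)
qed

text \<open>
  The edge equations solved for the third angles. The equations of the labels \<open>1 \<le> l < p\<close> prescribe the
  second differences \<open>c\<^sub>l\<^sub>-\<^sub>1 - 2 c\<^sub>l + c\<^sub>l\<^sub>+\<^sub>1 = 2 a\<^sub>l\<close>, where \<open>c\<^sub>0 = 0\<close>, and the equation of the label \<open>0\<close>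
  prescribes \<open>c\<^sub>1\<close>. The sum with coefficients \<open>min(j, k)\<close> solves this recursion; these coefficients are the
  entries of \<open>Q\<^sub>n\<close>.
\<close>

definition angle_relations :: "nat \<Rightarrow> (twist_tet \<Rightarrow> shape) \<Rightarrow> bool" where
  "angle_relations p s \<longleftrightarrow>
     shape_a (s V) = shape_a (s U) \<and> shape_c (s W) = shape_a (s U) \<and>
     (\<forall>j\<in>{1..p}. shape_c (s (T j)) = 2 * real j * pi
        - 2 * (\<Sum>k=1..p. real (min j k) * shape_a (s (T k))) - 2 * real j * shape_a (s U)) \<and>
     shape_c (s U) - shape_c (s V) = 2 * real p * pi - 2 * (\<Sum>k=1..p. real k * shape_a (s (T k)))
        - 2 * (real p + 1) * shape_a (s U) - shape_a (s W)"

lemma sum_min_shift: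
  fixes f :: "nat \<Rightarrow> real"
  assumes "1 \<le> j" "j \<le> p"
  shows "(\<Sum>k=1..p. real (min (j - 1) k) * f k) + (\<Sum>k=1..p. real (min (j + 1) k) * f k) =
         2 * (\<Sum>k=1..p. real (min j k) * f k) - f j"
proof -
  have "(\<Sum>k=1..p. real (min (j - 1) k) * f k) + (\<Sum>k=1..p. real (min (j + 1) k) * f k) =
      (\<Sum>k=1..p. 2 * (real (min j k) * f k) - (if k = j then f k else 0))"
    unfolding sum.distrib[symmetric] using assms
    by (intro sum.cong) (auto simp: min_def algebra_simps of_nat_diff)
  also have "\<dots> = 2 * (\<Sum>k=1..p. real (min j k) * f k) - f j"
    using assms by (simp add: sum_subtractf sum_distrib_left sum.delta)
  finally show ?thesis .
qed

text \<open>
  The hypotheses \<open>low\<close> and \<open>top\<close> are the edge equations with labels below \<open>p\<close> and with label \<open>p\<close>.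
  In \<open>top\<close> the part of the class that differs between \<open>X\<^sub>n\<close> and \<open>Y\<^sub>n\<close> has been removed; it has
  weight \<open>\<pi>\<close> in both.
\<close>

lemma angle_relationsI:
  assumes sum_pi: "\<And>t. t \<in> tets (X_tri n) \<Longrightarrow> shape_a (s t) + shape_b (s t) + shape_c (s t) = pi"
    and aV: "shape_a (s V) = shape_a (s U)" and cW: "shape_c (s W) = shape_a (s U)"
    and low: "\<And>l. l < twist_p n \<Longrightarrow>
       T_weight (twist_p n) s l + (if l = 0 then shape_a (s V) + shape_c (s W) else 0) = 2 * pi"
    and top: "T_weight (twist_p n) s (twist_p n) + (if twist_p n = 0 then shape_a (s V) + shape_c (s W) else 0)
       + shape_c (s U) + shape_b (s V) + shape_a (s V) + shape_a (s W) = pi"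
  shows "angle_relations (twist_p n) s"
proof -
  define p where "p = twist_p n"
  define a where "a k = shape_a (s (T k))" for k
  define c where "c k = (if k = 0 then 0 else shape_c (s (T k)))" for k
  define aU where "aU = shape_a (s U)"
  define E where "E j = 2 * real j * pi - 2 * (\<Sum>k=1..p. real (min j k) * a k) - 2 * real j * aU" for j
  have b: "shape_b (s (T k)) = pi - a k - c k" if "1 \<le> k" "k \<le> p" for k
    using sum_pi[of "T k"] that by (simp add: a_def c_def tets_simps p_def)
  have E_rec: "E (j - 1) + E (j + 1) = 2 * E j + 2 * a j" if "1 \<le> j" "j \<le> p" for j
    using sum_min_shift[OF that, of a] that unfolding E_def by (simp add: algebra_simps of_nat_diff)
  have E0: "E 0 = 0" by (simp add: E_def)
  have first: "c 1 = E 1" if "1 \<le> p"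
  proof -
    have "(\<Sum>k=1..p. real (min 1 k) * a k) = (\<Sum>k=1..p. a k)" by (intro sum.cong) auto
    then show ?thesis
      using low[of 0] that unfolding E_def c_def
      by (simp add: T_weight_def aV cW a_def p_def aU_def)
  qed
  have c_rec: "c (l - 1) + c (l + 1) = 2 * c l + 2 * a l" if "1 \<le> l" "l < p" for l
    using low[of l] that b[of l] by (auto simp: T_weight_def p_def c_def)
  have cE: "j \<le> p \<longrightarrow> c j = E j" for j
  proof (induction j rule: less_induct)
    case (less j)
    show ?case
    proof (cases "j \<le> 1")
      case True
      then have "j = 0 \<or> j = 1" by auto
      then show ?thesis using first by (auto simp: E0 c_def)
    next
      case False
      define l where "l = j - 1"
      have l: "1 \<le> l" "j = l + 1" using False by (auto simp: l_def)
      show ?thesis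
      proof
        assume "j \<le> p"
        then have "c (l - 1) = E (l - 1)" "c l = E l" using less.IH[of "l - 1"] less.IH[of l] l by auto
        then show "c j = E j"
          using c_rec[of l] E_rec[of l] l \<open>j \<le> p\<close> by simp
      qed
    qed
  qed
  have bV: "shape_b (s V) = pi - aU - shape_c (s V)"
    using sum_pi[of V] aV by (simp add: tets_simps aU_def)
  have "shape_c (s U) - shape_c (s V) = 2 * real p * pi - 2 * (\<Sum>k=1..p. real k * a k)
        - 2 * (real p + 1) * aU - shape_a (s W)"
  proof (cases "p = 0")
    case True
    then show ?thesis
      using top by (simp add: T_weight_def p_def aV cW bV flip: aU_def)
  next
    case False
    have "c (p - 1) + 2 * (pi - a p - c p) + shape_c (s U) + (pi - shape_c (s V)) + shape_a (s W) = pi"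
      using top False b[of p] by (auto simp: T_weight_def c_def bV aV p_def simp flip: aU_def)
    moreover have "E (p - 1) + E (p + 1) = 2 * E p + 2 * a p" using E_rec[of p] False by simp
    moreover have "E (p + 1) = 2 * real (p + 1) * pi - 2 * (\<Sum>k=1..p. real k * a k) - 2 * real (p + 1) * aU"
      unfolding E_def by (simp add: min_def cong: sum.cong) (intro sum.cong, auto)
    ultimately show ?thesis
      using cE[of "p - 1"] cE[of p] by (simp add: algebra_simps)
  qed
  moreover have "\<forall>j\<in>{1..p}. shape_c (s (T j)) = E j"
  proof
    fix j assume "j \<in> {1..p}"
    then show "shape_c (s (T j)) = E j" using cE[of j] by (simp add: c_def)
  qed
  ultimately show ?thesis
    using aV cW unfolding angle_relations_def E_def a_def aU_def p_def by simp
qed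

text \<open>
  Since \<open>a\<^sub>Z = 0\<close>, each of the two classes that meet \<open>Z\<close> in edges of angle \<open>b\<^sub>Z\<close> and \<open>c\<^sub>Z\<close> gets the weight
  \<open>b\<^sub>Z + c\<^sub>Z = \<pi>\<close> from \<open>Z\<close>. The class with label \<open>p + 2\<close> then yields \<open>c\<^sub>W = a\<^sub>U\<close>, and the class with label
  \<open>p + 3\<close> yields \<open>a\<^sub>V = a\<^sub>U\<close>.
\<close>

lemma angle_relations_Y:
  assumes s: "s \<in> shape_structures_closed_at (Y_tri n) Z" and knot: "weight s (knot_edge n) = 0"
    and w: "\<forall>e \<in> edges (Y_tri n) - {knot_edge n}. weight s e = 2 * pi"
  shows "angle_relations (twist_p n) s"
proof -
  define p where "p = twist_p n"
  have sum_pi: "shape_a (s t) + shape_b (s t) + shape_c (s t) = pi" if "t \<in> tets (Y_tri n)" for t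
    using PiE_mem[OF s[unfolded shape_structures_closed_at_def] that]
    by (auto simp: open_shapes_def closed_shapes_def shape_a_def shape_b_def shape_c_def split: if_splits)
  have W: "T_weight p s l + tet_weight p (p + 2) s U l + tet_weight p (p + 2) s V l +
      tet_weight p (p + 2) s W l + tet_weight p (p + 2) s Z l = 2 * pi"
    if "l \<le> p \<or> l = p + 2 \<or> l = p + 3" for l
  proof -
    let ?r = "edge_rep p l"
    have r: "?r \<in> tet_edges (Y_tri n)" "twist_label p (p + 2) ?r = l"
      using that by (auto simp: edge_rep_def tet_edges_def tets_simps twist_label_def edge_index_def p_def)
    have eq: "(edge_glue (Y_tri n))\<^sup>* `` {?r} = {e \<in> tet_edges (Y_tri n). twist_label p (p + 2) e = l}"
      unfolding p_def using r that by (intro edge_class_Y) (auto simp: p_def)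
    have "(edge_glue (Y_tri n))\<^sup>* `` {?r} \<in> edges (Y_tri n)"
      unfolding edges_def by (rule quotientI[OF r(1)])
    moreover have "(edge_glue (Y_tri n))\<^sup>* `` {?r} \<noteq> knot_edge n"
    proof
      assume "(edge_glue (Y_tri n))\<^sup>* `` {?r} = knot_edge n"
      then have "(Z, 2, 3) \<in> {e \<in> tet_edges (Y_tri n). twist_label p (p + 2) e = l}"
        unfolding eq knot_edge_def by auto
      then show False using that by (auto simp: twist_label_def edge_index_def)
    qed
    ultimately have "weight s {e \<in> tet_edges (Y_tri n). twist_label p (p + 2) e = l} = 2 * pi"
      using w eq by auto
    then show ?thesis unfolding p_def weight_Y .
  qed
  have aZ: "shape_a (s Z) = 0" using knot by (simp add: knot_edge_eq)
  have bcZ: "shape_b (s Z) + shape_c (s Z) = pi" using sum_pi[of Z] aZ by (simp add: tets_simps)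
  have U: "shape_a (s U) + shape_b (s U) + shape_c (s U) = pi"
    and V: "shape_a (s V) + shape_b (s V) + shape_c (s V) = pi"
    and WW: "shape_a (s W) + shape_b (s W) + shape_c (s W) = pi"
    using sum_pi by (auto simp: tets_simps)
  have cW: "shape_c (s W) = shape_a (s U)"
    using W[of "p + 2"] bcZ U by (simp add: tet_weight_def T_weight_def)
  have aV: "shape_a (s V) = shape_a (s U)"
    using W[of "p + 3"] aZ U V WW cW by (simp add: tet_weight_def T_weight_def)
  show ?thesis
  proof (rule angle_relationsI[OF _ aV cW])
    show "shape_a (s t) + shape_b (s t) + shape_c (s t) = pi" if "t \<in> tets (X_tri n)" for t
      using sum_pi that by (auto simp: tets_simps)
    show "T_weight (twist_p n) s l + (if l = 0 then shape_a (s V) + shape_c (s W) else 0) = 2 * pi"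
      if "l < twist_p n" for l
      using W[of l] that by (auto simp: tet_weight_def simp flip: p_def)
    show "T_weight (twist_p n) s (twist_p n) + (if twist_p n = 0 then shape_a (s V) + shape_c (s W) else 0)
       + shape_c (s U) + shape_b (s V) + shape_a (s V) + shape_a (s W) = pi"
      using W[of p] bcZ by (auto simp: tet_weight_def simp flip: p_def)
  qed
qed

text \<open>
  In \<open>X\<^sub>n\<close> the identification of \<open>s\<close> with \<open>s'\<close> adds up the equations of the two classes that it merges;
  \<open>a\<^sub>U = a\<^sub>V\<close> separates them again.
\<close>

lemma angle_relations_X:
  assumes s: "s \<in> angle_structures (X_tri n)" and UV: "shape_a (s U) = shape_a (s V)"
  shows "angle_relations (twist_p n) s"
proof -
  define p where "p = twist_p n"
  have sum_pi: "shape_a (s t) + shape_b (s t) + shape_c (s t) = pi" if "t \<in> tets (X_tri n)" for t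
    using s that
    by (auto simp: angle_structures_def shape_structures_def open_shapes_def shape_a_def shape_b_def shape_c_def dest!: PiE_mem)
  have W: "T_weight p s l + tet_weight p p s U l + tet_weight p p s V l +
      tet_weight p p s W l = 2 * pi"
    if "l \<le> p \<or> l = p + 3" for l
  proof -
    let ?r = "edge_rep p l"
    have r: "?r \<in> tet_edges (X_tri n)" "twist_label p p ?r = l"
      using that by (auto simp: edge_rep_def tet_edges_def tets_simps twist_label_def edge_index_def p_def)
    have eq: "(edge_glue (X_tri n))\<^sup>* `` {?r} = {e \<in> tet_edges (X_tri n). twist_label p p e = l}"
      unfolding p_def using r that by (intro edge_class_X) (auto simp: p_def)
    have "(edge_glue (X_tri n))\<^sup>* `` {?r} \<in> edges (X_tri n)"
      unfolding edges_def by (rule quotientI[OF r(1)])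
    then have "weight s {e \<in> tet_edges (X_tri n). twist_label p p e = l} = 2 * pi"
      using s eq by (auto simp: angle_structures_def)
    then show ?thesis unfolding p_def weight_X .
  qed
  have U: "shape_a (s U) + shape_b (s U) + shape_c (s U) = pi"
    and V: "shape_a (s V) + shape_b (s V) + shape_c (s V) = pi"
    and WW: "shape_a (s W) + shape_b (s W) + shape_c (s W) = pi"
    using sum_pi by (auto simp: tets_simps)
  have aV: "shape_a (s V) = shape_a (s U)" using UV by simp
  have cW: "shape_c (s W) = shape_a (s U)"
    using W[of "p + 3"] aV U V WW by (simp add: tet_weight_def T_weight_def)
  show ?thesis
  proof (rule angle_relationsI[OF sum_pi aV cW])
    show "T_weight (twist_p n) s l + (if l = 0 then shape_a (s V) + shape_c (s W) else 0) = 2 * pi"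
      if "l < twist_p n" for l
      using W[of l] that by (auto simp: tet_weight_def simp flip: p_def)
    show "T_weight (twist_p n) s (twist_p n) + (if twist_p n = 0 then shape_a (s V) + shape_c (s W) else 0)
       + shape_c (s U) + shape_b (s V) + shape_a (s V) + shape_a (s W) = pi"
      using W[of p] U cW by (auto simp: tet_weight_def simp flip: p_def)
  qed
qed

section \<open>The triangular system of deltas\<close>

abbreviation Leb :: "'i set \<Rightarrow> ('i \<Rightarrow> real) measure" where
  "Leb I \<equiv> \<Pi>\<^sub>M i\<in>I. lborel"

definition gauss :: "real \<Rightarrow> real" where
  "gauss y = exp (- pi * y\<^sup>2)"

lemma gauss_nonneg: "0 \<le> gauss y" and gauss_le_1: "gauss y \<le> 1"
  and gauss_minus: "gauss (- y) = gauss y"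
  by (simp_all add: gauss_def)

lemma gauss_measurable [measurable]: "gauss \<in> borel_measurable borel"
  unfolding gauss_def by measurable

text \<open>
  The Fourier transform of a Gaussian, taken from the characteristic function of the normal distribution.
\<close>

lemma delta_reg_eq:
  assumes "\<epsilon> > 0"
  shows "delta_reg \<epsilon> y = of_real (exp (- pi * y\<^sup>2 / \<epsilon>) / sqrt \<epsilon>)"
proof -
  define c where "c = sqrt (2 * pi * \<epsilon>)"
  have c: "c > 0" "c\<^sup>2 = 2 * pi * \<epsilon>" using assms by (auto simp: c_def)
  define t where "t = - 2 * pi * y / c"
  have "complex_of_real (exp (- (t\<^sup>2) / 2)) = char std_normal_distribution t"
    by (simp add: char_std_normal_distribution)
  also have "\<dots> = (LINT x|lborel. std_normal_density x *\<^sub>R iexp (t * x))"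
    unfolding char_def by (subst integral_density) (auto simp: normal_density_nonneg)
  also have "\<dots> = \<bar>c\<bar> *\<^sub>R (LINT w|lborel. std_normal_density (0 + c * w) *\<^sub>R iexp (t * (0 + c * w)))"
    using c by (intro lborel_integral_real_affine) simp
  also have "(\<lambda>w. std_normal_density (0 + c * w) *\<^sub>R iexp (t * (0 + c * w))) =
      (\<lambda>w. of_real (1 / sqrt (2 * pi)) * (exp (- 2 * \<i> * of_real pi * of_real y * of_real w) *
            exp (- of_real pi * of_real \<epsilon> * (of_real w)\<^sup>2)))"
  proof
    fix w :: real
    have "(c * w)\<^sup>2 / 2 = pi * \<epsilon> * w\<^sup>2" using c(2) by (simp add: power_mult_distrib)
    then have "std_normal_density (0 + c * w) = 1 / sqrt (2 * pi) * exp (- pi * \<epsilon> * w\<^sup>2)"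
      by (simp add: std_normal_density_def)
    moreover have "t * (0 + c * w) = - 2 * pi * y * w" using c(1) by (simp add: t_def)
    ultimately show "std_normal_density (0 + c * w) *\<^sub>R iexp (t * (0 + c * w)) =
      of_real (1 / sqrt (2 * pi)) * (exp (- 2 * \<i> * of_real pi * of_real y * of_real w) *
            exp (- of_real pi * of_real \<epsilon> * (of_real w)\<^sup>2))"
      by (simp add: scaleR_conv_of_real exp_of_real[symmetric] mult_ac)
  qed
  also have "\<bar>c\<bar> *\<^sub>R (LINT w|lborel. of_real (1 / sqrt (2 * pi)) * (exp (- 2 * \<i> * of_real pi * of_real y * of_real w) *
            exp (- of_real pi * of_real \<epsilon> * (of_real w)\<^sup>2))) =
      of_real (c / sqrt (2 * pi)) * delta_reg \<epsilon> y"
    using c(1) unfolding delta_reg_def integral_mult_right_zero by (simp add: scaleR_conv_of_real)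
  also have "c / sqrt (2 * pi) = sqrt \<epsilon>" by (simp add: c_def real_sqrt_mult)
  finally have "of_real (sqrt \<epsilon>) * delta_reg \<epsilon> y = of_real (exp (- (t\<^sup>2) / 2))" by simp
  moreover have "- (t\<^sup>2) / 2 = - pi * y\<^sup>2 / \<epsilon>"
    unfolding t_def power_divide power_mult_distrib c(2) by (simp add: power2_eq_square)
  ultimately show ?thesis using assms by (simp add: field_simps)
qed

lemma integral_gauss: "(LINT y|lborel. complex_of_real (gauss y)) = 1"
proof -
  have "delta_reg 1 0 = 1" by (simp add: delta_reg_eq)
  then show ?thesis
    by (simp add: delta_reg_def gauss_def exp_of_real[symmetric])
qed

lemma integrable_gauss: "integrable lborel gauss"
proof -
  have "integrable lborel (\<lambda>y. complex_of_real (gauss y))"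
    using integral_gauss not_integrable_integral_eq[of lborel "\<lambda>y. complex_of_real (gauss y)"] by auto
  then show ?thesis by (simp add: complex_of_real_integrable_eq)
qed

text \<open>
  The regularised delta in terms of \<open>\<sigma> = \<surd>\<epsilon>\<close>, the scale on which it lives.
\<close>

definition dl :: "real \<Rightarrow> real \<Rightarrow> real" where
  "dl \<sigma> y = gauss (y / \<sigma>) / \<sigma>"

lemma delta_reg_dl: "\<sigma> > 0 \<Longrightarrow> delta_reg (\<sigma>\<^sup>2) y = of_real (dl \<sigma> y)"
  by (simp add: delta_reg_eq dl_def gauss_def power_divide)

lemma dl_bounds: "\<sigma> > 0 \<Longrightarrow> 0 \<le> dl \<sigma> y" "\<sigma> > 0 \<Longrightarrow> dl \<sigma> y \<le> 1 / \<sigma>"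
  by (auto simp: dl_def gauss_nonneg gauss_le_1 divide_right_mono)

lemma dl_scaled: "\<sigma> > 0 \<Longrightarrow> dl \<sigma> (\<sigma> * y) = gauss y / \<sigma>" "\<sigma> > 0 \<Longrightarrow> dl \<sigma> (- (\<sigma> * y)) = gauss y / \<sigma>"
  by (auto simp: dl_def gauss_minus)

lemma dl_measurable [measurable]: "dl \<sigma> \<in> borel_measurable borel"
  unfolding dl_def by measurable

text \<open>
  All faces of \<open>Y\<^sub>n\<close> but \<open>m\<close>, which is integrated separately.
\<close>

definition other_faces :: "nat \<Rightarrow> twist_face set" where
  "other_faces p = Fe ` {1..p + 1} \<union> Ff ` {1..p} \<union> {Fs, Fs', Fg, Fr, Fv, Fu}"

lemma finite_other_faces [simp]: "finite (other_faces p)"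
  by (simp add: other_faces_def)

lemma Fm_notin [simp]: "Fm \<notin> other_faces p"
  by (auto simp: other_faces_def)

lemma in_other_faces [simp]:
  "Fs \<in> other_faces p" "Fs' \<in> other_faces p" "Fg \<in> other_faces p" "Fr \<in> other_faces p"
  "Fv \<in> other_faces p" "Fu \<in> other_faces p"
  "Fe k \<in> other_faces p \<longleftrightarrow> 1 \<le> k \<and> k \<le> p + 1" "Ff k \<in> other_faces p \<longleftrightarrow> 1 \<le> k \<and> k \<le> p"
  by (auto simp: other_faces_def)

lemma face_f_in [simp]: "k \<le> p \<Longrightarrow> face_f k \<in> other_faces p"
  by (auto simp: face_f_def)

lemma faces_Y: "faces (Y_tri n) = insert Fm (other_faces (twist_p n))"
proof -
  let ?p = "twist_p n"
  have 1: "{0..<4::nat} = {0, 1, 2, 3}" by auto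
  have "faces (Y_tri n) = (\<Union>t\<in>tets (Y_tri n). (\<lambda>k. face (Y_tri n) t k) ` {0..<4})"
    unfolding faces_def by fastforce
  also have "\<dots> = (\<Union>k\<in>{1..?p}. {Fe k, Fe (k + 1), face_f k, face_f (k - 1)}) \<union>
      {Fr, Fv, Fs', Fg} \<union> {Fs, Fg, face_f ?p, Fu} \<union> {Fu, Fv, Fr, Fe (?p + 1)} \<union> {Fm, Fs, Fs'}"
    unfolding 1 tets_simps by auto
  also have "\<dots> = insert Fm (other_faces ?p)" (is "?A = _")
  proof
    have f: "face_f (k - Suc 0) \<in> other_faces ?p" if "Suc 0 \<le> k \<and> k \<le> ?p" for k
      by (rule face_f_in) (use that in arith)
    show "?A \<subseteq> insert Fm (other_faces ?p)"
      using f by (intro Un_least UN_least insert_subsetI empty_subsetI) simp_all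
    have e: "Fe k \<in> ?A" if "1 \<le> k" "k \<le> ?p + 1" for k
    proof (cases "k = ?p + 1")
      case True
      then show ?thesis by simp
    next
      case False
      then have "k \<in> {1..?p}" using that by auto
      then show ?thesis by blast
    qed
    have f': "Ff k \<in> ?A" if "1 \<le> k" "k \<le> ?p" for k
    proof -
      have "k \<in> {1..?p}" "Ff k = face_f k" using that by (auto simp: face_f_def)
      then show ?thesis by blast
    qed
    show "insert Fm (other_faces ?p) \<subseteq> ?A"
    proof
      fix x assume "x \<in> insert Fm (other_faces ?p)"
      then consider k where "x = Fe k" "1 \<le> k" "k \<le> ?p + 1" | k where "x = Ff k" "1 \<le> k" "k \<le> ?p"
        | "x \<in> {Fm, Fs, Fs', Fg, Fr, Fv, Fu}"
        unfolding other_faces_def by auto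
      then show "x \<in> ?A" by cases (use e f' in blast)+
    qed
  qed
  finally show ?thesis .
qed

lemma prod_shift: "(\<Prod>k=1..p. h (k - 1)) * h p = (\<Prod>k\<le>p. h k)" for h :: "nat \<Rightarrow> 'c::comm_monoid_mult"
  by (induction p) (simp_all add: mult_ac)

text \<open>
  The order of the factors is that of the deltas: \<open>e\<^sub>k\<^sub>+\<^sub>1\<close> and \<open>f\<^sub>k\<^sub>-\<^sub>1\<close> are the variables resolved by the two
  deltas of \<open>T\<^sub>k\<close>.
\<close>

lemma prod_other_faces:
  fixes g :: "twist_face \<Rightarrow> 'c::comm_monoid_mult"
  shows "(\<Prod>f\<in>other_faces p. g f) = (\<Prod>k=1..p. g (Fe (k + 1))) * (\<Prod>k=1..p. g (face_f (k - 1))) * g (face_f p)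
     * (g Fs * g Fs' * g Fg * g Fr * g Fv * g Fu)"
proof -
  have "(\<Prod>f\<in>other_faces p. g f) = (\<Prod>f\<in>Fe ` {1..p + 1}. g f) * (\<Prod>f\<in>Ff ` {1..p}. g f) * (\<Prod>f\<in>{Fs, Fs', Fg, Fr, Fv, Fu}. g f)"
    unfolding other_faces_def by (subst prod.union_disjoint; (subst prod.union_disjoint)?) auto
  also have "(\<Prod>f\<in>{Fs, Fs', Fg, Fr, Fv, Fu}. g f) = g Fs * g Fs' * g Fg * g Fr * g Fv * g Fu"
    by (simp add: mult_ac)
  also have "(\<Prod>f\<in>Fe ` {1..p + 1}. g f) = g (Fe 1) * (\<Prod>k=1..p. g (Fe (k + 1)))"
  proof -
    have "(\<Prod>f\<in>Fe ` {1..p + 1}. g f) = (\<Prod>k=1..p + 1. g (Fe k))"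
      by (subst prod.reindex) (auto simp: inj_on_def)
    also have "\<dots> = g (Fe 1) * (\<Prod>k=Suc 1..p + 1. g (Fe k))"
      by (rule prod.atLeast_Suc_atMost) simp
    also have "(\<Prod>k=Suc 1..p + 1. g (Fe k)) = (\<Prod>k=1..p. g (Fe (k + 1)))"
      using prod.shift_bounds_cl_Suc_ivl[of "\<lambda>k. g (Fe k)" 1 p] by simp
    finally show ?thesis .
  qed
  also have "(\<Prod>f\<in>Ff ` {1..p}. g f) = (\<Prod>k=1..p. g (Ff k))"
    by (subst prod.reindex) (auto simp: inj_on_def)
  also have "g (Fe 1) * (\<Prod>k=1..p. g (Fe (k + 1))) * (\<Prod>k=1..p. g (Ff k)) =
      (\<Prod>k=1..p. g (Fe (k + 1))) * ((\<Prod>k=1..p. g (face_f (k - 1))) * g (face_f p))"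
  proof -
    have "(\<Prod>k=1..p. g (face_f (k - 1))) * g (face_f p) = (\<Prod>k\<le>p. g (face_f k))"
      by (rule prod_shift)
    also have "\<dots> = g (Fe 1) * (\<Prod>k=1..p. g (Ff k))"
      unfolding atMost_atLeast0 by (subst prod.atLeast_Suc_atMost) (auto simp: face_f_def intro!: prod.cong)
    finally show ?thesis by (simp add: mult_ac)
  qed
  finally show ?thesis by (simp add: mult_ac)
qed

definition f_sol :: "nat \<Rightarrow> real \<Rightarrow> (twist_tet \<Rightarrow> real) \<Rightarrow> (twist_face \<Rightarrow> real) \<Rightarrow> nat \<Rightarrow> real" where
  "f_sol p \<sigma> t v k = \<sigma> * (v Fs' + v Fg) + t Z + t U + (\<Sum>j=k+1..p. t (T j)) + \<sigma> * (\<Sum>j=k..p. v (face_f j))"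

definition e_sol :: "nat \<Rightarrow> real \<Rightarrow> (twist_tet \<Rightarrow> real) \<Rightarrow> (twist_face \<Rightarrow> real) \<Rightarrow> nat \<Rightarrow> real" where
  "e_sol p \<sigma> t v k = (\<Sum>j<k. f_sol p \<sigma> t v j) + \<sigma> * (\<Sum>j=2..k. v (Fe j))"

text \<open>
  The face variables at which each delta except the second one of \<open>V\<close> has the argument \<open>\<sigma> v\<^sub>f\<close>, up to
  sign, where \<open>f\<close> is the variable that it resolves. The deltas are used in the order in which the variables
  \<open>s, s', g, f\<^sub>p, \<dots>, f\<^sub>1, e\<^sub>1, \<dots>, e\<^sub>p\<^sub>+\<^sub>1, r, v, u\<close> can be read off.
\<close>

fun face_sol :: "nat \<Rightarrow> real \<Rightarrow> (twist_tet \<Rightarrow> real) \<Rightarrow> (twist_face \<Rightarrow> real) \<Rightarrow> twist_face \<Rightarrow> real" where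
  "face_sol p \<sigma> t v (Fe k) = e_sol p \<sigma> t v k"
| "face_sol p \<sigma> t v (Ff k) = f_sol p \<sigma> t v k"
| "face_sol p \<sigma> t v Fs = \<sigma> * v Fs"
| "face_sol p \<sigma> t v Fs' = \<sigma> * v Fs + t Z + \<sigma> * v Fs'"
| "face_sol p \<sigma> t v Fg = \<sigma> * v Fs + t Z + \<sigma> * v Fs' + t U + \<sigma> * v Fg"
| "face_sol p \<sigma> t v Fr = e_sol p \<sigma> t v (p + 1) - t W + \<sigma> * v Fr"
| "face_sol p \<sigma> t v Fv = e_sol p \<sigma> t v (p + 1) - t W + \<sigma> * v Fr + \<sigma> * v Fs + t Z + \<sigma> * v Fs' + \<sigma> * v Fv"
| "face_sol p \<sigma> t v Fu = \<sigma> * v Fs + t Z + \<sigma> * v Fs' + \<sigma> * v Fv + \<sigma> * v Fu"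
| "face_sol p \<sigma> t v Fm = 0"

text \<open>
  The second delta of \<open>V\<close> is left over when all faces are resolved; its argument is then
  \<open>t\<^sub>U + t\<^sub>V + \<sigma> defect\<close>.
\<close>

definition defect :: "nat \<Rightarrow> (twist_face \<Rightarrow> real) \<Rightarrow> real" where
  "defect p v = v Fg + v (face_f p) - v Fs - v Fv - v Fu"

lemma face_sol_face_f: "face_sol p \<sigma> t v (face_f k) = f_sol p \<sigma> t v k"
  by (simp add: face_f_def e_sol_def)

lemma f_sol_rec:
  assumes "1 \<le> k" "k \<le> p"
  shows "f_sol p \<sigma> t v (k - 1) = f_sol p \<sigma> t v k + t (T k) + \<sigma> * v (face_f (k - 1))"
proof -
  have "(\<Sum>j=k-1+1..p. t (T j)) = t (T k) + (\<Sum>j=k+1..p. t (T j))"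
    using assms sum.atLeast_Suc_atMost[of k p "\<lambda>j. t (T j)"] by simp
  moreover have "(\<Sum>j=k-1..p. v (face_f j)) = v (face_f (k - 1)) + (\<Sum>j=k..p. v (face_f j))"
    using assms sum.atLeast_Suc_atMost[of "k - 1" p "\<lambda>j. v (face_f j)"] by simp
  ultimately show ?thesis unfolding f_sol_def by (simp add: algebra_simps)
qed

lemma f_sol_last: "f_sol p \<sigma> t v p = \<sigma> * (v Fs' + v Fg) + t Z + t U + \<sigma> * v (face_f p)"
  by (simp add: f_sol_def)

lemma e_sol_Suc:
  "1 \<le> k \<Longrightarrow> e_sol p \<sigma> t v (k + 1) = e_sol p \<sigma> t v k + f_sol p \<sigma> t v k + \<sigma> * v (Fe (k + 1))"
  by (simp add: e_sol_def algebra_simps)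

definition delta_factors :: "nat \<Rightarrow> real \<Rightarrow> (twist_face \<Rightarrow> real) \<Rightarrow> (twist_tet \<Rightarrow> real) \<Rightarrow> real" where
  "delta_factors p \<sigma> x t =
     (\<Prod>k=1..p. dl \<sigma> (x (Fe k) - x (Fe (k + 1)) + x (face_f k)) * dl \<sigma> (x (face_f k) - x (face_f (k - 1)) + t (T k))) *
     (dl \<sigma> (x Fr - x Fv + x Fs') * dl \<sigma> (x Fs' - x Fg + t U)) *
     (dl \<sigma> (x Fs - x Fg + x (face_f p)) * dl \<sigma> (x (face_f p) - x Fu + t V)) *
     (dl \<sigma> (x Fu - x Fv + x Fr) * dl \<sigma> (x Fr - x (Fe (p + 1)) + t W)) *
     (dl \<sigma> (x Fs) * dl \<sigma> (x Fs - x Fs' + t Z))"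

definition phase :: "nat \<Rightarrow> (twist_face \<Rightarrow> real) \<Rightarrow> (twist_tet \<Rightarrow> real) \<Rightarrow> real" where
  "phase p x t = (\<Sum>k=1..p. x (Fe k) * t (T k)) + x Fr * t U - x Fs * t V - x Fu * t W"

lemma delta_factors_face_sol:
  assumes \<sigma>: "\<sigma> > 0"
  shows "delta_factors p \<sigma> (face_sol p \<sigma> t v) t =
         (\<Prod>f\<in>other_faces p. gauss (v f) / \<sigma>) * dl \<sigma> (t U + t V + \<sigma> * defect p v)"
proof -
  let ?x = "face_sol p \<sigma> t v"
  have T1: "dl \<sigma> (?x (Fe k) - ?x (Fe (k + 1)) + ?x (face_f k)) = gauss (v (Fe (k + 1))) / \<sigma>" if "1 \<le> k" for k
  proof -
    have "?x (Fe k) - ?x (Fe (k + 1)) + ?x (face_f k) = - (\<sigma> * v (Fe (k + 1)))"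
      using e_sol_Suc[OF that, of p \<sigma> t v] by (simp add: face_sol_face_f)
    then show ?thesis using dl_scaled[OF \<sigma>] by simp
  qed
  have T2: "dl \<sigma> (?x (face_f k) - ?x (face_f (k - 1)) + t (T k)) = gauss (v (face_f (k - 1))) / \<sigma>"
    if "1 \<le> k" "k \<le> p" for k
  proof -
    have "?x (face_f k) - ?x (face_f (k - 1)) + t (T k) = - (\<sigma> * v (face_f (k - 1)))"
      using f_sol_rec[OF that, of \<sigma> t v] by (simp add: face_sol_face_f)
    then show ?thesis using dl_scaled[OF \<sigma>] by simp
  qed
  have U: "dl \<sigma> (?x Fr - ?x Fv + ?x Fs') = gauss (v Fv) / \<sigma>" "dl \<sigma> (?x Fs' - ?x Fg + t U) = gauss (v Fg) / \<sigma>"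
    using dl_scaled(2)[OF \<sigma>, of "v Fv"] dl_scaled(2)[OF \<sigma>, of "v Fg"] by simp_all
  have V: "dl \<sigma> (?x Fs - ?x Fg + ?x (face_f p)) = gauss (v (face_f p)) / \<sigma>"
    "dl \<sigma> (?x (face_f p) - ?x Fu + t V) = dl \<sigma> (t U + t V + \<sigma> * defect p v)"
  proof -
    have "?x Fs - ?x Fg + ?x (face_f p) = \<sigma> * v (face_f p)"
      "?x (face_f p) - ?x Fu + t V = t U + t V + \<sigma> * defect p v"
      unfolding face_sol_face_f f_sol_last by (simp_all add: defect_def algebra_simps)
    then show "dl \<sigma> (?x Fs - ?x Fg + ?x (face_f p)) = gauss (v (face_f p)) / \<sigma>"
      "dl \<sigma> (?x (face_f p) - ?x Fu + t V) = dl \<sigma> (t U + t V + \<sigma> * defect p v)"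
      by (simp_all only: dl_scaled[OF \<sigma>])
  qed
  have W: "dl \<sigma> (?x Fu - ?x Fv + ?x Fr) = gauss (v Fu) / \<sigma>" "dl \<sigma> (?x Fr - ?x (Fe (p + 1)) + t W) = gauss (v Fr) / \<sigma>"
    using dl_scaled(1)[OF \<sigma>, of "v Fu"] dl_scaled(1)[OF \<sigma>, of "v Fr"] by simp_all
  have Z: "dl \<sigma> (?x Fs) = gauss (v Fs) / \<sigma>" "dl \<sigma> (?x Fs - ?x Fs' + t Z) = gauss (v Fs') / \<sigma>"
    using dl_scaled(1)[OF \<sigma>, of "v Fs"] dl_scaled(2)[OF \<sigma>, of "v Fs'"] by simp_all
  have "(\<Prod>k=1..p. dl \<sigma> (?x (Fe k) - ?x (Fe (k + 1)) + ?x (face_f k)) * dl \<sigma> (?x (face_f k) - ?x (face_f (k - 1)) + t (T k)))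
      = (\<Prod>k=1..p. gauss (v (Fe (k + 1))) / \<sigma>) * (\<Prod>k=1..p. gauss (v (face_f (k - 1))) / \<sigma>)"
    unfolding prod.distrib[symmetric] by (intro prod.cong refl) (simp only: T1 T2 atLeastAtMost_iff)
  then show ?thesis
    unfolding delta_factors_def U V W Z prod_other_faces by (simp only: mult_ac)
qed

fun face_rank :: "nat \<Rightarrow> twist_face \<Rightarrow> nat" where
  "face_rank p Fs = 0"
| "face_rank p Fs' = 1"
| "face_rank p Fg = 2"
| "face_rank p (Ff k) = 3 + (p - k)"
| "face_rank p (Fe k) = 3 + p + k"
| "face_rank p Fr = 2 * p + 10"
| "face_rank p Fv = 2 * p + 11"
| "face_rank p Fu = 2 * p + 12"
| "face_rank p Fm = 0"

lemma face_sol_triangular: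
  assumes f: "f \<in> other_faces p"
    and eq: "\<And>g. g \<in> other_faces p \<Longrightarrow> face_rank p g < face_rank p f \<Longrightarrow> v' g = v g"
  shows "face_sol p \<sigma> t v' f - \<sigma> * v' f = face_sol p \<sigma> t v f - \<sigma> * v f"
proof -
  have split_f: "f_sol p \<sigma> t w k - \<sigma> * w (face_f k) =
      \<sigma> * (w Fs' + w Fg) + t Z + t U + (\<Sum>j=k+1..p. t (T j)) + \<sigma> * (\<Sum>j=k+1..p. w (Ff j))"
    if "k \<le> p" for w k
  proof -
    have "(\<Sum>j=k..p. w (face_f j)) = w (face_f k) + (\<Sum>j=Suc k..p. w (face_f j))"
      using that by (rule sum.atLeast_Suc_atMost)
    also have "(\<Sum>j=Suc k..p. w (face_f j)) = (\<Sum>j=k+1..p. w (Ff j))"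
      by (intro sum.cong) (auto simp: face_f_def)
    finally show ?thesis by (simp add: f_sol_def algebra_simps)
  qed
  have split_e: "e_sol p \<sigma> t w k - \<sigma> * w (Fe k) = (\<Sum>j<k. f_sol p \<sigma> t w j) + \<sigma> * (\<Sum>j=2..k-1. w (Fe j))"
    if k: "2 \<le> k" for w k
  proof -
    have "{2..k} = insert k {2..k - 1}" using k by auto
    then have "(\<Sum>j=2..k. w (Fe j)) = w (Fe k) + (\<Sum>j=2..k-1. w (Fe j))" using k by simp
    then show ?thesis by (simp add: e_sol_def algebra_simps)
  qed
  have fs: "f_sol p \<sigma> t v' j = f_sol p \<sigma> t v j" if "face_rank p f > face_rank p (Fe 1)" "j \<le> p" for j
  proof -
    have "v' Fs' = v Fs'" "v' Fg = v Fg" using that by (auto intro!: eq)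
    moreover have "v' (face_f i) = v (face_f i)" if "i \<le> p" for i
      using that \<open>face_rank p f > face_rank p (Fe 1)\<close> by (intro eq) (auto simp: face_f_def)
    ultimately show ?thesis unfolding f_sol_def by simp
  qed
  have es: "e_sol p \<sigma> t v' (p + 1) = e_sol p \<sigma> t v (p + 1)" if "face_rank p f > face_rank p (Fe (p + 1))"
  proof -
    have "v' (Fe j) = v (Fe j)" if "j \<in> {2..p + 1}" for j
      using that \<open>face_rank p f > face_rank p (Fe (p + 1))\<close> by (intro eq) auto
    moreover have "f_sol p \<sigma> t v' j = f_sol p \<sigma> t v j" if "j < p + 1" for j
      using that \<open>face_rank p f > face_rank p (Fe (p + 1))\<close> by (intro fs) auto
    ultimately show ?thesis unfolding e_sol_def by simp
  qed
  show ?thesis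
  proof (cases f)
    case (Fe k)
    then have k: "1 \<le> k" "k \<le> p + 1" using f by auto
    show ?thesis
    proof (cases "k = 1")
      case True
      have "v' Fs' = v Fs'" "v' Fg = v Fg" "\<And>j. j \<in> {1..p} \<Longrightarrow> v' (Ff j) = v (Ff j)"
        using Fe True by (auto intro!: eq)
      then show ?thesis
        using split_f[of 0 v] split_f[of 0 v'] Fe True by (simp add: e_sol_def face_f_def)
    next
      case False
      then have k2: "2 \<le> k" using k by auto
      have "v' (Fe j) = v (Fe j)" if "j \<in> {2..k - 1}" for j
        using that Fe k by (intro eq) auto
      moreover have "f_sol p \<sigma> t v' j = f_sol p \<sigma> t v j" if "j < k" for j
        using that Fe k k2 by (intro fs) auto
      ultimately show ?thesis using split_e[OF k2, of v] split_e[OF k2, of v'] Fe by simp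
    qed
  next
    case (Ff k)
    then have k: "1 \<le> k" "k \<le> p" using f by auto
    have "v' Fs' = v Fs'" "v' Fg = v Fg" using Ff by (auto intro!: eq)
    moreover have "v' (Ff j) = v (Ff j)" if "j \<in> {k + 1..p}" for j
      using Ff k that by (intro eq) auto
    ultimately show ?thesis using split_f[OF k(2), of v] split_f[OF k(2), of v'] Ff k by (simp add: face_f_def)
  next
    case Fv
    have "v' Fr = v Fr" "v' Fs = v Fs" "v' Fs' = v Fs'" using Fv by (auto intro!: eq)
    then show ?thesis using es Fv by simp
  next
    case Fr
    then show ?thesis using es by simp
  next
    case Fs' then show ?thesis using eq[of Fs] by simp
  next
    case Fg then show ?thesis using eq[of Fs] eq[of Fs'] by simp
  next
    case Fu then show ?thesis using eq[of Fs] eq[of Fs'] eq[of Fv] by simp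
  qed (use f in auto)
qed

section \<open>Measurability and integrability on products\<close>

lemma Leb_component: "i \<in> I \<Longrightarrow> (\<lambda>x. x i) \<in> borel_measurable (Leb I)"
  using measurable_component_singleton[of i I "\<lambda>_. lborel :: real measure"] by simp

lemma sigma_finite_Leb: "finite I \<Longrightarrow> sigma_finite_measure (Leb I)"
proof -
  assume I: "finite I"
  interpret product_sigma_finite "\<lambda>_. lborel :: real measure" ..
  show ?thesis using sigma_finite[OF I] .
qed

lemma integrable_prod_Leb:
  fixes f :: "'i \<Rightarrow> real \<Rightarrow> real"
  assumes "finite I" "\<And>i. i \<in> I \<Longrightarrow> integrable lborel (f i)"
  shows "integrable (Leb I) (\<lambda>x. \<Prod>i\<in>I. f i (x i))"
proof -
  interpret product_sigma_finite "\<lambda>_. lborel :: real measure" ..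
  show ?thesis using assms by (rule product_integrable_prod)
qed

lemma integral_prod_gauss:
  assumes "finite I"
  shows "(LINT x|Leb I. complex_of_real (\<Prod>i\<in>I. gauss (x i))) = 1"
proof -
  interpret product_sigma_finite "\<lambda>_. lborel :: real measure" ..
  have "(LINT x|Leb I. (\<Prod>i\<in>I. complex_of_real (gauss (x i)))) = (\<Prod>i\<in>I. LINT y|lborel. complex_of_real (gauss y))"
    using assms integrable_gauss by (intro product_integral_prod) (auto simp: complex_of_real_integrable_eq)
  then show ?thesis by (simp add: integral_gauss del: integral_complex_of_real)
qed

text \<open>
  The hypothesis \<open>indep\<close> allows \<open>f\<close> to be kept as a function on the larger product.
\<close>

lemma integral_insert_separated:
  fixes f :: "('i \<Rightarrow> real) \<Rightarrow> complex" and g :: "real \<Rightarrow> complex"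
  assumes I: "finite I" "i \<notin> I"
    and int: "integrable (Leb (insert i I)) (\<lambda>x. g (x i) * f x)"
    and indep: "\<And>x y. f (x(i := y)) = f x"
  shows "(LINT x|Leb (insert i I). g (x i) * f x) = (LINT y|lborel. g y) * (LINT x|Leb I. f x)"
proof -
  interpret product_sigma_finite "\<lambda>_. lborel :: real measure" ..
  have "(LINT x|Leb (insert i I). g (x i) * f x) = (LINT x|Leb I. LINT y|lborel. g y * f x)"
    by (subst product_integral_insert[OF I int]) (simp add: indep)
  also have "\<dots> = (LINT x|Leb I. (LINT y|lborel. g y) * f x)"
    by simp
  finally show ?thesis by simp
qed

lemma integrable_pair_times:
  fixes f :: "'a \<Rightarrow> real" and g :: "'b \<Rightarrow> real"
  assumes "sigma_finite_measure M" "sigma_finite_measure N" "integrable M f" "integrable N g"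
  shows "integrable (M \<Otimes>\<^sub>M N) (\<lambda>p. f (fst p) * g (snd p))"
proof -
  interpret M: sigma_finite_measure M by fact
  interpret N: sigma_finite_measure N by fact
  interpret pair_sigma_finite M N ..
  have "integrable (M \<Otimes>\<^sub>M N) (\<lambda>(x, y). f x * g y)"
  proof (rule Fubini_integrable)
    show "(\<lambda>(x, y). f x * g y) \<in> borel_measurable (M \<Otimes>\<^sub>M N)"
      unfolding split_def using assms(3,4)[THEN borel_measurable_integrable]
      by (intro borel_measurable_times) (erule measurable_compose[OF measurable_fst] measurable_compose[OF measurable_snd])+
    have "integrable M (\<lambda>x. \<bar>f x\<bar> * (\<integral>y. \<bar>g y\<bar> \<partial>N))"
      by (intro integrable_mult_left integrable_abs assms(3))
    then show "integrable M (\<lambda>x. \<integral>y. norm (case (x, y) of (x, y) \<Rightarrow> f x * g y) \<partial>N)"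
      by (simp add: abs_mult)
    show "AE x in M. integrable N (\<lambda>y. case (x, y) of (x, y) \<Rightarrow> f x * g y)"
      unfolding prod.case by (intro AE_I2 integrable_mult_right assms(4))
  qed
  then show ?thesis by (simp add: split_def)
qed

section \<open>The action of the kinematical kernel\<close>

lemma tets_Y_insert: "tets (Y_tri n) = insert Z (insert V (J_index n))"
  by (auto simp: tets_simps J_index_def)

lemma J_index_simps [simp]: "Z \<notin> J_index n" "V \<notin> J_index n" "U \<in> J_index n" "W \<in> J_index n"
  "T k \<in> J_index n \<longleftrightarrow> 1 \<le> k \<and> k \<le> twist_p n" "finite (J_index n)"
  by (auto simp: J_index_def)

definition kernel_integrand :: "nat \<Rightarrow> real \<Rightarrow> (twist_face \<Rightarrow> real) \<Rightarrow> (twist_tet \<Rightarrow> real) \<Rightarrow> complex" where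
  "kernel_integrand p \<sigma> x t =
     of_real ((\<Prod>f\<in>other_faces p. gauss (\<sigma> * x f)) * delta_factors p \<sigma> x t) *
     exp (2 * \<i> * of_real pi * of_real (phase p x t))"

lemma gauss_scaled_of_real:
  "exp (- of_real pi * of_real (\<sigma>\<^sup>2) * (of_real y)\<^sup>2) = complex_of_real (gauss (\<sigma> * y))"
  by (simp add: gauss_def exp_of_real[symmetric] power_mult_distrib mult_ac)

lemma regularised_integrand_eq:
  fixes x :: "twist_face \<Rightarrow> real"
  assumes \<sigma>: "\<sigma> > 0"
  shows "(\<Prod>f\<in>faces (Y_tri n). exp (- of_real pi * of_real (\<sigma>\<^sup>2) * (of_real (x f))\<^sup>2)) *
     (\<Prod>t'\<in>tets (Y_tri n).
        exp (2 * \<i> * of_real pi * of_int (tsign (Y_tri n) t') * of_real (x (face (Y_tri n) t' 0)) * of_real (t t')) *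
        delta_reg (\<sigma>\<^sup>2) (x (face (Y_tri n) t' 0) - x (face (Y_tri n) t' 1) + x (face (Y_tri n) t' 2)) *
        delta_reg (\<sigma>\<^sup>2) (x (face (Y_tri n) t' 2) - x (face (Y_tri n) t' 3) + t t')) =
     (exp (2 * \<i> * of_real pi * of_real (t Z) * of_real (x Fm)) * of_real (gauss (\<sigma> * x Fm))) *
     kernel_integrand (twist_p n) \<sigma> x t"
proof -
  let ?p = "twist_p n"
  define F where "F t' = exp (2 * \<i> * of_real pi * of_int (tsign (Y_tri n) t') * of_real (x (face (Y_tri n) t' 0)) * of_real (t t')) *
        delta_reg (\<sigma>\<^sup>2) (x (face (Y_tri n) t' 0) - x (face (Y_tri n) t' 1) + x (face (Y_tri n) t' 2)) *
        delta_reg (\<sigma>\<^sup>2) (x (face (Y_tri n) t' 2) - x (face (Y_tri n) t' 3) + t t')" for t'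
  define E where "E y = exp (2 * \<i> * of_real pi * complex_of_real y)" for y
  have E_add: "E (y + z) = E y * E z" for y z by (simp add: E_def distrib_left exp_add)
  have E_sum: "E (\<Sum>k\<in>A. g k) = (\<Prod>k\<in>A. E (g k))" if "finite A" for A and g :: "nat \<Rightarrow> real"
    using that by (induction A rule: finite_induct) (simp_all add: E_add, simp add: E_def)
  note S = tets_simps delta_reg_dl[OF \<sigma>]
  have FT: "F (T k) = E (x (Fe k) * t (T k)) *
      of_real (dl \<sigma> (x (Fe k) - x (Fe (k + 1)) + x (face_f k)) * dl \<sigma> (x (face_f k) - x (face_f (k - 1)) + t (T k)))" for k
    by (simp add: F_def S E_def mult_ac)
  have FU: "F U = E (x Fr * t U) * of_real (dl \<sigma> (x Fr - x Fv + x Fs') * dl \<sigma> (x Fs' - x Fg + t U))"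
    by (simp add: F_def S E_def mult_ac)
  have FV: "F V = E (- (x Fs * t V)) * of_real (dl \<sigma> (x Fs - x Fg + x (face_f ?p)) * dl \<sigma> (x (face_f ?p) - x Fu + t V))"
    by (simp add: F_def S E_def mult_ac)
  have FW: "F W = E (- (x Fu * t W)) * of_real (dl \<sigma> (x Fu - x Fv + x Fr) * dl \<sigma> (x Fr - x (Fe (?p + 1)) + t W))"
    by (simp add: F_def S E_def mult_ac)
  have FZ: "F Z = E (t Z * x Fm) * of_real (dl \<sigma> (x Fs) * dl \<sigma> (x Fs - x Fs' + t Z))"
    by (simp add: F_def S E_def mult_ac)
  have "(\<Prod>t'\<in>tets (Y_tri n). F t') = (\<Prod>k=1..?p. F (T k)) * (F U * F V * F W * F Z)"
    unfolding tets_simps by (subst prod.union_disjoint) (auto simp: prod.reindex inj_on_def mult_ac)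
  also have "\<dots> = E (t Z * x Fm) * (E ((\<Sum>k=1..?p. x (Fe k) * t (T k)) + x Fr * t U + - (x Fs * t V) + - (x Fu * t W)) *
      of_real (delta_factors ?p \<sigma> x t))"
    unfolding FT FU FV FW FZ delta_factors_def prod.distrib E_add of_real_mult of_real_prod
    by (simp add: E_sum mult_ac)
  also have "(\<Sum>k=1..?p. x (Fe k) * t (T k)) + x Fr * t U + - (x Fs * t V) + - (x Fu * t W) = phase ?p x t"
    by (simp add: phase_def)
  finally have 1: "(\<Prod>t'\<in>tets (Y_tri n). F t') = E (t Z * x Fm) * (E (phase ?p x t) * of_real (delta_factors ?p \<sigma> x t))" .
  have 2: "(\<Prod>f\<in>faces (Y_tri n). exp (- of_real pi * of_real (\<sigma>\<^sup>2) * (of_real (x f))\<^sup>2)) =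
      complex_of_real (gauss (\<sigma> * x Fm)) * of_real (\<Prod>f\<in>other_faces ?p. gauss (\<sigma> * x f))"
    unfolding faces_Y gauss_scaled_of_real by simp
  show ?thesis
    unfolding F_def[symmetric] 1 2 kernel_integrand_def by (simp add: E_def mult_ac)
qed

lemma delta_factors_bounds:
  assumes \<sigma>: "\<sigma> > 0"
  shows "0 \<le> delta_factors p \<sigma> x t" "delta_factors p \<sigma> x t \<le> (1 / \<sigma>) ^ (2 * p + 8)"
proof -
  have d: "0 \<le> dl \<sigma> y \<and> dl \<sigma> y \<le> 1 / \<sigma>" for y using dl_bounds[OF \<sigma>] by auto
  have s: "0 \<le> 1 / \<sigma>" using \<sigma> by simp
  have "0 \<le> (\<Prod>k=1..p. dl \<sigma> (x (Fe k) - x (Fe (k + 1)) + x (face_f k)) * dl \<sigma> (x (face_f k) - x (face_f (k - 1)) + t (T k)))"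
    (is "0 \<le> ?P") using d by (intro prod_nonneg mult_nonneg_nonneg) auto
  moreover have "?P \<le> (\<Prod>k=1..p. (1 / \<sigma>) * (1 / \<sigma>))"
    using d s by (intro prod_mono conjI mult_nonneg_nonneg mult_mono) auto
  then have "?P \<le> ((1 / \<sigma>) * (1 / \<sigma>)) ^ p" by simp
  ultimately have "0 \<le> delta_factors p \<sigma> x t \<and> delta_factors p \<sigma> x t \<le>
      ((1 / \<sigma>) * (1 / \<sigma>)) ^ p * ((1 / \<sigma>) * (1 / \<sigma>)) * ((1 / \<sigma>) * (1 / \<sigma>)) * ((1 / \<sigma>) * (1 / \<sigma>)) * ((1 / \<sigma>) * (1 / \<sigma>))"
    unfolding delta_factors_def using d s
    by (intro conjI mult_mono mult_nonneg_nonneg zero_le_power) auto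
  moreover have "((1 / \<sigma>) * (1 / \<sigma>)) ^ p * ((1 / \<sigma>) * (1 / \<sigma>)) * ((1 / \<sigma>) * (1 / \<sigma>)) * ((1 / \<sigma>) * (1 / \<sigma>)) * ((1 / \<sigma>) * (1 / \<sigma>))
      = (1 / \<sigma>) ^ (2 * p + 8)"
    by (simp add: power_add mult_2 power_mult_distrib numeral_eq_Suc mult_ac del: power_one_over power_divide times_divide_eq_left times_divide_eq_right)
  ultimately show "0 \<le> delta_factors p \<sigma> x t" "delta_factors p \<sigma> x t \<le> (1 / \<sigma>) ^ (2 * p + 8)" by auto
qed

lemma borel_delta_factors:
  assumes x: "\<And>f. f \<in> other_faces p \<Longrightarrow> (\<lambda>w. x w f) \<in> borel_measurable N"
    and t: "\<And>k. k \<in> T ` {1..p} \<union> {U, V, W, Z} \<Longrightarrow> (\<lambda>w. t w k) \<in> borel_measurable N"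
  shows "(\<lambda>w. delta_factors p \<sigma> (x w) (t w)) \<in> borel_measurable N"
  unfolding delta_factors_def
  by (intro borel_measurable_times borel_measurable_prod measurable_compose[OF _ dl_measurable]
      borel_measurable_add borel_measurable_diff x t) auto

lemma borel_phase:
  assumes x: "\<And>f. f \<in> other_faces p \<Longrightarrow> (\<lambda>w. x w f) \<in> borel_measurable N"
    and t: "\<And>k. k \<in> T ` {1..p} \<union> {U, V, W, Z} \<Longrightarrow> (\<lambda>w. t w k) \<in> borel_measurable N"
  shows "(\<lambda>w. phase p (x w) (t w)) \<in> borel_measurable N"
  unfolding phase_def
  by (intro borel_measurable_times borel_measurable_sum borel_measurable_add borel_measurable_diff x t) auto

lemma borel_complex_of_real: "g \<in> borel_measurable N \<Longrightarrow> (\<lambda>w. complex_of_real (g w)) \<in> borel_measurable N"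
  by simp

lemma borel_e:
  assumes [measurable]: "g \<in> borel_measurable N"
  shows "(\<lambda>w. exp (2 * \<i> * of_real pi * complex_of_real (g w))) \<in> borel_measurable N"
  by measurable

lemma borel_gauss_prod:
  assumes "\<And>f. f \<in> I \<Longrightarrow> (\<lambda>w. x w f) \<in> borel_measurable N"
  shows "(\<lambda>w. \<Prod>f\<in>I. gauss (c * x w f)) \<in> borel_measurable N"
  by (intro borel_measurable_prod measurable_compose[OF _ gauss_measurable] borel_measurable_times assms) auto

lemma borel_kernel_integrand:
  assumes x: "\<And>f. f \<in> other_faces p \<Longrightarrow> (\<lambda>w. x w f) \<in> borel_measurable N"
    and t: "\<And>k. k \<in> T ` {1..p} \<union> {U, V, W, Z} \<Longrightarrow> (\<lambda>w. t w k) \<in> borel_measurable N"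
  shows "(\<lambda>w. kernel_integrand p \<sigma> (x w) (t w)) \<in> borel_measurable N"
  unfolding kernel_integrand_def
  by (rule borel_measurable_times[OF borel_complex_of_real[OF borel_measurable_times[OF
      borel_gauss_prod[OF x] borel_delta_factors[OF x t]]] borel_e[OF borel_phase[OF x t]]])

lemma kernel_integrand_cong:
  assumes "\<And>f. f \<in> other_faces p \<Longrightarrow> x f = x' f"
  shows "kernel_integrand p \<sigma> x t = kernel_integrand p \<sigma> x' t"
proof -
  have ff: "x (face_f k) = x' (face_f k)" if "k \<le> p" for k using assms that by simp
  have "delta_factors p \<sigma> x t = delta_factors p \<sigma> x' t"
    unfolding delta_factors_def using assms ff
    by (intro arg_cong2[where f = "(*)"] prod.cong refl) (auto intro!: arg_cong2[where f = "dl"])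
  moreover have "phase p x t = phase p x' t"
    unfolding phase_def using assms
    by (intro arg_cong2[where f = "(+)"] arg_cong2[where f = "(-)"] arg_cong2[where f = "(*)"] sum.cong refl) auto
  moreover have "(\<Prod>f\<in>other_faces p. gauss (\<sigma> * x f)) = (\<Prod>f\<in>other_faces p. gauss (\<sigma> * x' f))"
    using assms by (intro prod.cong) auto
  ultimately show ?thesis by (simp add: kernel_integrand_def)
qed

lemma cmod_e: "cmod (exp (2 * \<i> * of_real pi * complex_of_real y)) = 1"
  by simp

lemma integrable_gauss_prod:
  assumes "finite I" "c \<noteq> 0"
  shows "integrable (Leb I) (\<lambda>x. \<Prod>f\<in>I. gauss (c * x f))"
proof (rule integrable_prod_Leb[OF assms(1)])
  show "integrable lborel (\<lambda>y. gauss (c * y))"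
    using lborel_integrable_real_affine[OF integrable_gauss assms(2), of 0] by simp
qed

text \<open>
  The integral over \<open>m\<close>, which no delta contains, is itself a regularised delta, in \<open>t\<^sub>Z\<close>.
\<close>

lemma kernel_reg_eq:
  assumes \<sigma>: "\<sigma> > 0"
  shows "kinematical_kernel_reg (Y_tri n) (\<sigma>\<^sup>2) t =
     of_real (dl \<sigma> (t Z)) * (LINT x|Leb (other_faces (twist_p n)). kernel_integrand (twist_p n) \<sigma> x t)"
proof -
  let ?p = "twist_p n" and ?O = "other_faces (twist_p n)"
  let ?g = "\<lambda>y. exp (2 * \<i> * of_real pi * of_real (t Z) * of_real y) * complex_of_real (gauss (\<sigma> * y))"
  have meas: "(\<lambda>x. kernel_integrand ?p \<sigma> x t) \<in> borel_measurable (Leb (insert Fm ?O))"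
    by (rule borel_kernel_integrand) (auto intro!: Leb_component)
  have gm: "?g \<in> borel_measurable borel" by measurable
  have int: "integrable (Leb (insert Fm ?O)) (\<lambda>x. ?g (x Fm) * kernel_integrand ?p \<sigma> x t)"
  proof (rule Bochner_Integration.integrable_bound)
    show "integrable (Leb (insert Fm ?O)) (\<lambda>x. (\<Prod>f\<in>insert Fm ?O. gauss (\<sigma> * x f)) * (1 / \<sigma>) ^ (2 * ?p + 8))"
      using \<sigma> by (intro integrable_mult_left integrable_gauss_prod) auto
    show "(\<lambda>x. ?g (x Fm) * kernel_integrand ?p \<sigma> x t) \<in> borel_measurable (Leb (insert Fm ?O))"
      by (intro borel_measurable_times meas measurable_compose[OF Leb_component gm]) auto
    show "AE x in Leb (insert Fm ?O). cmod (?g (x Fm) * kernel_integrand ?p \<sigma> x t) \<le>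
        norm ((\<Prod>f\<in>insert Fm ?O. gauss (\<sigma> * x f)) * (1 / \<sigma>) ^ (2 * ?p + 8))"
    proof (rule AE_I2)
      fix x :: "twist_face \<Rightarrow> real"
      have "cmod (?g (x Fm) * kernel_integrand ?p \<sigma> x t) =
          (\<Prod>f\<in>insert Fm ?O. gauss (\<sigma> * x f)) * delta_factors ?p \<sigma> x t"
        using delta_factors_bounds(1)[OF \<sigma>, of ?p x t]
        by (simp add: kernel_integrand_def norm_mult cmod_e gauss_nonneg prod_nonneg abs_mult abs_prod
            del: of_real_prod of_real_mult)
      also have "\<dots> \<le> (\<Prod>f\<in>insert Fm ?O. gauss (\<sigma> * x f)) * (1 / \<sigma>) ^ (2 * ?p + 8)"
        using delta_factors_bounds(2)[OF \<sigma>, of ?p x t]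
        by (intro mult_left_mono prod_nonneg gauss_nonneg)
      finally show "cmod (?g (x Fm) * kernel_integrand ?p \<sigma> x t) \<le>
          norm ((\<Prod>f\<in>insert Fm ?O. gauss (\<sigma> * x f)) * (1 / \<sigma>) ^ (2 * ?p + 8))"
        by (rule order_trans) (simp only: real_norm_def abs_ge_self)
    qed
  qed
  have "kinematical_kernel_reg (Y_tri n) (\<sigma>\<^sup>2) t =
      (LINT x|Leb (insert Fm ?O). ?g (x Fm) * kernel_integrand ?p \<sigma> x t)"
    unfolding kinematical_kernel_reg_def regularised_integrand_eq[OF \<sigma>]
    unfolding faces_Y ..
  also have "\<dots> = (LINT y|lborel. ?g y) * (LINT x|Leb ?O. kernel_integrand ?p \<sigma> x t)"
    by (rule integral_insert_separated[OF _ _ int]) (auto intro!: kernel_integrand_cong)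
  also have "(LINT y|lborel. ?g y) = delta_reg (\<sigma>\<^sup>2) (- t Z)"
    unfolding delta_reg_def gauss_scaled_of_real by (simp add: mult_ac)
  also have "\<dots> = of_real (dl \<sigma> (t Z))"
    using \<sigma> by (simp add: delta_reg_dl dl_def gauss_minus)
  finally show ?thesis .
qed

lemma borel_face_sol:
  assumes x: "\<And>f. f \<in> other_faces p \<Longrightarrow> (\<lambda>w. v w f) \<in> borel_measurable N"
    and t: "\<And>k. k \<in> T ` {1..p} \<union> {U, V, W, Z} \<Longrightarrow> (\<lambda>w. t w k) \<in> borel_measurable N"
    and f: "f \<in> other_faces p"
  shows "(\<lambda>w. face_sol p \<sigma> (t w) (v w) f) \<in> borel_measurable N"
proof -
  have fs: "(\<lambda>w. f_sol p \<sigma> (t w) (v w) k) \<in> borel_measurable N" for k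
    unfolding f_sol_def
    by (intro borel_measurable_times borel_measurable_sum borel_measurable_add x t) auto
  have es: "(\<lambda>w. e_sol p \<sigma> (t w) (v w) k) \<in> borel_measurable N" if "k \<le> p + 1" for k
    unfolding e_sol_def using that
    by (intro borel_measurable_times borel_measurable_sum borel_measurable_add fs x) auto
  show ?thesis
    using f
    by (cases f)
       (auto intro!: fs es borel_measurable_add borel_measurable_diff borel_measurable_times x t)
qed

text \<open>
  What is left of the integrand in the variables \<open>v\<close>: the Jacobian \<open>\<sigma>\<close> of each face cancels the factor
  \<open>1 / \<sigma>\<close> of the delta that resolves it.
\<close>

definition subst_integrand :: "nat \<Rightarrow> real \<Rightarrow> (twist_tet \<Rightarrow> real) \<Rightarrow> (twist_face \<Rightarrow> real) \<Rightarrow> complex" where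
  "subst_integrand p \<sigma> t v =
     of_real ((\<Prod>f\<in>other_faces p. gauss (v f)) * (\<Prod>f\<in>other_faces p. gauss (\<sigma> * face_sol p \<sigma> t v f))) *
     exp (2 * \<i> * of_real pi * of_real (phase p (face_sol p \<sigma> t v) t))"

lemma integral_kernel_integrand:
  assumes \<sigma>: "\<sigma> > 0"
  shows "(LINT x|Leb (other_faces p). kernel_integrand p \<sigma> x t) =
         (LINT v|Leb (other_faces p). of_real (dl \<sigma> (t U + t V + \<sigma> * defect p v)) * subst_integrand p \<sigma> t v)"
proof -
  let ?O = "other_faces p"
  have "(LINT x|Leb ?O. kernel_integrand p \<sigma> x t) =
      of_real (\<Prod>f\<in>?O. \<bar>\<sigma>\<bar>) * (LINT v|Leb ?O. kernel_integrand p \<sigma> (\<lambda>f\<in>?O. face_sol p \<sigma> t v f) t)"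
  proof (rule integral_triangular_affine[where rank = "face_rank p"])
    show "(\<lambda>v. face_sol p \<sigma> t v f) \<in> borel_measurable (Leb ?O)" if "f \<in> ?O" for f
      using that by (intro borel_face_sol) (auto intro!: Leb_component)
    show "(\<lambda>x. kernel_integrand p \<sigma> x t) \<in> borel_measurable (Leb ?O)"
      by (rule borel_kernel_integrand) (auto intro!: Leb_component)
    show "face_sol p \<sigma> t (v(i := y)) j - \<sigma> * (v(i := y)) j = face_sol p \<sigma> t v j - \<sigma> * v j"
      if "i \<in> ?O" "j \<in> ?O" "face_rank p j \<le> face_rank p i" for i j v y
      by (rule face_sol_triangular[OF that(2)]) (use that(3) in auto)
  qed (use \<sigma> in auto)
  also have "\<dots> = (LINT v|Leb ?O. of_real (\<Prod>f\<in>?O. \<bar>\<sigma>\<bar>) * kernel_integrand p \<sigma> (\<lambda>f\<in>?O. face_sol p \<sigma> t v f) t)"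
    by simp
  also have "(\<lambda>v. of_real (\<Prod>f\<in>?O. \<bar>\<sigma>\<bar>) * kernel_integrand p \<sigma> (\<lambda>f\<in>?O. face_sol p \<sigma> t v f) t) =
      (\<lambda>v. of_real (dl \<sigma> (t U + t V + \<sigma> * defect p v)) * subst_integrand p \<sigma> t v)"
  proof
    fix v
    have "kernel_integrand p \<sigma> (\<lambda>f\<in>?O. face_sol p \<sigma> t v f) t = kernel_integrand p \<sigma> (face_sol p \<sigma> t v) t"
      by (rule kernel_integrand_cong) auto
    moreover have PQ: "(\<Prod>f\<in>?O. gauss (v f)) = (\<Prod>f\<in>?O. \<bar>\<sigma>\<bar>) * (\<Prod>f\<in>?O. gauss (v f) / \<sigma>)"
      unfolding prod.distrib[symmetric] using \<sigma> by (intro prod.cong) auto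
    ultimately show "of_real (\<Prod>f\<in>?O. \<bar>\<sigma>\<bar>) * kernel_integrand p \<sigma> (\<lambda>f\<in>?O. face_sol p \<sigma> t v f) t =
        of_real (dl \<sigma> (t U + t V + \<sigma> * defect p v)) * subst_integrand p \<sigma> t v"
      unfolding kernel_integrand_def delta_factors_face_sol[OF \<sigma>] subst_integrand_def PQ
      by (simp only: of_real_mult mult_ac)
  qed
  finally show ?thesis .
qed

text \<open>
  The same change of scale for the two remaining deltas, which resolve \<open>t\<^sub>V\<close> and \<open>t\<^sub>Z\<close>.
\<close>

definition tet_subst :: "nat \<Rightarrow> real \<Rightarrow> (twist_face \<Rightarrow> real) \<Rightarrow> (twist_tet \<Rightarrow> real) \<Rightarrow> twist_tet \<Rightarrow> real" where
  "tet_subst p \<sigma> v t = t(V := - t U - \<sigma> * defect p v + \<sigma> * t V, Z := \<sigma> * t Z)"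

lemma tet_subst_simps [simp]:
  "tet_subst p \<sigma> v t V = - t U - \<sigma> * defect p v + \<sigma> * t V"
  "tet_subst p \<sigma> v t Z = \<sigma> * t Z" "tet_subst p \<sigma> v t U = t U" "tet_subst p \<sigma> v t W = t W"
  "tet_subst p \<sigma> v t (T k) = t (T k)"
  by (simp_all add: tet_subst_def)

text \<open>
  The quadratic form of \<open>Q\<^sub>n\<close>, written as it comes from the kernel: the sum of \<open>x\<^sub>0(T) t\<^sub>T\<close> over \<open>T\<^sub>1, \<dots>, T\<^sub>p\<close>
  and \<open>U\<close>. The terms of \<open>V\<close> and \<open>W\<close> vanish, because \<open>s = u = 0\<close> in the limit.
\<close>

definition Q_form :: "nat \<Rightarrow> (twist_tet \<Rightarrow> real) \<Rightarrow> real" where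
  "Q_form p t = (\<Sum>k=1..p. (real k * t U + (\<Sum>j=1..p. real (min j k) * t (T j))) * t (T k)) +
     ((real p + 1) * t U + (\<Sum>j=1..p. real j * t (T j)) - t W) * t U"

lemma sum_nested_min:
  fixes a :: "nat \<Rightarrow> real"
  assumes "k \<le> p + 1"
  shows "(\<Sum>i<k. \<Sum>j=i+1..p. a j) = (\<Sum>j=1..p. real (min j k) * a j)"
proof -
  have "(\<Sum>i<k. \<Sum>j=i+1..p. a j) = (\<Sum>i<k. \<Sum>j=1..p. if i < j then a j else 0)"
    by (intro sum.cong refl sum.mono_neutral_cong_left) auto
  also have "\<dots> = (\<Sum>j=1..p. \<Sum>i<k. if i < j then a j else 0)"
    by (rule sum.swap)
  also have "\<dots> = (\<Sum>j=1..p. real (min j k) * a j)"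
  proof (intro sum.cong refl)
    fix j
    have "(\<Sum>i<k. if i < j then a j else 0) = (\<Sum>i\<in>{..<k} \<inter> {i. i < j}. a j)"
      by (subst sum.inter_restrict) auto
    also have "{..<k} \<inter> {i. i < j} = {..<min j k}" by auto
    finally show "(\<Sum>i<k. if i < j then a j else 0) = real (min j k) * a j" by simp
  qed
  finally show ?thesis .
qed

lemma phase_on_support: "phase p (face_sol p 0 (tet_subst p 0 v t) v) (tet_subst p 0 v t) = Q_form p t"
proof -
  have e: "e_sol p 0 (tet_subst p 0 v t) v k = real k * t U + (\<Sum>j=1..p. real (min j k) * t (T j))" if "k \<le> p + 1" for k
    using sum_nested_min[OF that, of "\<lambda>j. t (T j)"] by (simp add: e_sol_def f_sol_def sum.distrib)
  have "(\<Sum>j=1..p. real (min j (p + 1)) * t (T j)) = (\<Sum>j=1..p. real j * t (T j))"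
    by (intro sum.cong) auto
  then have "e_sol p 0 (tet_subst p 0 v t) v (p + 1) = (real p + 1) * t U + (\<Sum>j=1..p. real j * t (T j))"
    by (simp add: e)
  then show ?thesis by (simp add: phase_def Q_form_def e)
qed

lemma tendsto_face_sol:
  assumes s: "(s \<longlongrightarrow> \<sigma>) F" and t: "\<And>k. ((\<lambda>w. t w k) \<longlongrightarrow> t0 k) F"
  shows "((\<lambda>w. face_sol p (s w) (t w) v f) \<longlongrightarrow> face_sol p \<sigma> t0 v f) F"
proof -
  have fs: "((\<lambda>w. f_sol p (s w) (t w) v k) \<longlongrightarrow> f_sol p \<sigma> t0 v k) F" for k
    unfolding f_sol_def by (intro tendsto_intros s t)
  have es: "((\<lambda>w. e_sol p (s w) (t w) v k) \<longlongrightarrow> e_sol p \<sigma> t0 v k) F" for k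
    unfolding e_sol_def by (intro tendsto_intros s fs)
  show ?thesis
    by (cases f) (auto intro!: tendsto_intros fs es s t)
qed

lemma tendsto_phase:
  assumes x: "\<And>f. ((\<lambda>w. x w f) \<longlongrightarrow> x0 f) F" and t: "\<And>k. ((\<lambda>w. t w k) \<longlongrightarrow> t0 k) F"
  shows "((\<lambda>w. phase p (x w) (t w)) \<longlongrightarrow> phase p x0 t0) F"
  unfolding phase_def by (intro tendsto_intros x t)

text \<open>
  The factors of the dynamical content enter the evaluation of the kernel only through their continuity
  and their decay.
\<close>

locale decaying_content =
  fixes n :: nat and d :: "twist_tet \<Rightarrow> real \<Rightarrow> complex" and C \<kappa> :: real
  assumes cont: "\<And>t. t \<in> tets (Y_tri n) \<Longrightarrow> continuous_on UNIV (d t)"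
    and bound: "\<And>t y. t \<in> tets (Y_tri n) \<Longrightarrow> cmod (d t y) \<le> C * exp (- \<kappa> * \<bar>y\<bar>)"
    and C: "C > 0" and \<kappa>: "\<kappa> > 0"
begin

abbreviation "p \<equiv> twist_p n"
abbreviation "TS \<equiv> tets (Y_tri n)"
abbreviation "FS \<equiv> other_faces p"

lemma finite_TS [simp]: "finite TS" by (simp add: tets_simps)

lemma TS_members: "k \<in> T ` {1..p} \<union> {U, V, W, Z} \<longleftrightarrow> k \<in> TS"
  by (simp add: tets_simps)

definition content :: "(twist_tet \<Rightarrow> real) \<Rightarrow> complex" where
  "content t = (\<Prod>k\<in>TS. d k (t k))"

lemma d_measurable: "k \<in> TS \<Longrightarrow> d k \<in> borel_measurable borel"
  by (intro borel_measurable_continuous_onI cont)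

lemma borel_content:
  assumes "\<And>k. k \<in> TS \<Longrightarrow> (\<lambda>w. t w k) \<in> borel_measurable N"
  shows "(\<lambda>w. content (t w)) \<in> borel_measurable N"
  unfolding content_def
  by (intro borel_measurable_prod measurable_compose[OF assms d_measurable])

lemma cmod_content_le: "cmod (content t) \<le> (\<Prod>k\<in>TS. C * exp (- \<kappa> * \<bar>t k\<bar>))"
  unfolding content_def prod_norm[symmetric] by (intro prod_mono conjI norm_ge_zero bound)

lemma sf: "sigma_finite_measure (Leb FS)" "sigma_finite_measure (Leb TS)"
  by (auto intro: sigma_finite_Leb)

lemma fst_comp: "f \<in> FS \<Longrightarrow> (\<lambda>w. fst w f) \<in> borel_measurable (Leb FS \<Otimes>\<^sub>M Leb TS)"
  by (rule measurable_compose[OF measurable_fst Leb_component])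

lemma snd_comp: "k \<in> TS \<Longrightarrow> (\<lambda>w. snd w k) \<in> borel_measurable (Leb FS \<Otimes>\<^sub>M Leb TS)"
  by (rule measurable_compose[OF measurable_snd Leb_component])

lemma borel_subst_integrand:
  assumes x: "\<And>f. f \<in> FS \<Longrightarrow> (\<lambda>w. v w f) \<in> borel_measurable N"
    and t: "\<And>k. k \<in> TS \<Longrightarrow> (\<lambda>w. t w k) \<in> borel_measurable N"
  shows "(\<lambda>w. subst_integrand p \<sigma> (t w) (v w)) \<in> borel_measurable N"
proof -
  have t': "(\<lambda>w. t w k) \<in> borel_measurable N" if "k \<in> T ` {1..p} \<union> {U, V, W, Z}" for k
    using t that by (simp only: TS_members)
  have g: "(\<lambda>w. \<Prod>f\<in>FS. gauss (v w f)) \<in> borel_measurable N"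
    using borel_gauss_prod[of FS v N 1] x by simp
  show ?thesis
    unfolding subst_integrand_def
    by (rule borel_measurable_times[OF borel_complex_of_real[OF borel_measurable_times[OF g
        borel_gauss_prod[OF borel_face_sol[OF x t']]]] borel_e[OF borel_phase[OF borel_face_sol[OF x t'] t']]])
qed

lemma borel_defect:
  assumes x: "\<And>f. f \<in> FS \<Longrightarrow> (\<lambda>w. v w f) \<in> borel_measurable N"
  shows "(\<lambda>w. defect p (v w)) \<in> borel_measurable N"
  unfolding defect_def by (intro borel_measurable_add borel_measurable_diff x) auto

lemma cmod_subst_integrand: "cmod (subst_integrand p \<sigma> t v) \<le> (\<Prod>f\<in>FS. gauss (v f))"
proof -
  have "cmod (subst_integrand p \<sigma> t v) = (\<Prod>f\<in>FS. gauss (v f)) * (\<Prod>f\<in>FS. gauss (\<sigma> * face_sol p \<sigma> t v f))"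
    unfolding subst_integrand_def norm_mult cmod_e norm_of_real
    by (simp add: gauss_nonneg prod_nonneg abs_mult abs_prod)
  also have "\<dots> \<le> (\<Prod>f\<in>FS. gauss (v f)) * 1"
    by (intro mult_left_mono prod_nonneg prod_le_1) (auto simp: gauss_nonneg gauss_le_1)
  finally show ?thesis by simp
qed

definition limit_integrand :: "real \<Rightarrow> (twist_face \<Rightarrow> real) \<Rightarrow> (twist_tet \<Rightarrow> real) \<Rightarrow> complex" where
  "limit_integrand \<sigma> v t = of_real (gauss (t Z)) * of_real (gauss (t V)) *
     subst_integrand p \<sigma> (tet_subst p \<sigma> v t) v * content (tet_subst p \<sigma> v t)"

lemma borel_tet_subst:
  assumes x: "\<And>f. f \<in> FS \<Longrightarrow> (\<lambda>w. v w f) \<in> borel_measurable N"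
    and t: "\<And>k. k \<in> TS \<Longrightarrow> (\<lambda>w. t w k) \<in> borel_measurable N" and k: "k \<in> TS"
  shows "(\<lambda>w. tet_subst p \<sigma> (v w) (t w) k) \<in> borel_measurable N"
  using k t by (cases k) (auto simp: tets_simps intro!: borel_measurable_add borel_measurable_diff borel_measurable_times borel_defect x)

lemma borel_limit_integrand:
  assumes x: "\<And>f. f \<in> FS \<Longrightarrow> (\<lambda>w. v w f) \<in> borel_measurable N"
    and t: "\<And>k. k \<in> TS \<Longrightarrow> (\<lambda>w. t w k) \<in> borel_measurable N"
  shows "(\<lambda>w. limit_integrand \<sigma> (v w) (t w)) \<in> borel_measurable N"
proof -
  have g: "(\<lambda>w. complex_of_real (gauss (t w k))) \<in> borel_measurable N" if "k \<in> TS" for k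
    by (intro borel_complex_of_real measurable_compose[OF t[OF that] gauss_measurable])
  show ?thesis
    unfolding limit_integrand_def
    by (intro borel_measurable_times g borel_subst_integrand borel_content borel_tet_subst x t)
       (auto simp: tets_simps)
qed

text \<open>
  Gaussian decay in all resolved variables, exponential decay in the free ones. The factors of \<open>V\<close> and \<open>Z\<close>
  are only bounded, since their arguments are moved by the substitution; no uniformity in \<open>\<sigma>\<close> is lost
  because the arguments of the other factors stay where they are.
\<close>

definition majorant :: "(twist_face \<Rightarrow> real) \<Rightarrow> (twist_tet \<Rightarrow> real) \<Rightarrow> real" where
  "majorant v t = (\<Prod>f\<in>FS. gauss (v f)) *
     (\<Prod>k\<in>TS. if k \<in> {V, Z} then gauss (t k) * C else C * exp (- \<kappa> * \<bar>t k\<bar>))"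

lemma cmod_limit_integrand: "cmod (limit_integrand \<sigma> v t) \<le> majorant v t"
proof -
  let ?t = "tet_subst p \<sigma> v t"
  have "cmod (content ?t) \<le> (\<Prod>k\<in>TS. if k \<in> {V, Z} then C else C * exp (- \<kappa> * \<bar>t k\<bar>))"
    unfolding content_def prod_norm[symmetric]
  proof (intro prod_mono conjI norm_ge_zero)
    fix k assume k: "k \<in> TS"
    have "C * exp (- \<kappa> * \<bar>?t k\<bar>) \<le> C * 1"
      using C \<kappa> by (intro mult_left_mono) auto
    then show "cmod (d k (?t k)) \<le> (if k \<in> {V, Z} then C else C * exp (- \<kappa> * \<bar>t k\<bar>))"
      using bound[OF k, of "?t k"] by (cases k) auto
  qed
  moreover have "(\<Prod>k\<in>TS. if k \<in> {V, Z} then gauss (t k) * C else C * exp (- \<kappa> * \<bar>t k\<bar>)) =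
      gauss (t Z) * gauss (t V) * (\<Prod>k\<in>TS. if k \<in> {V, Z} then C else C * exp (- \<kappa> * \<bar>t k\<bar>))"
  proof -
    have "(\<Prod>k\<in>J_index n. if k \<in> {V, Z} then gauss (t k) * C else C * exp (- \<kappa> * \<bar>t k\<bar>)) =
        (\<Prod>k\<in>J_index n. if k \<in> {V, Z} then C else C * exp (- \<kappa> * \<bar>t k\<bar>))"
      by (intro prod.cong) (auto simp: J_index_def)
    then show ?thesis by (simp add: tets_Y_insert mult_ac)
  qed
  moreover have "cmod (limit_integrand \<sigma> v t) =
      gauss (t Z) * gauss (t V) * cmod (subst_integrand p \<sigma> ?t v) * cmod (content ?t)"
    unfolding limit_integrand_def norm_mult norm_of_real by (simp add: gauss_nonneg)
  moreover have "gauss (t Z) * gauss (t V) * cmod (subst_integrand p \<sigma> ?t v) * cmod (content ?t) \<le>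
      gauss (t Z) * gauss (t V) * (\<Prod>f\<in>FS. gauss (v f)) * (\<Prod>k\<in>TS. if k \<in> {V, Z} then C else C * exp (- \<kappa> * \<bar>t k\<bar>))"
    if "cmod (content ?t) \<le> (\<Prod>k\<in>TS. if k \<in> {V, Z} then C else C * exp (- \<kappa> * \<bar>t k\<bar>))"
    using that by (intro mult_mono cmod_subst_integrand mult_nonneg_nonneg prod_nonneg) (auto simp: gauss_nonneg)
  ultimately show ?thesis
    unfolding majorant_def by (simp only: mult_ac)
qed

lemma integrable_majorant: "integrable (Leb FS \<Otimes>\<^sub>M Leb TS) (\<lambda>w. majorant (fst w) (snd w))"
  unfolding majorant_def
proof (rule integrable_pair_times[OF sf])
  show "integrable (Leb FS) (\<lambda>v. \<Prod>f\<in>FS. gauss (v f))"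
    using integrable_gauss_prod[of FS 1] by simp
  have "integrable lborel (\<lambda>y. if k \<in> {V, Z} then gauss y * C else C * exp (- \<kappa> * \<bar>y\<bar>))" for k
    using integrable_gauss integrable_exp_abs[OF \<kappa>] by (cases "k \<in> {V, Z}") auto
  then show "integrable (Leb TS) (\<lambda>t. \<Prod>k\<in>TS. if k \<in> {V, Z} then gauss (t k) * C else C * exp (- \<kappa> * \<bar>t k\<bar>))"
    by (intro integrable_prod_Leb[where f = "\<lambda>k y. if k \<in> {V, Z} then gauss y * C else C * exp (- \<kappa> * \<bar>y\<bar>)"]) auto
qed

lemma integrable_limit_integrand:
  "integrable (Leb FS \<Otimes>\<^sub>M Leb TS) (\<lambda>w. limit_integrand \<sigma> (fst w) (snd w))"
  by (rule Bochner_Integration.integrable_bound[OF integrable_majorant])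
     (auto intro!: borel_limit_integrand fst_comp snd_comp AE_I2 order_trans[OF cmod_limit_integrand abs_ge_self])

lemma regularised_kernel_action:
  assumes \<sigma>: "\<sigma> > 0"
  shows "(LINT t|Leb TS. kinematical_kernel_reg (Y_tri n) (\<sigma>\<^sup>2) t * content t) =
         (LINT w|(Leb FS \<Otimes>\<^sub>M Leb TS). limit_integrand \<sigma> (fst w) (snd w))"
proof -
  interpret O: sigma_finite_measure "Leb FS" by (rule sf)
  interpret S: sigma_finite_measure "Leb TS" by (rule sf)
  interpret pair_sigma_finite "Leb FS" "Leb TS" ..
  define G where "G v t = of_real (dl \<sigma> (t Z)) * of_real (dl \<sigma> (t U + t V + \<sigma> * defect p v)) *
      subst_integrand p \<sigma> t v * content t" for v t
  have Gm: "(\<lambda>w. G (v w) (t w)) \<in> borel_measurable N"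
    if x: "\<And>f. f \<in> FS \<Longrightarrow> (\<lambda>w. v w f) \<in> borel_measurable N"
    and t: "\<And>k. k \<in> TS \<Longrightarrow> (\<lambda>w. t w k) \<in> borel_measurable N" for N :: "'x measure" and v t
    unfolding G_def
    by (intro borel_measurable_times borel_complex_of_real measurable_compose[OF _ dl_measurable]
          borel_measurable_add borel_subst_integrand borel_content borel_defect x t borel_measurable_const)
       (auto simp: tets_simps)
  have Gint: "integrable (Leb FS \<Otimes>\<^sub>M Leb TS) (\<lambda>w. G (fst w) (snd w))"
  proof (rule Bochner_Integration.integrable_bound)
    let ?h = "\<lambda>w. (1 / \<sigma> * (1 / \<sigma>)) * ((\<Prod>f\<in>FS. gauss (fst w f)) * (\<Prod>k\<in>TS. C * exp (- \<kappa> * \<bar>snd w k\<bar>)))"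
    have "integrable (Leb FS) (\<lambda>v. \<Prod>f\<in>FS. gauss (v f))"
      using integrable_gauss_prod[of FS 1] by simp
    moreover have "integrable (Leb TS) (\<lambda>t. \<Prod>k\<in>TS. C * exp (- \<kappa> * \<bar>t k\<bar>))"
      by (intro integrable_prod_Leb[where f = "\<lambda>k y. C * exp (- \<kappa> * \<bar>y\<bar>)"] integrable_mult_right integrable_exp_abs \<kappa> finite_TS)
    ultimately show "integrable (Leb FS \<Otimes>\<^sub>M Leb TS) ?h"
      by (intro integrable_mult_right integrable_pair_times sf)
    show "(\<lambda>w. G (fst w) (snd w)) \<in> borel_measurable (Leb FS \<Otimes>\<^sub>M Leb TS)"
      by (intro Gm fst_comp snd_comp)
    show "AE w in Leb FS \<Otimes>\<^sub>M Leb TS. cmod (G (fst w) (snd w)) \<le> norm (?h w)"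
    proof (rule AE_I2)
      fix w
      have "cmod (G (fst w) (snd w)) \<le> ?h w"
        unfolding G_def norm_mult norm_of_real abs_of_nonneg[OF dl_bounds(1)[OF \<sigma>]] mult.assoc[symmetric]
        using \<sigma> dl_bounds[OF \<sigma>]
        by (intro mult_mono cmod_subst_integrand cmod_content_le mult_nonneg_nonneg prod_nonneg)
             (auto simp: gauss_nonneg)
      then show "cmod (G (fst w) (snd w)) \<le> norm (?h w)" by (rule order_trans) (simp only: real_norm_def abs_ge_self)
    qed
  qed
  then have Gint': "integrable (Leb FS \<Otimes>\<^sub>M Leb TS) (\<lambda>(v, t). G v t)" by (simp add: split_def)
  have "(LINT t|Leb TS. kinematical_kernel_reg (Y_tri n) (\<sigma>\<^sup>2) t * content t) =
      (LINT t|Leb TS. LINT v|Leb FS. G v t)"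
  proof (rule Bochner_Integration.integral_cong[OF refl])
    fix t
    show "kinematical_kernel_reg (Y_tri n) (\<sigma>\<^sup>2) t * content t = (LINT v|Leb FS. G v t)"
      unfolding kernel_reg_eq[OF \<sigma>] integral_kernel_integrand[OF \<sigma>] G_def
      by (simp only: mult.assoc[of "complex_of_real (dl \<sigma> (t Z))"] integral_mult_left_zero integral_mult_right_zero)
  qed
  also have "\<dots> = (LINT v|Leb FS. LINT t|Leb TS. G v t)"
    by (rule Fubini_integral[OF Gint'])
  also have "\<dots> = (LINT v|Leb FS. LINT t|Leb TS. limit_integrand \<sigma> v t)"
  proof (rule Bochner_Integration.integral_cong[OF refl])
    fix v :: "twist_face \<Rightarrow> real"
    define c where "c k = (if k = V \<or> k = Z then \<sigma> else 1)" for k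
    have "(LINT t|Leb TS. G v t) = of_real (\<Prod>k\<in>TS. \<bar>c k\<bar>) *
        (LINT t|Leb TS. G v (\<lambda>k\<in>TS. tet_subst p \<sigma> v t k))"
    proof (rule integral_triangular_affine[where rank = "\<lambda>k. if k = V then 1 else 0"])
      show "(\<lambda>t. tet_subst p \<sigma> v t k) \<in> borel_measurable (Leb TS)" if "k \<in> TS" for k
        by (intro borel_tet_subst that borel_measurable_const Leb_component)
      show "(\<lambda>t. G v t) \<in> borel_measurable (Leb TS)"
        by (intro Gm borel_measurable_const Leb_component)
      show "tet_subst p \<sigma> v (t(i := y)) j - c j * (t(i := y)) j = tet_subst p \<sigma> v t j - c j * t j"
        if "(if j = V then 1 else 0) \<le> (if i = V then 1 else (0::nat))" for i j t y
        using that by (cases j) (auto simp: c_def split: if_splits)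
    qed (use \<sigma> in \<open>auto simp: c_def\<close>)
    also have "(\<Prod>k\<in>TS. \<bar>c k\<bar>) = \<sigma> * \<sigma>"
    proof -
      have "(\<Prod>k\<in>J_index n. \<bar>c k\<bar>) = 1" by (intro prod.neutral) (auto simp: c_def J_index_def)
      then show ?thesis using \<sigma> by (simp add: tets_Y_insert) (simp add: c_def)
    qed
    also have "of_real (\<sigma> * \<sigma>) * (LINT t|Leb TS. G v (\<lambda>k\<in>TS. tet_subst p \<sigma> v t k)) =
        (LINT t|Leb TS. of_real (\<sigma> * \<sigma>) * G v (\<lambda>k\<in>TS. tet_subst p \<sigma> v t k))"
      by simp
    also have "\<dots> = (LINT t|Leb TS. limit_integrand \<sigma> v t)"
    proof (rule Bochner_Integration.integral_cong[OF refl])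
      fix t assume t: "t \<in> space (Leb TS)"
      have "(\<lambda>k\<in>TS. tet_subst p \<sigma> v t k) = tet_subst p \<sigma> v t"
        using t by (intro ext) (auto simp: space_PiM PiE_def extensional_def tet_subst_def tets_simps)
      moreover have "dl \<sigma> (t U + (- t U - \<sigma> * defect p v + \<sigma> * t V) + \<sigma> * defect p v) = gauss (t V) / \<sigma>"
        using dl_scaled(1)[OF \<sigma>, of "t V"] by (simp add: algebra_simps)
      ultimately show "of_real (\<sigma> * \<sigma>) * G v (\<lambda>k\<in>TS. tet_subst p \<sigma> v t k) = limit_integrand \<sigma> v t"
        using \<sigma> by (simp add: G_def limit_integrand_def dl_scaled(1)[OF \<sigma>] field_simps)
    qed
    finally show "(LINT t|Leb TS. G v t) = (LINT t|Leb TS. limit_integrand \<sigma> v t)" .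
  qed
  also have "\<dots> = (LINT w|(Leb FS \<Otimes>\<^sub>M Leb TS). limit_integrand \<sigma> (fst w) (snd w))"
    using integral_fst'[OF integrable_limit_integrand[of \<sigma>]] by simp
  finally show ?thesis .
qed

lemma tendsto_limit_integrand:
  "((\<lambda>\<sigma>. limit_integrand \<sigma> v t) \<longlongrightarrow> limit_integrand 0 v t) (at 0 within S)"
proof -
  have s: "((\<lambda>\<sigma>. \<sigma>) \<longlongrightarrow> 0) (at (0::real) within S)" by (rule tendsto_ident_at)
  have ts: "((\<lambda>\<sigma>. tet_subst p \<sigma> v t k) \<longlongrightarrow> tet_subst p 0 v t k) (at 0 within S)" for k
    unfolding tet_subst_def by (auto simp: fun_upd_def intro!: tendsto_eq_intros)
  have fs: "((\<lambda>\<sigma>. face_sol p \<sigma> (tet_subst p \<sigma> v t) v f) \<longlongrightarrow> face_sol p 0 (tet_subst p 0 v t) v f) (at 0 within S)" for f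
    by (rule tendsto_face_sol[OF s ts])
  have g: "((\<lambda>\<sigma>. gauss (\<sigma> * face_sol p \<sigma> (tet_subst p \<sigma> v t) v f)) \<longlongrightarrow> gauss (0 * face_sol p 0 (tet_subst p 0 v t) v f)) (at 0 within S)" for f
    unfolding gauss_def by (intro tendsto_intros fs)
  have c: "((\<lambda>\<sigma>. content (tet_subst p \<sigma> v t)) \<longlongrightarrow> content (tet_subst p 0 v t)) (at 0 within S)"
    unfolding content_def
    by (intro tendsto_prod continuous_on_tendsto_compose[OF cont ts]) auto
  show ?thesis
    unfolding limit_integrand_def subst_integrand_def
    by (intro tendsto_intros c g tendsto_phase fs ts)
qed

lemma kernel_limit:
  "kinematical_kernel (Y_tri n) content = (LINT w|(Leb FS \<Otimes>\<^sub>M Leb TS). limit_integrand 0 (fst w) (snd w))"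
proof -
  let ?I = "\<lambda>\<sigma>. LINT w|(Leb FS \<Otimes>\<^sub>M Leb TS). limit_integrand \<sigma> (fst w) (snd w)"
  have lim: "(?I \<longlongrightarrow> ?I 0) (at_right 0)"
  proof (rule tendsto_integral_dominated[OF _ integrable_majorant])
    show "\<forall>\<^sub>F \<sigma> in at_right 0. \<forall>w\<in>space (Leb FS \<Otimes>\<^sub>M Leb TS). cmod (limit_integrand \<sigma> (fst w) (snd w)) \<le> majorant (fst w) (snd w)"
      using cmod_limit_integrand by simp
  qed (auto intro!: tendsto_limit_integrand borel_limit_integrand fst_comp snd_comp)
  \<comment> \<open>The kernel is a limit in \<open>\<epsilon> = \<sigma>\<^sup>2\<close>.\<close>
  have "filterlim sqrt (at_right 0) (at_right (0::real))"
    unfolding filterlim_at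
    by (auto simp: eventually_at_filter intro!: tendsto_eq_intros)
  with lim have "((\<lambda>\<epsilon>. ?I (sqrt \<epsilon>)) \<longlongrightarrow> ?I 0) (at_right 0)"
    by (rule filterlim_compose)
  moreover have "\<forall>\<^sub>F \<epsilon> in at_right 0. ?I (sqrt \<epsilon>) = (LINT t|Leb TS. kinematical_kernel_reg (Y_tri n) \<epsilon> t * content t)"
    using eventually_at_right_less[of 0]
  proof eventually_elim
    case (elim \<epsilon>)
    then show ?case using regularised_kernel_action[of "sqrt \<epsilon>"] by simp
  qed
  ultimately have "((\<lambda>\<epsilon>. LINT t|Leb TS. kinematical_kernel_reg (Y_tri n) \<epsilon> t * content t) \<longlongrightarrow> ?I 0) (at_right 0)"
    by (rule Lim_transform_eventually)
  then show ?thesis unfolding kinematical_kernel_def by (intro tendsto_Lim) auto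
qed

text \<open>
  At \<open>\<sigma> = 0\<close> the integrand no longer depends on the resolved variables except through the Gaussian, whose
  integral is \<open>1\<close>.
\<close>

theorem kinematical_kernel_content:
  "kinematical_kernel (Y_tri n) content =
     d Z 0 * (LINT t|Leb (J_index n). exp (2 * \<i> * of_real pi * of_real (Q_form p t)) *
       ((\<Prod>k\<in>J_index n. d k (t k)) * d V (- t U)))"
proof -
  let ?J = "J_index n"
  define H where "H t = exp (2 * \<i> * of_real pi * of_real (Q_form p t)) *
       ((\<Prod>k\<in>?J. d k (t k)) * d V (- t U))" for t
  interpret O: sigma_finite_measure "Leb FS" by (rule sf)
  interpret S: sigma_finite_measure "Leb TS" by (rule sf)
  interpret pair_sigma_finite "Leb FS" "Leb TS" ..
  have eq: "limit_integrand 0 v t = of_real (\<Prod>f\<in>FS. gauss (v f)) *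
      (of_real (gauss (t Z)) * (of_real (gauss (t V)) * (d Z 0 * H t)))" for v t
  proof -
    have "content (tet_subst p 0 v t) = d Z 0 * ((\<Prod>k\<in>?J. d k (t k)) * d V (- t U))"
    proof -
      have "(\<Prod>k\<in>?J. d k (tet_subst p 0 v t k)) = (\<Prod>k\<in>?J. d k (t k))"
        by (intro prod.cong) (auto simp: tet_subst_def)
      then show ?thesis unfolding content_def tets_Y_insert by (simp add: mult_ac)
    qed
    then show ?thesis
      unfolding limit_integrand_def subst_integrand_def phase_on_support H_def
      by (simp add: gauss_def mult_ac)
  qed
  let ?g = "\<lambda>y. complex_of_real (gauss y)"
  have indepV: "H (t(V := y)) = H t" and indepZ: "H (t(Z := y)) = H t" for t y
    unfolding H_def Q_form_def by (auto intro!: arg_cong2[where f = "(*)"] prod.cong)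
  have Hm: "H \<in> borel_measurable (Leb I)" if "?J \<subseteq> I" for I
  proof -
    have comp: "(\<lambda>t. t k) \<in> borel_measurable (Leb I)" if "k \<in> ?J" for k
      using that \<open>?J \<subseteq> I\<close> by (intro Leb_component) auto
    have "(\<lambda>t. Q_form p t) \<in> borel_measurable (Leb I)"
      unfolding Q_form_def
      by (intro borel_measurable_add borel_measurable_sum borel_measurable_times borel_measurable_diff
          borel_measurable_const comp) auto
    moreover have "(\<lambda>t. d V (- t U)) \<in> borel_measurable (Leb I)"
      by (rule measurable_compose[OF _ d_measurable]) (auto simp: tets_simps intro!: borel_measurable_uminus comp)
    moreover have "(\<lambda>t. \<Prod>k\<in>?J. d k (t k)) \<in> borel_measurable (Leb I)"
      by (intro borel_measurable_prod measurable_compose[OF comp d_measurable]) (auto simp: tets_Y_insert)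
    ultimately show ?thesis unfolding H_def by (intro borel_measurable_times borel_e)
  qed
  have Hb: "cmod (H t) \<le> (\<Prod>k\<in>?J. C * exp (- \<kappa> * \<bar>t k\<bar>)) * C" for t
  proof -
    have "cmod (d V (- t U)) \<le> C * exp (- \<kappa> * \<bar>- t U\<bar>)" by (rule bound) (simp add: tets_simps)
    also have "\<dots> \<le> C" using C \<kappa> by simp
    finally have "cmod (d V (- t U)) \<le> C" .
    moreover have "cmod (\<Prod>k\<in>?J. d k (t k)) \<le> (\<Prod>k\<in>?J. C * exp (- \<kappa> * \<bar>t k\<bar>))"
      unfolding prod_norm[symmetric] by (intro prod_mono conjI norm_ge_zero bound) (simp add: tets_Y_insert)
    ultimately show ?thesis
      unfolding H_def norm_mult cmod_e using C by (simp) (intro mult_mono prod_nonneg; simp)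
  qed
  have intJ: "integrable (Leb I) (\<lambda>t. (\<Prod>k\<in>I - ?J. ?g (t k)) * H t)" if I: "finite I" "?J \<subseteq> I" for I
  proof (rule Bochner_Integration.integrable_bound)
    let ?f = "\<lambda>k y. if k \<in> ?J then C * exp (- \<kappa> * \<bar>y\<bar>) else gauss y"
    have fint: "integrable lborel (?f k)" for k
      using integrable_gauss integrable_exp_abs[OF \<kappa>] by (cases "k \<in> ?J") auto
    show "integrable (Leb I) (\<lambda>t. (\<Prod>k\<in>I. ?f k (t k)) * C)"
      by (intro integrable_mult_left integrable_prod_Leb[OF I(1) fint])
    show "(\<lambda>t. (\<Prod>k\<in>I - ?J. ?g (t k)) * H t) \<in> borel_measurable (Leb I)"
      by (intro borel_measurable_times Hm I borel_measurable_prod borel_complex_of_real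
          measurable_compose[OF Leb_component gauss_measurable]) auto
    show "AE t in Leb I. cmod ((\<Prod>k\<in>I - ?J. ?g (t k)) * H t) \<le> norm ((\<Prod>k\<in>I. ?f k (t k)) * C)"
    proof (rule AE_I2)
      fix t :: "twist_tet \<Rightarrow> real"
      have "(\<Prod>k\<in>I. ?f k (t k)) = (\<Prod>k\<in>I - ?J. gauss (t k)) * (\<Prod>k\<in>?J. C * exp (- \<kappa> * \<bar>t k\<bar>))"
        by (subst prod.subset_diff[OF I(2,1)]) (auto intro!: arg_cong2[where f = "(*)"] prod.cong)
      moreover have "cmod (\<Prod>k\<in>I - ?J. ?g (t k)) = (\<Prod>k\<in>I - ?J. gauss (t k))"
        unfolding prod_norm[symmetric] by (intro prod.cong) (auto simp: gauss_nonneg)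
      moreover have "0 \<le> (\<Prod>k\<in>I - ?J. gauss (t k))" by (intro prod_nonneg) (simp add: gauss_nonneg)
      ultimately have "cmod ((\<Prod>k\<in>I - ?J. ?g (t k)) * H t) \<le> (\<Prod>k\<in>I. ?f k (t k)) * C"
        using mult_left_mono[OF Hb[of t]] by (simp add: norm_mult mult.assoc)
      then show "cmod ((\<Prod>k\<in>I - ?J. ?g (t k)) * H t) \<le> norm ((\<Prod>k\<in>I. ?f k (t k)) * C)"
        by (rule order_trans) (simp only: real_norm_def abs_ge_self)
    qed
  qed
  have "(LINT t|Leb TS. ?g (t Z) * (?g (t V) * H t)) = (LINT t|Leb ?J. H t)"
  proof -
    have 1: "integrable (Leb (insert Z (insert V ?J))) (\<lambda>t. ?g (t Z) * (?g (t V) * H t))"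
    proof -
      have "insert Z (insert V ?J) - ?J = {Z, V}" by auto
      then show ?thesis using intJ[of "insert Z (insert V ?J)"] by (auto simp: mult.assoc)
    qed
    have 2: "integrable (Leb (insert V ?J)) (\<lambda>t. ?g (t V) * H t)"
    proof -
      have "insert V ?J - ?J = {V}" by auto
      then show ?thesis using intJ[of "insert V ?J"] by auto
    qed
    have "(LINT t|Leb (insert Z (insert V ?J)). ?g (t Z) * (?g (t V) * H t)) =
        (LINT y|lborel. ?g y) * (LINT t|Leb (insert V ?J). ?g (t V) * H t)"
      by (rule integral_insert_separated[OF _ _ 1]) (auto simp: indepZ)
    also have "(LINT t|Leb (insert V ?J). ?g (t V) * H t) = (LINT y|lborel. ?g y) * (LINT t|Leb ?J. H t)"
      by (rule integral_insert_separated[OF _ _ 2]) (auto simp: indepV)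
    finally show ?thesis unfolding tets_Y_insert integral_gauss by simp
  qed
  then have inner: "(LINT t|Leb TS. limit_integrand 0 v t) =
      of_real (\<Prod>f\<in>FS. gauss (v f)) * (d Z 0 * (LINT t|Leb ?J. H t))" for v
  proof -
    have "(\<lambda>t. limit_integrand 0 v t) = (\<lambda>t. (of_real (\<Prod>f\<in>FS. gauss (v f)) * d Z 0) * (?g (t Z) * (?g (t V) * H t)))"
      unfolding eq by (auto simp: mult_ac)
    then have "(LINT t|Leb TS. limit_integrand 0 v t) =
        (of_real (\<Prod>f\<in>FS. gauss (v f)) * d Z 0) * (LINT t|Leb TS. ?g (t Z) * (?g (t V) * H t))"
      by (simp only: integral_mult_right_zero)
    then show ?thesis
      using \<open>(LINT t|Leb TS. ?g (t Z) * (?g (t V) * H t)) = (LINT t|Leb ?J. H t)\<close> by (simp add: mult.assoc)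
  qed
  have "kinematical_kernel (Y_tri n) content = (LINT v|Leb FS. LINT t|Leb TS. limit_integrand 0 v t)"
    unfolding kernel_limit using integral_fst'[OF integrable_limit_integrand[of 0]] by simp
  also have "\<dots> = (LINT v|Leb FS. complex_of_real (\<Prod>f\<in>FS. gauss (v f))) * (d Z 0 * (LINT t|Leb ?J. H t))"
    unfolding inner by (rule integral_mult_left_zero)
  also have "\<dots> = d Z 0 * (LINT t|Leb ?J. H t)"
    by (subst integral_prod_gauss) auto
  finally show ?thesis unfolding H_def .
qed

end

section \<open>The reduced state integral\<close>

text \<open>
  The kernel restricts the dynamical content to \<open>t\<^sub>Z = 0\<close> and \<open>t\<^sub>V = - t\<^sub>U\<close>; the factor of \<open>Z\<close> has been split off.
\<close>

definition state_integrand :: "real \<Rightarrow> nat \<Rightarrow> (twist_tet \<Rightarrow> shape) \<Rightarrow> (twist_tet \<Rightarrow> real) \<Rightarrow> complex" where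
  "state_integrand b n s t =
     exp (2 * \<i> * of_real pi * of_real (Q_form (twist_p n) t)) *
     ((\<Prod>k\<in>J_index n. tet_factor b (twist_sign k) (s k) (t k)) * tet_factor b (- 1) (s V) (- t U))"

definition state_integral :: "real \<Rightarrow> nat \<Rightarrow> (twist_tet \<Rightarrow> shape) \<Rightarrow> complex" where
  "state_integral b n s = (LINT t|Leb (J_index n). state_integrand b n s t)"

definition angles_ge :: "nat \<Rightarrow> real \<Rightarrow> (twist_tet \<Rightarrow> shape) \<Rightarrow> bool" where
  "angles_ge n m s \<longleftrightarrow> (\<forall>k\<in>insert V (J_index n).
     s k \<in> open_shapes \<and> m \<le> shape_a (s k) \<and> m \<le> shape_b (s k) \<and> m \<le> shape_c (s k))"

lemma twist_sign_cases: "twist_sign k = 1 \<or> twist_sign k = - 1"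
  by (cases k) auto

lemma positive_lower_bound:
  fixes f :: "'a \<Rightarrow> real"
  assumes "finite A" "\<And>k. k \<in> A \<Longrightarrow> f k > 0"
  shows "\<exists>m>0. \<forall>k\<in>A. m \<le> f k"
proof (intro exI conjI)
  show "Min (insert 1 (f ` A)) > 0" using assms by auto
  show "\<forall>k\<in>A. Min (insert 1 (f ` A)) \<le> f k" using assms by auto
qed

lemma shapes_lower_bound:
  assumes "finite A" "\<And>k. k \<in> A \<Longrightarrow> s k \<in> open_shapes"
  shows "\<exists>m>0. \<forall>k\<in>A. s k \<in> open_shapes \<and> m \<le> shape_a (s k) \<and> m \<le> shape_b (s k) \<and> m \<le> shape_c (s k)"
  using positive_lower_bound[OF assms(1), of "\<lambda>k. min (shape_a (s k)) (min (shape_b (s k)) (shape_c (s k)))"]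
    open_shapesD[OF assms(2)] assms(2) by auto

context
  fixes b :: real
  assumes b: "b > 0"
begin

lemma partition_function_eq:
  assumes \<alpha>: "\<alpha> \<in> shape_structures (Y_tri n)"
  shows "partition_function b (Y_tri n) \<alpha> = tet_factor b 1 (\<alpha> Z) 0 * state_integral b n \<alpha>"
proof -
  have op: "\<alpha> k \<in> open_shapes" if "k \<in> tets (Y_tri n)" for k
    using \<alpha> that by (auto simp: shape_structures_def)
  obtain m where m: "m > 0" "\<forall>k\<in>tets (Y_tri n). \<alpha> k \<in> open_shapes \<and> m \<le> shape_a (\<alpha> k) \<and>
      m \<le> shape_b (\<alpha> k) \<and> m \<le> shape_c (\<alpha> k)"
    using shapes_lower_bound[of "tets (Y_tri n)" \<alpha>] op by (auto simp: tets_simps)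
  obtain C where C: "C > 0"
    "\<And>s \<epsilon> t. s \<in> open_shapes \<Longrightarrow> \<epsilon> = 1 \<or> \<epsilon> = -1 \<Longrightarrow> m \<le> shape_a s \<Longrightarrow> m \<le> shape_b s \<Longrightarrow> m \<le> shape_c s \<Longrightarrow>
       cmod (tet_factor b \<epsilon> s t) \<le> C * exp (- (m * strip_width b) * \<bar>t\<bar>)"
    by (rule tet_factor_bound[OF b m(1)]) blast
  interpret decaying_content n "\<lambda>k. tet_factor b (twist_sign k) (\<alpha> k)" C "m * strip_width b"
  proof
    show "continuous_on UNIV (tet_factor b (twist_sign k) (\<alpha> k))" if "k \<in> tets (Y_tri n)" for k
      using continuous_on_compose2[OF tet_factor_continuous[OF b twist_sign_cases]
          continuous_on_Pair[OF continuous_on_const continuous_on_id], of "\<alpha> k" UNIV] op[OF that]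
      by auto
    show "cmod (tet_factor b (twist_sign k) (\<alpha> k) y) \<le> C * exp (- (m * strip_width b) * \<bar>y\<bar>)"
      if "k \<in> tets (Y_tri n)" for k y
      using m(2) that by (intro C(2) twist_sign_cases) auto
    show "m * strip_width b > 0" using m(1) strip_width_pos[OF b] by simp
  qed (rule C(1))
  have "dynamical_content b (Y_tri n) \<alpha> = content"
    by (rule ext) (simp add: dynamical_content_eq content_def tets_simps(5))
  then show ?thesis
    unfolding partition_function_def using kinematical_kernel_content
    by (simp add: state_integral_def state_integrand_def)
qed

lemma prefactor_cancels:
  assumes \<alpha>: "\<alpha> \<in> shape_structures (Y_tri n)"
  shows "qdilog b (of_real (pi - weight \<alpha> (knot_edge n)) / (2 * of_real pi * \<i> * of_real (sqrt (hbar b)))) *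
         tet_factor b 1 (\<alpha> Z) 0 = 1"
proof -
  have Z: "\<alpha> Z \<in> open_shapes" using \<alpha> by (auto simp: shape_structures_def tets_simps)
  have arg: "of_real (pi - weight \<alpha> (knot_edge n)) / (2 * of_real pi * \<i> * of_real (sqrt (hbar b))) =
      Complex 0 (tet_height b 1 (\<alpha> Z))"
    unfolding knot_edge_eq tet_argument[OF b, symmetric]
    using hbar_pos[OF b] by (simp add: field_simps)
  have "qdilog b (Complex 0 (tet_height b 1 (\<alpha> Z))) \<noteq> 0"
    using qdilog_nonzero[OF b] tet_argument_in_strip[OF b Z, of 1 0] by auto
  then show ?thesis
    unfolding arg tet_factor_def tet_argument[OF b] by simp
qed

lemma state_integrand_bound:
  assumes m: "m > 0"
  obtains C where "C > 0"
    "\<And>s t. angles_ge n m s \<Longrightarrow>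
       cmod (state_integrand b n s t) \<le> (\<Prod>k\<in>J_index n. C * exp (- (m * strip_width b) * \<bar>t k\<bar>)) * C"
proof -
  obtain C where C: "C > 0"
    "\<And>s \<epsilon> t. s \<in> open_shapes \<Longrightarrow> \<epsilon> = 1 \<or> \<epsilon> = -1 \<Longrightarrow> m \<le> shape_a s \<Longrightarrow> m \<le> shape_b s \<Longrightarrow> m \<le> shape_c s \<Longrightarrow>
       cmod (tet_factor b \<epsilon> s t) \<le> C * exp (- (m * strip_width b) * \<bar>t\<bar>)"
    by (rule tet_factor_bound[OF b m]) blast
  show ?thesis
  proof (rule that[OF C(1)])
    fix s t assume s: "angles_ge n m s"
    have "cmod (\<Prod>k\<in>J_index n. tet_factor b (twist_sign k) (s k) (t k)) \<le>
        (\<Prod>k\<in>J_index n. C * exp (- (m * strip_width b) * \<bar>t k\<bar>))"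
      unfolding prod_norm[symmetric] using s
      by (intro prod_mono conjI norm_ge_zero C(2) twist_sign_cases) (auto simp: angles_ge_def)
    moreover have "cmod (tet_factor b (- 1) (s V) (- t U)) \<le> C * exp (- (m * strip_width b) * \<bar>- t U\<bar>)"
      using s by (intro C(2)) (auto simp: angles_ge_def)
    then have "cmod (tet_factor b (- 1) (s V) (- t U)) \<le> C * 1"
      by (rule order_trans) (use C(1) m strip_width_pos[OF b] in \<open>intro mult_left_mono; simp\<close>)
    ultimately show "cmod (state_integrand b n s t) \<le> (\<Prod>k\<in>J_index n. C * exp (- (m * strip_width b) * \<bar>t k\<bar>)) * C"
      unfolding state_integrand_def norm_mult cmod_e using C(1)
      by (simp only: mult_1_left mult_1_right) (intro mult_mono prod_nonneg; simp)
  qed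
qed

lemma integrable_exp_prod:
  assumes "m > 0" "finite I"
  shows "integrable (Leb I) (\<lambda>t. (\<Prod>k\<in>I. C k * exp (- (m * strip_width b) * \<bar>t k\<bar>)) * C')"
  using assms strip_width_pos[OF b]
  by (intro integrable_mult_left integrable_prod_Leb[where f = "\<lambda>k y. C k * exp (- (m * strip_width b) * \<bar>y\<bar>)"]
      integrable_mult_right integrable_exp_abs) auto

lemma state_integrand_measurable:
  assumes s: "\<And>k. k \<in> insert V (J_index n) \<Longrightarrow> s k \<in> open_shapes"
    and comp: "\<And>k. k \<in> J_index n \<Longrightarrow> (\<lambda>w. t w k) \<in> borel_measurable N"
  shows "(\<lambda>w. state_integrand b n s (t w)) \<in> borel_measurable N"
proof -
  let ?J = "J_index n"
  have "(\<lambda>w. Q_form (twist_p n) (t w)) \<in> borel_measurable N"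
    unfolding Q_form_def
    by (intro borel_measurable_add borel_measurable_sum borel_measurable_times borel_measurable_diff
        borel_measurable_const comp) auto
  moreover have "(\<lambda>w. tet_factor b (- 1) (s V) (- t w U)) \<in> borel_measurable N"
    using s by (intro measurable_compose[OF borel_measurable_uminus[OF comp] tet_factor_measurable[OF b]]) auto
  moreover have "(\<lambda>w. \<Prod>k\<in>?J. tet_factor b (twist_sign k) (s k) (t w k)) \<in> borel_measurable N"
    using s by (intro borel_measurable_prod measurable_compose[OF comp tet_factor_measurable[OF b]] twist_sign_cases) auto
  ultimately show ?thesis
    unfolding state_integrand_def by (intro borel_measurable_times borel_e)
qed

end

instance twist_tet :: countable
  by countable_datatype

lemma tendsto_coordinate: "((\<lambda>\<alpha>. \<alpha> k) \<longlongrightarrow> \<tau> k) (at \<tau> within S)"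
  for \<tau> :: "twist_tet \<Rightarrow> shape"
proof -
  have "continuous_on UNIV (\<lambda>\<alpha>::twist_tet \<Rightarrow> shape. \<alpha> k)"
    by (rule continuous_on_product_coordinates)
  then show ?thesis
    using continuous_on_tendsto_compose[of UNIV "\<lambda>\<alpha>. \<alpha> k" "\<lambda>\<alpha>. \<alpha>" \<tau> "at \<tau> within S"] by simp
qed

lemma tendsto_shape_coordinates:
  assumes "(f \<longlongrightarrow> s) F"
  shows "((\<lambda>x. shape_a (f x)) \<longlongrightarrow> shape_a s) F" "((\<lambda>x. shape_b (f x)) \<longlongrightarrow> shape_b s) F"
    "((\<lambda>x. shape_c (f x)) \<longlongrightarrow> shape_c s) F"
  unfolding shape_a_def shape_b_def shape_c_def by (intro tendsto_intros assms)+

lemma state_integral_tendsto: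
  assumes b: "b > 0" and \<tau>: "\<tau> \<in> shape_structures_closed_at (Y_tri n) Z"
  shows "(state_integral b n \<longlongrightarrow> state_integral b n \<tau>) (at \<tau> within shape_structures (Y_tri n))"
proof -
  let ?K = "insert V (J_index n)" and ?S = "shape_structures (Y_tri n)"
  have \<tau>o: "\<tau> k \<in> open_shapes" if k: "k \<in> ?K" for k
  proof -
    have "k \<in> tets (Y_tri n)" "k \<noteq> Z" using k by (auto simp: tets_Y_insert)
    then show ?thesis using PiE_mem[OF \<tau>[unfolded shape_structures_closed_at_def], of k] by simp
  qed
  have \<alpha>o: "\<alpha> k \<in> open_shapes" if "\<alpha> \<in> ?S" "k \<in> ?K" for \<alpha> k
    using that by (auto simp: shape_structures_def tets_Y_insert)
  obtain m0 where m0: "m0 > 0" "\<forall>k\<in>?K. \<tau> k \<in> open_shapes \<and> m0 \<le> shape_a (\<tau> k) \<and>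
      m0 \<le> shape_b (\<tau> k) \<and> m0 \<le> shape_c (\<tau> k)"
    using shapes_lower_bound[of ?K \<tau>] \<tau>o by auto
  define m where "m = m0 / 2"
  have m: "m > 0" "m < m0" using m0(1) by (auto simp: m_def)
  have near: "\<forall>\<^sub>F \<alpha> in at \<tau> within ?S. angles_ge n m \<alpha>"
  proof -
    have "\<forall>\<^sub>F \<alpha> in at \<tau> within ?S. \<forall>k\<in>?K. m \<le> shape_a (\<alpha> k) \<and> m \<le> shape_b (\<alpha> k) \<and> m \<le> shape_c (\<alpha> k)"
    proof (rule eventually_ball_finite)
      show "\<forall>k\<in>?K. \<forall>\<^sub>F \<alpha> in at \<tau> within ?S. m \<le> shape_a (\<alpha> k) \<and> m \<le> shape_b (\<alpha> k) \<and> m \<le> shape_c (\<alpha> k)"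
      proof
        fix k assume k: "k \<in> ?K"
        then have "m < shape_a (\<tau> k)" "m < shape_b (\<tau> k)" "m < shape_c (\<tau> k)"
          using m0(2) m(2) by fastforce+
        then have "\<forall>\<^sub>F \<alpha> in at \<tau> within ?S. m < shape_a (\<alpha> k)" "\<forall>\<^sub>F \<alpha> in at \<tau> within ?S. m < shape_b (\<alpha> k)"
          "\<forall>\<^sub>F \<alpha> in at \<tau> within ?S. m < shape_c (\<alpha> k)"
          using tendsto_shape_coordinates[OF tendsto_coordinate[of k \<tau> ?S]] by (auto intro: order_tendstoD(1))
        then show "\<forall>\<^sub>F \<alpha> in at \<tau> within ?S. m \<le> shape_a (\<alpha> k) \<and> m \<le> shape_b (\<alpha> k) \<and> m \<le> shape_c (\<alpha> k)"
          by eventually_elim auto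
      qed
    qed auto
    moreover have "\<forall>\<^sub>F \<alpha> in at \<tau> within ?S. \<alpha> \<in> ?S" by (simp add: eventually_at_filter)
    ultimately show ?thesis by eventually_elim (use \<alpha>o in \<open>auto simp: angles_ge_def\<close>)
  qed
  obtain C where C: "C > 0"
    "\<And>s t. angles_ge n m s \<Longrightarrow>
       cmod (state_integrand b n s t) \<le> (\<Prod>k\<in>J_index n. C * exp (- (m * strip_width b) * \<bar>t k\<bar>)) * C"
    by (rule state_integrand_bound[OF b m(1), where n = n]) blast
  have "((\<lambda>\<alpha>. LINT t|Leb (J_index n). state_integrand b n \<alpha> t) \<longlongrightarrow> (LINT t|Leb (J_index n). state_integrand b n \<tau> t)) (at \<tau> within ?S)"
  proof (rule tendsto_integral_dominated)
    show "state_integrand b n \<alpha> \<in> borel_measurable (Leb (J_index n))" if "\<alpha> \<in> ?S" for \<alpha>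
      using that by (intro state_integrand_measurable[OF b, where t = "\<lambda>t. t"] \<alpha>o Leb_component)
    show "integrable (Leb (J_index n)) (\<lambda>t. (\<Prod>k\<in>J_index n. C * exp (- (m * strip_width b) * \<bar>t k\<bar>)) * C)"
      by (rule integrable_exp_prod[OF b m(1)]) simp
    show "\<forall>\<^sub>F \<alpha> in at \<tau> within ?S. \<forall>t\<in>space (Leb (J_index n)).
        cmod (state_integrand b n \<alpha> t) \<le> (\<Prod>k\<in>J_index n. C * exp (- (m * strip_width b) * \<bar>t k\<bar>)) * C"
      using near by eventually_elim (use C(2) in blast)
    show "state_integrand b n \<tau> \<in> borel_measurable (Leb (J_index n))"
      by (intro state_integrand_measurable[OF b, where t = "\<lambda>t. t"] \<tau>o Leb_component)
    have inS: "\<forall>\<^sub>F \<alpha> in at \<tau> within ?S. \<alpha> k \<in> open_shapes" if "k \<in> ?K" for k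
      using \<alpha>o that by (auto simp: eventually_at_filter)
    show "((\<lambda>\<alpha>. state_integrand b n \<alpha> t) \<longlongrightarrow> state_integrand b n \<tau> t) (at \<tau> within ?S)" for t
      unfolding state_integrand_def
      by (intro tendsto_intros tet_factor_tendsto[OF b tendsto_coordinate inS \<tau>o] twist_sign_cases) auto
  qed
  then show ?thesis unfolding state_integral_def .
qed

section \<open>The contour integral\<close>

lemma sum_J_index: "(\<Sum>k\<in>J_index n. g k) = (\<Sum>k=1..twist_p n. g (T k)) + g U + g W"
proof -
  have "(\<Sum>k\<in>J_index n. g k) = (\<Sum>k\<in>T ` {1..twist_p n}. g k) + (\<Sum>k\<in>{U, W}. g k)"
    unfolding J_index_def by (rule sum.union_disjoint) auto
  then show ?thesis by (simp add: sum.reindex inj_on_def add.assoc)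
qed

lemma prod_J_index: "(\<Prod>k\<in>J_index n. g k) = (\<Prod>k=1..twist_p n. g (T k)) * g U * g W"
proof -
  have "(\<Prod>k\<in>J_index n. g k) = (\<Prod>k\<in>T ` {1..twist_p n}. g k) * (\<Prod>k\<in>{U, W}. g k)"
    unfolding J_index_def by (rule prod.union_disjoint) auto
  then show ?thesis by (simp add: prod.reindex inj_on_def mult.assoc)
qed

lemma Q_matrix_sym: "Q_matrix n j k = Q_matrix n k j"
  by (cases j; cases k) (auto simp: min.commute)

lemma sum_upto: "(\<Sum>k=1..p. real k) = real p * (real p + 1) / 2"
  by (induction p) (auto simp: field_simps)

lemma sum_min:
  assumes "i \<le> p"
  shows "(\<Sum>k=1..p. real (min i k)) = real i * real p - real i * (real i - 1) / 2"
  using assms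
proof (induction p)
  case (Suc p)
  show ?case
  proof (cases "i = Suc p")
    case True
    then have "(\<Sum>k=1..Suc p. real (min i k)) = (\<Sum>k=1..Suc p. real k)" by (intro sum.cong) auto
    then show ?thesis unfolding sum_upto using True by (simp add: field_simps)
  next
    case False
    then show ?thesis using Suc by (simp add: field_simps)
  qed
qed simp

definition bilinear_Q :: "nat \<Rightarrow> (twist_tet \<Rightarrow> real) \<Rightarrow> (twist_tet \<Rightarrow> real) \<Rightarrow> real" where
  "bilinear_Q n x z = (\<Sum>j\<in>J_index n. x j * (\<Sum>k\<in>J_index n. Q_matrix n j k * z k))"

lemma row_Q:
  "(\<Sum>k\<in>J_index n. Q_matrix n (T i) k * z k) = (\<Sum>k=1..twist_p n. real (min i k) * z (T k)) + real i * z U"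
  "(\<Sum>k\<in>J_index n. Q_matrix n U k * z k) = (\<Sum>k=1..twist_p n. real k * z (T k)) + (real (twist_p n) + 1) * z U - z W / 2"
  "(\<Sum>k\<in>J_index n. Q_matrix n W k * z k) = - z U / 2"
  by (simp_all add: sum_J_index)

lemma bilinear_Q_sym: "bilinear_Q n x z = bilinear_Q n z x"
proof -
  have "bilinear_Q n x z = (\<Sum>j\<in>J_index n. \<Sum>k\<in>J_index n. x j * Q_matrix n j k * z k)"
    by (simp add: bilinear_Q_def sum_distrib_left mult.assoc)
  also have "\<dots> = (\<Sum>k\<in>J_index n. \<Sum>j\<in>J_index n. x j * Q_matrix n j k * z k)"
    by (rule sum.swap)
  also have "\<dots> = bilinear_Q n z x"
    unfolding bilinear_Q_def sum_distrib_left
    by (intro sum.cong refl) (simp add: Q_matrix_sym mult_ac)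
  finally show ?thesis .
qed

lemma bilinear_Q_diag: "bilinear_Q n x x = Q_form (twist_p n) x"
proof -
  have "(\<Sum>k=1..twist_p n. x (T k) * (real k * x U)) = x U * (\<Sum>k=1..twist_p n. real k * x (T k))"
    unfolding sum_distrib_left by (intro sum.cong) auto
  then show ?thesis
    unfolding bilinear_Q_def Q_form_def sum_J_index[of "\<lambda>j. x j * _ j"] row_Q
    by (simp add: min.commute distrib_left distrib_right sum.distrib mult_ac) (simp add: algebra_simps sum_distrib_left)
qed

lemma J_shift_strip_width:
  assumes "b > 0"
  shows "J_shift b s k = (if k = W then 1 else - 1) * (pi - shape_a (s k)) * strip_width b / (2 * pi)"
  unfolding J_shift_def strip_width_eq[OF assms] by simp

lemma J_shift_eq:
  assumes "b > 0" "k \<in> J_index n"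
  shows "J_shift b s k = tet_height b (twist_sign k) (s k)"
  using assms(2)
  by (auto simp: J_shift_strip_width[OF assms(1)] tet_height_def[OF assms(1)] J_index_def
      left_diff_distrib diff_divide_distrib)

text \<open>
  Row \<open>j\<close> of \<open>Q\<^sub>n\<close> applied to the heights of the contour, together with entry \<open>j\<close> of \<open>\<W>\<^sub>n\<close>, is the
  expression for \<open>c\<^sub>j\<close> (and \<open>c\<^sub>U - c\<^sub>V\<close> for \<open>j = U\<close>) in \<open>angle_relations\<close>. The difference \<open>c\<^sub>U - c\<^sub>V\<close> appears
  because the content of \<open>V\<close> is evaluated at \<open>t\<^sub>V = - t\<^sub>U\<close>.
\<close>

lemma linear_exponent:
  assumes b: "b > 0" and s: "angle_relations (twist_p n) s"
  shows "- 4 * pi * bilinear_Q n x (J_shift b s) + strip_width b * (\<Sum>k\<in>J_index n. x k * W_vector n k) =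
     strip_width b * ((\<Sum>k=1..twist_p n. shape_c (s (T k)) * x (T k)) + (shape_c (s U) - shape_c (s V)) * x U
       + shape_c (s W) * x W)"
proof -
  let ?p = "twist_p n"
  define q where "q = strip_width b"
  define h where "h = J_shift b s"
  define a where "a k = shape_a (s k)" for k
  have hT: "4 * pi * h (T k) = - 2 * q * (pi - a (T k))" for k
    by (simp add: h_def J_shift_strip_width[OF b] q_def a_def field_simps)
  have hU: "4 * pi * h U = - 2 * q * (pi - a U)"
    by (simp add: h_def J_shift_strip_width[OF b] q_def a_def field_simps)
  have hW: "4 * pi * h W = 2 * q * (pi - a W)"
    by (simp add: h_def J_shift_strip_width[OF b] q_def a_def field_simps)
  have sumT: "4 * pi * (\<Sum>k=1..?p. r k * h (T k)) = - 2 * q * (pi * (\<Sum>k=1..?p. r k) - (\<Sum>k=1..?p. r k * a (T k)))"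
    for r :: "nat \<Rightarrow> real"
  proof -
    have "4 * pi * (\<Sum>k=1..?p. r k * h (T k)) = (\<Sum>k=1..?p. r k * (4 * pi * h (T k)))"
      unfolding sum_distrib_left by (intro sum.cong) auto
    also have "\<dots> = (\<Sum>k=1..?p. - 2 * q * (pi * r k - r k * a (T k)))"
      unfolding hT by (intro sum.cong) (auto simp: algebra_simps)
    also have "\<dots> = - 2 * q * (pi * (\<Sum>k=1..?p. r k) - (\<Sum>k=1..?p. r k * a (T k)))"
      unfolding sum_distrib_left[symmetric] sum_subtractf ..
    finally show ?thesis .
  qed
  have rowT: "- 4 * pi * (\<Sum>k\<in>J_index n. Q_matrix n (T i) k * h k) + q * W_vector n (T i) = q * shape_c (s (T i))"
    if i: "i \<in> {1..?p}" for i
  proof -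
    have c: "shape_c (s (T i)) = 2 * real i * pi - 2 * (\<Sum>k=1..?p. real (min i k) * a (T k)) - 2 * real i * a U"
      using s i by (auto simp: angle_relations_def a_def)
    define X where "X = real i * real ?p - real i * (real i - 1) / 2"
    have Wi: "W_vector n (T i) = - 2 * pi * X" by (simp add: X_def)
    have X: "(\<Sum>k=1..?p. real (min i k)) = X" using sum_min[of i ?p] i by (simp add: X_def)
    have "- 4 * pi * (\<Sum>k\<in>J_index n. Q_matrix n (T i) k * h k) =
        - (4 * pi * (\<Sum>k=1..?p. real (min i k) * h (T k))) - real i * (4 * pi * h U)"
      unfolding row_Q by (simp add: algebra_simps)
    also have "\<dots> = 2 * q * (pi * X
          - (\<Sum>k=1..?p. real (min i k) * a (T k))) + real i * (2 * q * (pi - a U))"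
      unfolding sumT hU X by (simp add: algebra_simps)
    finally show ?thesis unfolding c by (simp only: Wi) (simp add: algebra_simps)
  qed
  have rowU: "- 4 * pi * (\<Sum>k\<in>J_index n. Q_matrix n U k * h k) + q * W_vector n U = q * (shape_c (s U) - shape_c (s V))"
  proof -
    have c: "shape_c (s U) - shape_c (s V) = 2 * real ?p * pi - 2 * (\<Sum>k=1..?p. real k * a (T k))
        - 2 * (real ?p + 1) * a U - a W"
      using s by (auto simp: angle_relations_def a_def)
    define X where "X = real ?p * (real ?p + 1) / 2"
    have Wi: "W_vector n U = - (2 * X + 3) * pi" by (simp add: X_def power2_eq_square algebra_simps)
    have hW2: "(4 * pi * h W) / 2 = q * (pi - a W)" unfolding hW by simp
    have "- 4 * pi * (\<Sum>k\<in>J_index n. Q_matrix n U k * h k) =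
        - (4 * pi * (\<Sum>k=1..?p. real k * h (T k))) - (real ?p + 1) * (4 * pi * h U) + (4 * pi * h W) / 2"
      unfolding row_Q by (simp add: algebra_simps)
    also have "\<dots> = 2 * q * (pi * X - (\<Sum>k=1..?p. real k * a (T k)))
        + (real ?p + 1) * (2 * q * (pi - a U)) + q * (pi - a W)"
      unfolding sumT hU hW2 sum_upto X_def[symmetric] by (simp add: algebra_simps)
    finally show ?thesis unfolding c by (simp only: Wi) (simp add: algebra_simps)
  qed
  have rowW: "- 4 * pi * (\<Sum>k\<in>J_index n. Q_matrix n W k * h k) + q * W_vector n W = q * shape_c (s W)"
  proof -
    have "- 4 * pi * (\<Sum>k\<in>J_index n. Q_matrix n W k * h k) = (4 * pi * h U) / 2"
      unfolding row_Q by simp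
    then show ?thesis using s unfolding hU by (simp add: angle_relations_def a_def algebra_simps)
  qed
  define S where "S j = (\<Sum>k\<in>J_index n. Q_matrix n j k * h k)" for j
  note row = rowT[folded S_def] rowU[folded S_def] rowW[folded S_def]
  have "- 4 * pi * bilinear_Q n x h + q * (\<Sum>k\<in>J_index n. x k * W_vector n k) =
      (\<Sum>j\<in>J_index n. x j * (- 4 * pi * S j + q * W_vector n j))"
    unfolding bilinear_Q_def S_def[symmetric] sum_distrib_left sum.distrib[symmetric]
    by (intro sum.cong refl) (simp add: algebra_simps)
  also have "\<dots> = (\<Sum>i=1..?p. x (T i) * (q * shape_c (s (T i)))) + x U * (q * (shape_c (s U) - shape_c (s V)))
      + x W * (q * shape_c (s W))"
    unfolding sum_J_index row(2,3)
    by (intro arg_cong2[where f = "(+)"] sum.cong refl arg_cong2[where f = "(*)"] row(1)) auto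
  also have "\<dots> = q * ((\<Sum>k=1..?p. shape_c (s (T k)) * x (T k)) + (shape_c (s U) - shape_c (s V)) * x U
       + shape_c (s W) * x W)"
    by (simp add: distrib_left sum_distrib_left mult_ac)
  finally show ?thesis unfolding h_def q_def .
qed

text \<open>
  The part of the exponent of the integrand of \<open>J\<close> that is constant on the contour of \<open>s\<close>, divided by \<open>i\<close>.
\<close>

definition contour_phase :: "real \<Rightarrow> nat \<Rightarrow> (twist_tet \<Rightarrow> shape) \<Rightarrow> real" where
  "contour_phase b n s = - 2 * pi * bilinear_Q n (J_shift b s) (J_shift b s)
     + strip_width b * (\<Sum>k\<in>J_index n. J_shift b s k * W_vector n k)"

text \<open>
  The real linear part of the exponent supplies the exponentials of the dynamical content; the part that is
  constant on the contour is imaginary. The factor \<open>\<Phi>\<^sub>b(- y\<^sub>U)\<close> is that of \<open>V\<close>, by \<open>a\<^sub>V = a\<^sub>U\<close>.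
\<close>

lemma J_integrand_on_contour:
  assumes b: "b > 0" and s: "angle_relations (twist_p n) s"
  shows "J_integrand b n (\<lambda>k. of_real (x k) + \<i> * of_real (J_shift b s k)) =
         exp (\<i> * of_real (contour_phase b n s)) * state_integrand b n s x"
proof -
  let ?p = "twist_p n" and ?J = "J_index n"
  define q where "q = strip_width b"
  define h where "h = J_shift b s"
  define y where "y k = complex_of_real (x k) + \<i> * of_real (h k)" for k
  have q: "1 / sqrt (hbar b) = q" using strip_width_eq[OF b] by (simp add: q_def)
  have quad: "(\<Sum>j\<in>?J. \<Sum>k\<in>?J. y j * of_real (Q_matrix n j k) * y k) =
      of_real (bilinear_Q n x x - bilinear_Q n h h) + \<i> * of_real (2 * bilinear_Q n x h)"
  proof -
    have "(\<Sum>j\<in>?J. \<Sum>k\<in>?J. y j * of_real (Q_matrix n j k) * y k) =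
        (\<Sum>j\<in>?J. \<Sum>k\<in>?J. of_real (x j * (Q_matrix n j k * x k) - h j * (Q_matrix n j k * h k)) +
           \<i> * of_real (x j * (Q_matrix n j k * h k) + h j * (Q_matrix n j k * x k)))"
      unfolding y_def by (intro sum.cong refl) (simp add: complex_eq_iff algebra_simps)
    also have "\<dots> = of_real (bilinear_Q n x x - bilinear_Q n h h) + \<i> * of_real (bilinear_Q n x h + bilinear_Q n h x)"
      unfolding bilinear_Q_def sum_distrib_left of_real_sum of_real_add of_real_diff sum.distrib sum_subtractf
      by (simp add: sum_distrib_left distrib_left sum.distrib)
    finally show ?thesis using bilinear_Q_sym[of n h x] by simp
  qed
  have lin: "(\<Sum>j\<in>?J. y j * of_real (W_vector n j)) =
      of_real (\<Sum>k\<in>?J. x k * W_vector n k) + \<i> * of_real (\<Sum>k\<in>?J. h k * W_vector n k)"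
    unfolding y_def by (simp add: distrib_right sum.distrib sum_distrib_left mult.assoc)
  define L where "L = (\<Sum>k=1..?p. shape_c (s (T k)) * x (T k)) + (shape_c (s U) - shape_c (s V)) * x U
       + shape_c (s W) * x W"
  have L: "- 4 * pi * bilinear_Q n x h + q * (\<Sum>k\<in>?J. x k * W_vector n k) = q * L"
    using linear_exponent[OF b s, of x] by (simp add: L_def h_def q_def)
  have expo: "2 * \<i> * of_real pi * (\<Sum>j\<in>?J. \<Sum>k\<in>?J. y j * of_real (Q_matrix n j k) * y k) +
      (\<Sum>j\<in>?J. y j * of_real (W_vector n j)) / of_real (sqrt (hbar b)) =
      2 * \<i> * of_real pi * of_real (Q_form ?p x) + \<i> * of_real (contour_phase b n s) + of_real (q * L)"
  proof -
    have div: "z / of_real (sqrt (hbar b)) = z * of_real q" for z :: complex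
      unfolding q[symmetric] by simp
    show ?thesis
      unfolding quad lin div bilinear_Q_diag L[symmetric] contour_phase_def h_def[symmetric] q_def[symmetric]
      by (simp add: complex_eq_iff algebra_simps)
  qed
  have yk: "y k = Complex (x k) (tet_height b (twist_sign k) (s k))" if "k \<in> ?J" for k
    using J_shift_eq[OF b that, of s] by (simp add: y_def h_def complex_eq_iff)
  have yU: "- y U = Complex (- x U) (tet_height b (- 1) (s V))"
    using yk[of U] s
    by (simp add: complex_eq_iff tet_height_def[OF b] angle_relations_def left_diff_distrib diff_divide_distrib)
  have f1: "tet_factor b 1 (s k) (x k) = of_real (exp (q * (shape_c (s k) * x k))) / qdilog b (y k)"
    if "k \<in> ?J" "twist_sign k = 1" for k
    unfolding tet_factor_def tet_argument[OF b] using yk[OF that(1)] that(2) by (simp add: q[symmetric])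
  have fW: "tet_factor b (- 1) (s W) (x W) = of_real (exp (q * (shape_c (s W) * x W))) * qdilog b (y W)"
    unfolding tet_factor_def tet_argument[OF b] using yk[of W]
    by (simp add: q[symmetric] power_int_minus divide_inverse)
  have fV: "tet_factor b (- 1) (s V) (- x U) = of_real (exp (q * (- shape_c (s V) * x U))) * qdilog b (- y U)"
    unfolding tet_factor_def tet_argument[OF b] yU
    by (simp add: q[symmetric] power_int_minus divide_inverse)
  have fac: "(\<Prod>k\<in>?J. tet_factor b (twist_sign k) (s k) (x k)) * tet_factor b (- 1) (s V) (- x U) =
      of_real (exp (q * L)) * (qdilog b (- y U) * qdilog b (y W)) / ((\<Prod>k\<in>{1..?p}. qdilog b (y (T k))) * qdilog b (y U))"
  proof -
    have "(\<Prod>k\<in>?J. tet_factor b (twist_sign k) (s k) (x k)) =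
        (\<Prod>k=1..?p. of_real (exp (q * (shape_c (s (T k)) * x (T k)))) / qdilog b (y (T k))) *
        (of_real (exp (q * (shape_c (s U) * x U))) / qdilog b (y U)) *
        (of_real (exp (q * (shape_c (s W) * x W))) * qdilog b (y W))"
      unfolding prod_J_index by (simp add: fW f1)
    moreover have "exp (q * L) = (\<Prod>k=1..?p. exp (q * (shape_c (s (T k)) * x (T k)))) * exp (q * (shape_c (s U) * x U)) *
        exp (q * (shape_c (s W) * x W)) * exp (q * (- shape_c (s V) * x U))"
      unfolding exp_sum[OF finite_atLeastAtMost, symmetric] exp_add[symmetric] L_def
      by (simp add: algebra_simps sum_distrib_left)
    ultimately show ?thesis
      unfolding fV by (simp add: prod_dividef of_real_prod mult_ac)
  qed
  have "J_integrand b n y = exp (\<i> * of_real (contour_phase b n s)) * state_integrand b n s x"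
    unfolding J_integrand_def expo state_integrand_def fac exp_add exp_of_real[symmetric]
    by (simp add: mult_ac)
  then show ?thesis by (simp add: y_def[abs_def] h_def)
qed

lemma J_value_eq:
  assumes "b > 0" "angle_relations (twist_p n) s"
  shows "J_value b n s = exp (\<i> * of_real (contour_phase b n s)) * state_integral b n s"
  unfolding J_value_def state_integral_def J_integrand_on_contour[OF assms] by simp

definition mix_shapes :: "real \<Rightarrow> (twist_tet \<Rightarrow> shape) \<Rightarrow> (twist_tet \<Rightarrow> shape) \<Rightarrow> twist_tet \<Rightarrow> shape" where
  "mix_shapes l s0 s1 k = (1 - l) *\<^sub>R s0 k + l *\<^sub>R s1 k"

lemma shape_mix:
  "shape_a (mix_shapes l s0 s1 k) = (1 - l) * shape_a (s0 k) + l * shape_a (s1 k)"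
  "shape_b (mix_shapes l s0 s1 k) = (1 - l) * shape_b (s0 k) + l * shape_b (s1 k)"
  "shape_c (mix_shapes l s0 s1 k) = (1 - l) * shape_c (s0 k) + l * shape_c (s1 k)"
  by (simp_all add: mix_shapes_def shape_a_def shape_b_def shape_c_def)

lemma angle_relations_mix:
  assumes "angle_relations p s0" "angle_relations p s1"
  shows "angle_relations p (mix_shapes l s0 s1)"
proof -
  have S: "(\<Sum>k=1..p. r k * ((1 - l) * u k + l * w k)) = (1 - l) * (\<Sum>k=1..p. r k * u k) + l * (\<Sum>k=1..p. r k * w k)"
    for r u w :: "nat \<Rightarrow> real"
    unfolding sum_distrib_left sum.distrib[symmetric] by (intro sum.cong refl) (simp add: algebra_simps)
  have 1: "shape_a (s0 V) = shape_a (s0 U)" "shape_c (s0 W) = shape_a (s0 U)"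
    "shape_a (s1 V) = shape_a (s1 U)" "shape_c (s1 W) = shape_a (s1 U)"
    using assms by (auto simp: angle_relations_def)
  have 2: "shape_c (s (T j)) = 2 * real j * pi
        - 2 * (\<Sum>k=1..p. real (min j k) * shape_a (s (T k))) - 2 * real j * shape_a (s U)"
    if "j \<in> {1..p}" "s = s0 \<or> s = s1" for j s
    using assms that by (auto simp: angle_relations_def)
  have 3: "shape_c (s U) = shape_c (s V) + 2 * real p * pi - 2 * (\<Sum>k=1..p. real k * shape_a (s (T k)))
        - 2 * (real p + 1) * shape_a (s U) - shape_a (s W)" if "s = s0 \<or> s = s1" for s
    using assms that by (auto simp: angle_relations_def)
  show ?thesis
    unfolding angle_relations_def shape_mix S
  proof (intro conjI ballI)
    fix j assume j: "j \<in> {1..p}"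
    show "(1 - l) * shape_c (s0 (T j)) + l * shape_c (s1 (T j)) = 2 * real j * pi -
         2 * ((1 - l) * (\<Sum>k=1..p. real (min j k) * shape_a (s0 (T k))) + l * (\<Sum>k=1..p. real (min j k) * shape_a (s1 (T k)))) -
         2 * real j * ((1 - l) * shape_a (s0 U) + l * shape_a (s1 U))"
      unfolding 2[OF j disjI1[OF refl]] 2[OF j disjI2[OF refl]] by (simp add: algebra_simps)
  next
    show "(1 - l) * shape_c (s0 U) + l * shape_c (s1 U) - ((1 - l) * shape_c (s0 V) + l * shape_c (s1 V)) =
         2 * real p * pi - 2 * ((1 - l) * (\<Sum>k=1..p. real k * shape_a (s0 (T k))) + l * (\<Sum>k=1..p. real k * shape_a (s1 (T k)))) -
         2 * (real p + 1) * ((1 - l) * shape_a (s0 U) + l * shape_a (s1 U)) - ((1 - l) * shape_a (s0 W) + l * shape_a (s1 W))"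
      unfolding 3[OF disjI1[OF refl]] 3[OF disjI2[OF refl]] by (simp add: algebra_simps)
  qed (use 1 in auto)
qed

lemma J_shift_mix: "J_shift b (mix_shapes l s0 s1) k = (1 - l) * J_shift b s0 k + l * J_shift b s1 k"
  unfolding J_shift_def shape_mix by (simp add: add_divide_distrib[symmetric] algebra_simps)

lemma J_integrand_cong:
  assumes "\<And>k. k \<in> J_index n \<Longrightarrow> y k = y' k"
  shows "J_integrand b n y = J_integrand b n y'"
proof -
  have "(\<Sum>j\<in>J_index n. \<Sum>k\<in>J_index n. y j * of_real (Q_matrix n j k) * y k) =
      (\<Sum>j\<in>J_index n. \<Sum>k\<in>J_index n. y' j * of_real (Q_matrix n j k) * y' k)"
    using assms by (intro sum.cong) auto
  moreover have "(\<Sum>j\<in>J_index n. y j * of_real (W_vector n j)) = (\<Sum>j\<in>J_index n. y' j * of_real (W_vector n j))"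
    using assms by (intro sum.cong) auto
  moreover have "(\<Prod>k\<in>{1..twist_p n}. qdilog b (y (T k))) = (\<Prod>k\<in>{1..twist_p n}. qdilog b (y' (T k)))"
    using assms by (intro prod.cong) auto
  ultimately show ?thesis using assms unfolding J_integrand_def by simp
qed

text \<open>
  The contours of \<open>s0\<close> and \<open>s1\<close> are the members \<open>\<zeta> = 0\<close> and \<open>\<zeta> = i\<close> of a family of parallel contours, moved
  by \<open>\<zeta>\<close> times the vector \<open>\<delta>\<close>; a contour with \<open>Im \<zeta> = l\<close> belongs to the shape \<open>mx l\<close> on the line through
  \<open>s0\<close> and \<open>s1\<close>. A real \<open>\<zeta>\<close> only translates the real variables of integration.
\<close>

lemma J_value_independent:
  assumes b: "b > 0"
    and s0: "\<And>k. k \<in> insert V (J_index n) \<Longrightarrow> s0 k \<in> open_shapes" "angle_relations (twist_p n) s0"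
    and s1: "\<And>k. k \<in> insert V (J_index n) \<Longrightarrow> s1 k \<in> open_shapes" "angle_relations (twist_p n) s1"
  shows "J_value b n s0 = J_value b n s1"
proof -
  let ?J = "J_index n" and ?K = "insert V (J_index n)"
  have fin: "finite ?K" by simp
  obtain m0 where m0: "m0 > 0" "\<forall>k\<in>?K. s0 k \<in> open_shapes \<and> m0 \<le> shape_a (s0 k) \<and> m0 \<le> shape_b (s0 k) \<and> m0 \<le> shape_c (s0 k)"
    using shapes_lower_bound[where s = s0, OF fin s0(1)] by blast
  obtain m1 where m1: "m1 > 0" "\<forall>k\<in>?K. s1 k \<in> open_shapes \<and> m1 \<le> shape_a (s1 k) \<and> m1 \<le> shape_b (s1 k) \<and> m1 \<le> shape_c (s1 k)"
    using shapes_lower_bound[where s = s1, OF fin s1(1)] by blast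
  \<comment> \<open>Angles of \<open>s0\<close> and \<open>s1\<close> are at least \<open>2 m\<close>, so the line may be prolonged by \<open>m / \<pi>\<close> at both ends.\<close>
  define m where "m = min m0 m1 / 2"
  have m: "m > 0" using m0(1) m1(1) by (simp add: m_def)
  define \<eta> where "\<eta> = m / pi"
  have \<eta>: "\<eta> > 0" using m by (simp add: \<eta>_def)
  define mx where "mx l = mix_shapes l s0 s1" for l
  have lower: "m \<le> (1 - l) * u + l * w"
    if l: "- \<eta> < l" "l < 1 + \<eta>" and u: "2 * m \<le> u" "u < pi" and w: "2 * m \<le> w" "w < pi" for l u w :: real
  proof -
    have pe: "pi * \<eta> = m" by (simp add: \<eta>_def)
    consider "l < 0" | "0 \<le> l" "l \<le> 1" | "1 < l" by linarith
    then show ?thesis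
    proof cases
      case 1
      have "(- l) * (w - u) \<le> (- l) * pi" using 1 u w m by (intro mult_left_mono) auto
      also have "\<dots> \<le> \<eta> * pi" using l by (intro mult_right_mono) auto
      finally have "(- l) * (w - u) \<le> m" using pe by (simp add: mult.commute)
      then show ?thesis using u by (simp add: algebra_simps)
    next
      case 2
      have "(1 - l) * (2 * m) + l * (2 * m) \<le> (1 - l) * u + l * w"
        using 2 u w by (intro add_mono mult_left_mono) auto
      then show ?thesis using m by (simp add: algebra_simps)
    next
      case 3
      have "(l - 1) * (u - w) \<le> (l - 1) * pi" using 3 u w m by (intro mult_left_mono) auto
      also have "\<dots> \<le> \<eta> * pi" using l by (intro mult_right_mono) auto
      finally have "(l - 1) * (u - w) \<le> m" using pe by (simp add: mult.commute)
      then show ?thesis using w by (simp add: algebra_simps)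
    qed
  qed
  have mx_ge: "angles_ge n m (mx l)" if l: "- \<eta> < l" "l < 1 + \<eta>" for l
    unfolding angles_ge_def
  proof
    fix k assume k: "k \<in> ?K"
    note o0 = open_shapesD[OF s0(1)[OF k]] and o1 = open_shapesD[OF s1(1)[OF k]]
    have m2: "2 * m \<le> m0" "2 * m \<le> m1" by (auto simp: m_def)
    have ge: "m \<le> shape_a (mx l k)" "m \<le> shape_b (mx l k)" "m \<le> shape_c (mx l k)"
      unfolding mx_def shape_mix using o0 o1 m0(2) m1(2) k m2 by (auto intro!: lower[OF l] intro: order_trans)
    have "shape_a (mx l k) + shape_b (mx l k) + shape_c (mx l k) =
        (1 - l) * (shape_a (s0 k) + shape_b (s0 k) + shape_c (s0 k)) + l * (shape_a (s1 k) + shape_b (s1 k) + shape_c (s1 k))"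
      unfolding mx_def shape_mix by (simp add: algebra_simps)
    also have "\<dots> = pi" unfolding o0(7) o1(7) by (simp add: algebra_simps)
    finally have "mx l k \<in> open_shapes"
      using ge m by (cases "mx l k") (auto simp: open_shapes_def shape_a_def shape_b_def shape_c_def)
    with ge show "mx l k \<in> open_shapes \<and> m \<le> shape_a (mx l k) \<and> m \<le> shape_b (mx l k) \<and> m \<le> shape_c (mx l k)"
      by simp
  qed
  have rel: "angle_relations (twist_p n) (mx l)" for l
    unfolding mx_def by (rule angle_relations_mix[OF s0(2) s1(2)])
  define \<delta> where "\<delta> k = J_shift b s1 k - J_shift b s0 k" for k
  define y where "y \<zeta> x k = complex_of_real (x k) + \<i> * of_real (J_shift b s0 k) + \<zeta> * of_real (\<delta> k)"
    for \<zeta> and x :: "twist_tet \<Rightarrow> real" and k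
  define F where "F \<zeta> x = J_integrand b n (y \<zeta> x)" for \<zeta> x
  let ?S = "{\<zeta>. - \<eta> < Im \<zeta>} \<inter> {\<zeta>. Im \<zeta> < 1 + \<eta>}"
  let ?G = "\<lambda>\<zeta>. LINT x|Leb ?J. F \<zeta> x"
  have y_eq: "y \<zeta> x = (\<lambda>k. of_real (x k + Re \<zeta> * \<delta> k) + \<i> * of_real (J_shift b (mx (Im \<zeta>)) k))" for \<zeta> x
    unfolding y_def mx_def J_shift_mix \<delta>_def by (rule ext) (simp add: complex_eq_iff algebra_simps)
  have F_eq: "F \<zeta> x = exp (\<i> * of_real (contour_phase b n (mx (Im \<zeta>)))) *
      state_integrand b n (mx (Im \<zeta>)) (\<lambda>k. x k + Re \<zeta> * \<delta> k)" for \<zeta> x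
    unfolding F_def y_eq by (rule J_integrand_on_contour[OF b rel])
  have mx_open: "mx (Im \<zeta>) k \<in> open_shapes" if "\<zeta> \<in> ?S" "k \<in> ?K" for \<zeta> k
    using mx_ge[of "Im \<zeta>"] that unfolding angles_ge_def by auto
  have F_meas: "F \<zeta> \<in> borel_measurable (Leb ?J)" if "\<zeta> \<in> ?S" for \<zeta>
    unfolding F_eq[abs_def]
    by (intro borel_measurable_times borel_measurable_const state_integrand_measurable[OF b mx_open[OF that]]
        borel_measurable_add Leb_component)
  obtain C where C: "C > 0"
    "\<And>s t. angles_ge n m s \<Longrightarrow>
       cmod (state_integrand b n s t) \<le> (\<Prod>k\<in>?J. C * exp (- (m * strip_width b) * \<bar>t k\<bar>)) * C"
    by (rule state_integrand_bound[OF b m, where n = n]) blast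
  have mq: "m * strip_width b > 0" using m strip_width_pos[OF b] by simp
  have F_le: "cmod (F \<zeta> x) \<le> (\<Prod>k\<in>?J. (C * exp (m * strip_width b * (R * \<bar>\<delta> k\<bar>))) * exp (- (m * strip_width b) * \<bar>x k\<bar>)) * C"
    if \<zeta>: "\<zeta> \<in> ?S" "\<bar>Re \<zeta>\<bar> \<le> R" for \<zeta> x R
  proof -
    have "cmod (F \<zeta> x) = cmod (state_integrand b n (mx (Im \<zeta>)) (\<lambda>k. x k + Re \<zeta> * \<delta> k))"
      unfolding F_eq norm_mult by simp
    also have "\<dots> \<le> (\<Prod>k\<in>?J. C * exp (- (m * strip_width b) * \<bar>x k + Re \<zeta> * \<delta> k\<bar>)) * C"
      using \<zeta> by (intro C(2) mx_ge) auto
    also have "\<dots> \<le> (\<Prod>k\<in>?J. (C * exp (m * strip_width b * (R * \<bar>\<delta> k\<bar>))) * exp (- (m * strip_width b) * \<bar>x k\<bar>)) * C"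
    proof (intro mult_right_mono prod_mono conjI)
      fix k
      have "\<bar>x k\<bar> \<le> \<bar>x k + Re \<zeta> * \<delta> k\<bar> + \<bar>Re \<zeta> * \<delta> k\<bar>" by linarith
      also have "\<bar>Re \<zeta> * \<delta> k\<bar> \<le> R * \<bar>\<delta> k\<bar>" using \<zeta>(2) by (simp add: abs_mult mult_right_mono)
      finally have "\<bar>x k\<bar> - R * \<bar>\<delta> k\<bar> \<le> \<bar>x k + Re \<zeta> * \<delta> k\<bar>" by simp
      then have "m * strip_width b * (\<bar>x k\<bar> - R * \<bar>\<delta> k\<bar>) \<le> m * strip_width b * \<bar>x k + Re \<zeta> * \<delta> k\<bar>"
        using mq by (intro mult_left_mono) auto
      then have "exp (- (m * strip_width b) * \<bar>x k + Re \<zeta> * \<delta> k\<bar>) \<le>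
          exp (m * strip_width b * (R * \<bar>\<delta> k\<bar>) + - (m * strip_width b) * \<bar>x k\<bar>)"
        unfolding exp_le_cancel_iff by (simp add: algebra_simps)
      then show "C * exp (- (m * strip_width b) * \<bar>x k + Re \<zeta> * \<delta> k\<bar>) \<le>
          (C * exp (m * strip_width b * (R * \<bar>\<delta> k\<bar>))) * exp (- (m * strip_width b) * \<bar>x k\<bar>)"
        unfolding exp_add mult.assoc using C(1) by (intro mult_left_mono) auto
    qed (use C(1) in auto)
    finally show ?thesis .
  qed
  have "?G 0 = ?G \<i>"
  proof (rule constant_if_invariant_under_real_translations[where S = ?S and G = ?G])
    show S: "open ?S"
      by (intro open_Int open_halfspace_Im_gt open_halfspace_Im_lt)
    show "connected ?S"
      by (intro convex_connected convex_Int convex_halfspace_Im_gt convex_halfspace_Im_lt)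
    show "?G holomorphic_on ?S"
    proof (rule holomorphic_integral[OF S F_meas])
      fix x
      have yh: "(\<lambda>\<zeta>. y \<zeta> x k) holomorphic_on ?S" for k
        unfolding y_def by (intro holomorphic_intros)
      have strip: "\<bar>Im (y \<zeta> x k)\<bar> < strip_width b / 2" if "\<zeta> \<in> ?S" "k \<in> ?J" for \<zeta> k
        using tet_argument_in_strip[OF b mx_open[OF that(1)] twist_sign_cases[of k]] that(2)
        unfolding y_eq by (simp add: J_shift_eq[OF b that(2)])
      have qh: "(\<lambda>\<zeta>. qdilog b (y \<zeta> x k)) holomorphic_on ?S" if "k \<in> ?J" for k
        using holomorphic_on_compose_gen[OF yh[of k] qdilog_holomorphic[OF b]] strip that by (auto simp: o_def)
      have qh': "(\<lambda>\<zeta>. qdilog b (- y \<zeta> x k)) holomorphic_on ?S" if "k \<in> ?J" for k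
      proof -
        have "(\<lambda>\<zeta>. - y \<zeta> x k) ` ?S \<subseteq> {z. \<bar>Im z\<bar> < strip_width b / 2}"
        proof
          fix w assume "w \<in> (\<lambda>\<zeta>. - y \<zeta> x k) ` ?S"
          then obtain \<zeta> where "\<zeta> \<in> ?S" "w = - y \<zeta> x k" by blast
          then show "w \<in> {z. \<bar>Im z\<bar> < strip_width b / 2}" using strip[OF _ that, of \<zeta>] by simp
        qed
        from holomorphic_on_compose_gen[OF holomorphic_on_minus[OF yh[of k]] qdilog_holomorphic[OF b] this]
        show ?thesis by (simp add: o_def)
      qed
      have nz: "qdilog b (y \<zeta> x k) \<noteq> 0" if "\<zeta> \<in> ?S" "k \<in> ?J" for \<zeta> k
        by (rule qdilog_nonzero[OF b strip[OF that]])
      show "(\<lambda>\<zeta>. F \<zeta> x) holomorphic_on ?S"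
        unfolding F_def J_integrand_def divide_inverse[of _ "of_real (sqrt (hbar b))"]
        by (intro holomorphic_on_divide holomorphic_on_mult holomorphic_on_exp' holomorphic_on_add
            holomorphic_on_sum holomorphic_on_prod holomorphic_on_const yh qh qh')
           (use nz in \<open>auto simp: prod_zero_iff\<close>)
    next
      fix \<zeta>0 assume "\<zeta>0 \<in> ?S"
      then obtain r where r: "r > 0" "cball \<zeta>0 r \<subseteq> ?S"
        using S by (meson open_contains_cball)
      have ball: "\<bar>Re \<zeta>\<bar> \<le> \<bar>Re \<zeta>0\<bar> + r" if "\<zeta> \<in> cball \<zeta>0 r" for \<zeta>
        using that abs_Re_le_cmod[of "\<zeta>0 - \<zeta>"] by (auto simp: dist_norm)
      show "\<exists>r>0. \<exists>h. integrable (Leb ?J) h \<and> cball \<zeta>0 r \<subseteq> ?S \<and>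
          (\<forall>\<zeta>\<in>cball \<zeta>0 r. \<forall>x\<in>space (Leb ?J). cmod (F \<zeta> x) \<le> h x)"
      proof (intro exI conjI ballI)
        show "integrable (Leb ?J) (\<lambda>x. (\<Prod>k\<in>?J. (C * exp (m * strip_width b * ((\<bar>Re \<zeta>0\<bar> + r) * \<bar>\<delta> k\<bar>))) *
            exp (- (m * strip_width b) * \<bar>x k\<bar>)) * C)"
          by (rule integrable_exp_prod[OF b m]) simp
        fix \<zeta> x assume "\<zeta> \<in> cball \<zeta>0 r"
        then show "cmod (F \<zeta> x) \<le> (\<Prod>k\<in>?J. (C * exp (m * strip_width b * ((\<bar>Re \<zeta>0\<bar> + r) * \<bar>\<delta> k\<bar>))) *
            exp (- (m * strip_width b) * \<bar>x k\<bar>)) * C"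
          using subsetD[OF r(2)] ball by (intro F_le)
      qed (use r in auto)
    qed
    show "?G (\<zeta> + of_real r) = ?G \<zeta>" if "\<zeta> \<in> ?S" for \<zeta> r
    proof -
      have "?G \<zeta> = of_real (\<Prod>k\<in>?J. \<bar>1\<bar>) * (LINT x|Leb ?J. F \<zeta> (\<lambda>k\<in>?J. x k + r * \<delta> k))"
        by (rule integral_triangular_affine[where rank = "\<lambda>_. 0" and c = "\<lambda>_. 1"])
           (auto intro!: F_meas[OF that] borel_measurable_add Leb_component)
      also have "(\<lambda>x. F \<zeta> (\<lambda>k\<in>?J. x k + r * \<delta> k)) = F (\<zeta> + of_real r)"
        unfolding F_def by (rule ext, rule J_integrand_cong) (simp add: y_def algebra_simps)
      finally show ?thesis by simp
    qed
  qed (use \<eta> in auto)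
  moreover have "?G 0 = J_value b n s0"
    unfolding J_value_def F_def y_def by simp
  moreover have "?G \<i> = J_value b n s1"
    unfolding J_value_def F_def y_def \<delta>_def by (simp add: algebra_simps)
  ultimately show ?thesis by simp
qed

theorem theorem8p6:
  fixes n :: nat and b :: real and \<tau> :: "twist_tet \<Rightarrow> shape"
  assumes "n > 0" and "even n"
    and "b > 0"
    and "\<tau> \<in> shape_structures_closed_at (Y_tri n) Z"
    and "weight \<tau> (knot_edge n) = 0"
    and "\<forall>e \<in> edges (Y_tri n) - {knot_edge n}. weight \<tau> e = 2 * pi"
  shows "\<exists>L. ((\<lambda>\<alpha>. qdilog b (of_real (pi - weight \<alpha> (knot_edge n)) /
                               (2 * of_real pi * \<i> * of_real (sqrt (hbar b)))) *
                    partition_function b (Y_tri n) \<alpha>)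
              \<longlongrightarrow> L) (at \<tau> within shape_structures (Y_tri n)) \<and>
             (\<forall>\<beta> \<in> angle_structures (X_tri n).
                shape_a (\<beta> U) = shape_a (\<beta> V) \<longrightarrow> cmod L = cmod (J_value b n \<beta>))"
proof (intro exI conjI ballI impI)
  note b = assms(3)
  show "((\<lambda>\<alpha>. qdilog b (of_real (pi - weight \<alpha> (knot_edge n)) /
                 (2 * of_real pi * \<i> * of_real (sqrt (hbar b)))) * partition_function b (Y_tri n) \<alpha>)
         \<longlongrightarrow> state_integral b n \<tau>) (at \<tau> within shape_structures (Y_tri n))"
  proof (rule Lim_transform_eventually[OF state_integral_tendsto[OF b assms(4)]])
    have "\<forall>\<^sub>F \<alpha> in at \<tau> within shape_structures (Y_tri n). \<alpha> \<in> shape_structures (Y_tri n)"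
      by (simp add: eventually_at_filter)
    then show "\<forall>\<^sub>F \<alpha> in at \<tau> within shape_structures (Y_tri n). state_integral b n \<alpha> =
        qdilog b (of_real (pi - weight \<alpha> (knot_edge n)) /
                 (2 * of_real pi * \<i> * of_real (sqrt (hbar b)))) * partition_function b (Y_tri n) \<alpha>"
    proof eventually_elim
      case (elim \<alpha>)
      then show ?case
        unfolding partition_function_eq[OF b elim] mult.assoc[symmetric] prefactor_cancels[OF b elim] by simp
    qed
  qed
  fix \<beta> assume \<beta>: "\<beta> \<in> angle_structures (X_tri n)" "shape_a (\<beta> U) = shape_a (\<beta> V)"
  have \<tau>o: "\<tau> k \<in> open_shapes" if k: "k \<in> insert V (J_index n)" for k
  proof -
    have "k \<in> tets (Y_tri n)" "k \<noteq> Z" using k by (auto simp: tets_Y_insert)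
    then show ?thesis using PiE_mem[OF assms(4)[unfolded shape_structures_closed_at_def], of k] by simp
  qed
  have \<beta>o: "\<beta> k \<in> open_shapes" if k: "k \<in> insert V (J_index n)" for k
  proof -
    have "\<beta> \<in> (\<Pi>\<^sub>E k \<in> tets (X_tri n). open_shapes)" "k \<in> tets (X_tri n)"
      using \<beta>(1) k by (auto simp: angle_structures_def shape_structures_def tets_simps J_index_def)
    then show ?thesis by (rule PiE_mem)
  qed
  have rel: "angle_relations (twist_p n) \<tau>" by (rule angle_relations_Y[OF assms(4-6)])
  have "J_value b n \<beta> = J_value b n \<tau>"
    by (rule J_value_independent[OF b \<beta>o angle_relations_X[OF \<beta>] \<tau>o rel])
  then show "cmod (state_integral b n \<tau>) = cmod (J_value b n \<beta>)"
    by (simp add: J_value_eq[OF b rel] norm_mult)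
qed

end
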